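(* For every $\delta>0$ the parameters $Q$, $r$, $k_0$, $\eta$, $v_s$, $v_s'$ described in the context can be chosen so that, with $u_0\equiv0$ and $$b_0=\frac{Q}{\sqrt r}\sum_{i=1}^r\bigl(|k_i|v_i\cos(k_i\cdot x)+|k_i'|v_i'\cos(k_i'\cdot x)\bigr),$$ one has $\|b_0\|_{\dot B^{-1,\infty}_\infty}\lesssim\delta$, and there exist a time $T$ with $0<T<\delta$ and a solution $(u,b,p)$ on $\mathbb{T}^3\times[0,T]$ of $$u_t-\Delta u+u\cdot\nabla u-b\cdot\nabla b+\nabla p=0,\qquad b_t-\Delta b+u\cdot\nabla b-b\cdot\nabla u=0,\qquad \nabla\cdot u=0,\quad \nabla\cdot b=0,$$ with $u(\cdot,0)=u_0$, $b(\cdot,0)=b_0$, satisfying $$\|u(T)\|_{\dot B^{-1,\infty}_\infty}\gtrsim\frac1\delta,$$ while for all $0<t<T$ $$\|b(t)\|_{B^{-1,\infty}_\infty}\lesssim\delta .$$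
   Context: $\mathbb{T}^3$ is the flat three-dimensional torus; functions on it are identified with periodic functions on $\mathbb{R}^3$, and wave vectors are chosen so that the plane waves below are functions on $\mathbb{T}^3$. $u,b$ are $\mathbb{R}^3$-valued (velocity and magnetic field), $p$ is the scalar pressure. $e^{t\Delta}$ is the heat semigroup. Norms: $\|f\|_{\dot B^{-1,\infty}_\infty}=\sup_{t>0}t^{1/2}\|e^{t\Delta}f\|_{L^\infty}$ and $\|f\|_{B^{-1,\infty}_\infty}=\sup_{0<t<1}t^{1/2}\|e^{t\Delta}f\|_{L^\infty}$. $A\lesssim B$ means $A\le CB$ for an absolute constant $C>0$ (independent of $\delta$), and $A\gtrsim B$ means $B\lesssim A$. Parameters: $Q>0$ is a (large) number and $r\ge1$ an integer. $k_0\in\mathbb{R}^3$ is a nonzero vector, with $|k_0|$ large depending on $Q$. For $s=1,\dots,r$ the wave vectors $k_s\in\mathbb{R}^3$ are parallel to $k_0$ with $|k_s|=2^s|k_0||k_{s-1}|$, and $k_s'=k_s-\eta$ for a fixed $\eta\in\mathbb{S}^2$ (unit sphere of $\mathbb{R}^3$). The amplitude vectors $v_s,v_s'\in\mathbb{S}^2$ satisfy $k_s\cdot v_s=k_s'\cdot v_s'=0$, $\eta\cdot v_s=0$, $\eta\cdot v_s'=\tfrac12$, and $v_s=v$ is a fixed vector independent of $s$. *)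

theory Defs
  imports "HOL-Analysis.Analysis" "HOL-Probability.Essential_Supremum"
begin

text \<open>Functions on the flat torus are functions on \<open>real ^ 3\<close> with period \<open>2 * pi\<close> in each
  coordinate; a plane wave \<open>cos (k \<bullet> x)\<close> is then a function on the torus iff \<open>k\<close> has
  integer coordinates.\<close>

definition torus_fun :: "(real ^ 3 \<Rightarrow> 'a) \<Rightarrow> bool" where
  "torus_fun f \<longleftrightarrow> (\<forall>x j. f (x + (2 * pi) *\<^sub>R axis j 1) = f x)"

text \<open>For bounded measurable periodic functions, convolution with the heat kernel of the whole
  space is the heat semigroup of the torus, and the essential supremum over the whole space is the
  one over the torus.\<close>

definition heat_semigroup :: "real \<Rightarrow> (real ^ 3 \<Rightarrow> real ^ 3) \<Rightarrow> real ^ 3 \<Rightarrow> real ^ 3" where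
  "heat_semigroup t f x =
     (LINT y|lborel. ((4 * pi * t) powr (- 3 / 2) * exp (- (norm (x - y))\<^sup>2 / (4 * t))) *\<^sub>R f y)"

definition Linfty_norm :: "(real ^ 3 \<Rightarrow> real ^ 3) \<Rightarrow> ennreal" where
  "Linfty_norm f = esssup lborel (\<lambda>x. ennreal (norm (f x)))"

definition hom_besov_norm :: "(real ^ 3 \<Rightarrow> real ^ 3) \<Rightarrow> ennreal" where
  "hom_besov_norm f = (SUP t\<in>{0<..}. ennreal (t powr (1 / 2)) * Linfty_norm (heat_semigroup t f))"

definition besov_norm :: "(real ^ 3 \<Rightarrow> real ^ 3) \<Rightarrow> ennreal" where
  "besov_norm f = (SUP t\<in>{0<..<1}. ennreal (t powr (1 / 2)) * Linfty_norm (heat_semigroup t f))"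

definition partial :: "3 \<Rightarrow> (real ^ 3 \<Rightarrow> 'a::real_normed_vector) \<Rightarrow> real ^ 3 \<Rightarrow> 'a" where
  "partial j f x = frechet_derivative f (at x) (axis j 1)"

definition grad :: "(real ^ 3 \<Rightarrow> real) \<Rightarrow> real ^ 3 \<Rightarrow> real ^ 3" where
  "grad q x = (\<chi> j. partial j q x)"

definition divergence :: "(real ^ 3 \<Rightarrow> real ^ 3) \<Rightarrow> real ^ 3 \<Rightarrow> real" where
  "divergence f x = (\<Sum>j\<in>UNIV. partial j f x $ j)"

definition laplacian :: "(real ^ 3 \<Rightarrow> real ^ 3) \<Rightarrow> real ^ 3 \<Rightarrow> real ^ 3" where
  "laplacian f x = (\<Sum>j\<in>UNIV. partial j (partial j f) x)"

definition advect :: "(real ^ 3 \<Rightarrow> real ^ 3) \<Rightarrow> (real ^ 3 \<Rightarrow> real ^ 3) \<Rightarrow> real ^ 3 \<Rightarrow> real ^ 3" where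
  "advect a f x = (\<Sum>j\<in>UNIV. (a x $ j) *\<^sub>R partial j f x)"

text \<open>One-sided at the end points of \<open>{0..T}\<close>.\<close>

definition time_deriv :: "real \<Rightarrow> (real \<Rightarrow> real ^ 3 \<Rightarrow> real ^ 3) \<Rightarrow> real \<Rightarrow> real ^ 3 \<Rightarrow> real ^ 3" where
  "time_deriv T f t x = vector_derivative (\<lambda>s. f s x) (at t within {0..T})"

text \<open>\<open>f\<close> is once continuously differentiable in time and twice in space, up to both end points
  of the time interval.\<close>

definition C12 :: "real \<Rightarrow> (real \<Rightarrow> real ^ 3 \<Rightarrow> real ^ 3) \<Rightarrow> bool" where
  "C12 T f \<longleftrightarrow>
     (\<forall>t\<in>{0..T}. \<forall>x. (\<lambda>s. f s x) differentiable (at t within {0..T})) \<and>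
     (\<forall>t\<in>{0..T}. \<forall>x. f t differentiable (at x)) \<and>
     (\<forall>t\<in>{0..T}. \<forall>j x. partial j (f t) differentiable (at x)) \<and>
     continuous_on ({0..T} \<times> UNIV) (\<lambda>(t, x). f t x) \<and>
     continuous_on ({0..T} \<times> UNIV) (\<lambda>(t, x). time_deriv T f t x) \<and>
     (\<forall>j. continuous_on ({0..T} \<times> UNIV) (\<lambda>(t, x). partial j (f t) x)) \<and>
     (\<forall>i j. continuous_on ({0..T} \<times> UNIV) (\<lambda>(t, x). partial i (partial j (f t)) x))"

definition C01 :: "real \<Rightarrow> (real \<Rightarrow> real ^ 3 \<Rightarrow> real) \<Rightarrow> bool" where
  "C01 T q \<longleftrightarrow>
     (\<forall>t\<in>{0..T}. \<forall>x. q t differentiable (at x)) \<and>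
     continuous_on ({0..T} \<times> UNIV) (\<lambda>(t, x). q t x) \<and>
     continuous_on ({0..T} \<times> UNIV) (\<lambda>(t, x). grad (q t) x)"

text \<open>Classical solutions on the torus over the closed time interval. The pressure is required to
  be periodic too, so that no mean pressure gradient can drive the flow.\<close>

definition mhd_solution ::
  "real \<Rightarrow> (real \<Rightarrow> real ^ 3 \<Rightarrow> real ^ 3) \<Rightarrow> (real \<Rightarrow> real ^ 3 \<Rightarrow> real ^ 3) \<Rightarrow>
   (real \<Rightarrow> real ^ 3 \<Rightarrow> real) \<Rightarrow> bool" where
  "mhd_solution T u b p \<longleftrightarrow>
     C12 T u \<and> C12 T b \<and> C01 T p \<and>
     (\<forall>t\<in>{0..T}. torus_fun (u t) \<and> torus_fun (b t) \<and> torus_fun (p t)) \<and>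
     (\<forall>t\<in>{0..T}. \<forall>x.
        time_deriv T u t x - laplacian (u t) x + advect (u t) (u t) x
          - advect (b t) (b t) x + grad (p t) x = 0 \<and>
        time_deriv T b t x - laplacian (b t) x + advect (u t) (b t) x
          - advect (b t) (u t) x = 0 \<and>
        divergence (u t) x = 0 \<and> divergence (b t) x = 0)"

text \<open>The vector called \<open>k\<^sub>0\<close> is \<open>k 0\<close>; only the indices \<open>1..r\<close> of \<open>k'\<close>,
  \<open>v\<close>, \<open>v'\<close> matter. That \<open>Q\<close> and the length of \<open>k 0\<close> are large is no separate
  condition: these parameters are chosen existentially.\<close>

definition wave_parameters ::
  "real \<Rightarrow> nat \<Rightarrow> (nat \<Rightarrow> real ^ 3) \<Rightarrow> (nat \<Rightarrow> real ^ 3) \<Rightarrow> real ^ 3 \<Rightarrow>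
   (nat \<Rightarrow> real ^ 3) \<Rightarrow> (nat \<Rightarrow> real ^ 3) \<Rightarrow> bool" where
  "wave_parameters Q r k k' \<eta> v v' \<longleftrightarrow>
     0 < Q \<and> 1 \<le> r \<and> k 0 \<noteq> 0 \<and> \<eta> \<in> sphere 0 1 \<and>
     (\<forall>s\<in>{1..r}.
        (\<exists>c. k s = c *\<^sub>R k 0) \<and>
        norm (k s) = 2 ^ s * norm (k 0) * norm (k (s - 1)) \<and>
        k' s = k s - \<eta> \<and>
        torus_fun (\<lambda>x. cos (k s \<bullet> x)) \<and> torus_fun (\<lambda>x. cos (k' s \<bullet> x)) \<and>
        v s \<in> sphere 0 1 \<and> v' s \<in> sphere 0 1 \<and>
        k s \<bullet> v s = 0 \<and> k' s \<bullet> v' s = 0 \<and>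
        \<eta> \<bullet> v s = 0 \<and> \<eta> \<bullet> v' s = 1 / 2) \<and>
     (\<exists>w. \<forall>s\<in>{1..r}. v s = w)"

definition b_init ::
  "real \<Rightarrow> nat \<Rightarrow> (nat \<Rightarrow> real ^ 3) \<Rightarrow> (nat \<Rightarrow> real ^ 3) \<Rightarrow>
   (nat \<Rightarrow> real ^ 3) \<Rightarrow> (nat \<Rightarrow> real ^ 3) \<Rightarrow> real ^ 3 \<Rightarrow> real ^ 3" where
  "b_init Q r k k' v v' x =
     (Q / sqrt (real r)) *\<^sub>R
       (\<Sum>i=1..r. (norm (k i) * cos (k i \<bullet> x)) *\<^sub>R v i
                + (norm (k' i) * cos (k' i \<bullet> x)) *\<^sub>R v' i)"

end

theory Submission
  imports Defs "HOL-Probability.Characteristic_Functions"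
begin

text \<open>Take \<open>\<eta> = (0, 1, 0)\<close>, \<open>k\<^sub>s = (m\<^sub>s, 0, 0)\<close> and \<open>v = (0, 0, 1)\<close>. Then everything lives on Fourier modes
  with vanishing third frequency, \<open>u\<close> is a sine and \<open>b\<close> a cosine series, and the linear evolution of
  \<open>b\<^sub>0\<close> drives \<open>u\<close> through \<open>b \<cdot> \<nabla>b\<close>. The waves \<open>k\<^sub>s\<close> and \<open>k\<^sub>s - \<eta>\<close> resonate at the mode \<open>\<eta>\<close>, where each of the
  \<open>r\<close> pairs adds an amount of order \<open>Q\<^sup>2 / r\<close> to \<open>u\<close> within the time \<open>T = 1 / |k\<^sub>1|\<^sup>2\<close>; all other interactions
  have high frequency and hence a small Besov norm.

  The remainder \<open>w\<close> of the solution is the limit of a Picard iteration in a weighted Wiener algebra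
  \<open>\<Sum>k. W k * sup\<^sub>t |w\<^sub>k(t)| / E t\<close>. The bilinear term is small because of the short time. The term linear
  in \<open>w\<close> is critical and has a large coefficient depending on \<open>Q\<close> and \<open>r\<close>, but the exponential weight
  \<open>E\<close> in time, which is bounded independently of \<open>|k\<^sub>0|\<close>, turns it into a contraction. Since \<open>Q\<close> and
  \<open>r\<close> are fixed in terms of \<open>\<delta>\<close> before \<open>|k\<^sub>0|\<close> is chosen, all error terms are \<open>O(1 / |k\<^sub>1|)\<close>.\<close>

section \<open>Infinite sums\<close>

text \<open>The term linear in the remainder offers no smallness: a data wave has size |j| exp (-
  |j|^2 s), the nonlinearity costs a factor |k|, and the heat kernel returns exp (- |k|^2 (t - s)).
  Both factors are square integrable in time with a norm independent of the frequency, so a shorter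
  time gains nothing. The weight \<open>E\<close> is built for this: its logarithmic derivative is
  lam times the sum of 2 |j|^2 exp (- 2 |j|^2 s), so Young's inequality gains 1 / sqrt lam, while
  \<open>E\<close> stays below exp (lam * card J) whatever the frequencies. The self-interaction of
  the data looks worse, of cubic size |j| |l| |j + l|. The orthogonality relations reduce it to
  |j|^2 + |l|^2, the very rate at which the product of the two waves decays. The data are purely
  magnetic, so their self-interaction forces only the velocity; \<open>b\<close> leaves its free
  evolution by the remainder alone. With Q^2 = 1 / d and r >= 1 / d^3, where d = min \<delta> 1, the
  amplitude B0 = Q / sqrt r is at most d, while B0^2 * r = 1 / d governs the velocity.\<close>

lemma summable_norm_bound:
  fixes f :: "'i \<Rightarrow> 'b::banach"
  assumes "m summable_on A" and "\<And>i. i \<in> A \<Longrightarrow> norm (f i) \<le> m i"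
  shows "f summable_on A" "(\<lambda>i. norm (f i)) summable_on A"
    "norm (infsum f A) \<le> infsum m A"
proof -
  show 1: "(\<lambda>i. norm (f i)) summable_on A"
    using Infinite_Sum.abs_summable_on_comparison_test'[OF assms(1)] assms(2) by blast
  show 2: "f summable_on A"
    using abs_summable_summable[OF 1] .
  show "norm (infsum f A) \<le> infsum m A"
    using norm_infsum_le[OF has_sum_infsum[OF 2] has_sum_infsum[OF assms(1)]] assms(2) by blast
qed

lemma infsum_diff:
  fixes f g :: "'i \<Rightarrow> 'b::real_normed_vector"
  assumes "f summable_on A" "g summable_on A"
  shows "infsum (\<lambda>i. f i - g i) A = infsum f A - infsum g A"
  using infsum_add[OF assms(1), of "\<lambda>i. - g i"] assms(2)
  by (simp add: summable_on_uminus infsum_uminus)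

lemma infsum_diff_finite_norm_le:
  fixes f :: "'i \<Rightarrow> 'b::banach"
  assumes "m summable_on UNIV" and "\<And>i. norm (f i) \<le> m i" and "finite F"
  shows "norm ((\<Sum>\<^sub>\<infinity>i. f i) - (\<Sum>i\<in>F. f i)) \<le> (\<Sum>\<^sub>\<infinity>i. m i) - (\<Sum>i\<in>F. m i)"
proof -
  have f: "f summable_on A" and m: "m summable_on A" for A
  proof -
    show m: "m summable_on A" using summable_on_subset_banach[OF assms(1)] by blast
    show "f summable_on A" using summable_norm_bound(1)[OF m] assms(2) by blast
  qed
  have "(\<Sum>\<^sub>\<infinity>i. f i) = infsum f F + infsum f (-F)"
    using infsum_Un_disjoint[OF f f, of F "-F"] by (simp add: Compl_partition)
  moreover have "(\<Sum>\<^sub>\<infinity>i. m i) = infsum m F + infsum m (-F)"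
    using infsum_Un_disjoint[OF m m, of F "-F"] by (simp add: Compl_partition)
  moreover have "norm (infsum f (-F)) \<le> infsum m (-F)"
    using summable_norm_bound(3)[OF m] assms(2) by blast
  ultimately show ?thesis using assms(3) by simp
qed

lemma finite_tail_small:
  fixes m :: "'i \<Rightarrow> real"
  assumes "m summable_on UNIV" and "0 < e"
  obtains F where "finite F" "(\<Sum>\<^sub>\<infinity>i. m i) - (\<Sum>i\<in>F. m i) < e"
proof -
  obtain F where F: "finite F" "dist (sum m F) (\<Sum>\<^sub>\<infinity>i. m i) \<le> e/2"
    using infsum_finite_approximation[OF assms(1), of "e/2"] assms(2) by auto
  have "\<bar>sum m F - (\<Sum>\<^sub>\<infinity>i. m i)\<bar> \<le> e/2" using F by (simp add: dist_real_def)
  then have "(\<Sum>\<^sub>\<infinity>i. m i) - sum m F < e" using assms(2) by linarith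
  with F(1) show thesis by (rule that)
qed

lemma continuous_on_infsum:
  fixes f :: "'i \<Rightarrow> 'a::topological_space \<Rightarrow> 'b::banach"
  assumes "\<And>i. continuous_on S (f i)" and "\<And>i x. x \<in> S \<Longrightarrow> norm (f i x) \<le> m i"
    and "m summable_on UNIV"
  shows "continuous_on S (\<lambda>x. \<Sum>\<^sub>\<infinity>i. f i x)"
proof (rule uniform_limit_theorem)
  show "uniform_limit S (\<lambda>X y. \<Sum>x\<in>X. f x y) (\<lambda>x. \<Sum>\<^sub>\<infinity>i. f i x) (finite_subsets_at_top UNIV)"
    by (rule Weierstrass_m_test_general[OF assms(2,3)])
  show "\<forall>\<^sub>F X in finite_subsets_at_top UNIV. continuous_on S (\<lambda>y. \<Sum>x\<in>X. f x y)"
    by (intro always_eventually allI continuous_on_sum assms(1))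
qed simp

text \<open>Split off a finite part; the rest is Lipschitz with a small constant.\<close>

lemma has_derivative_infsum:
  fixes f :: "'i \<Rightarrow> 'a::{real_normed_vector,perfect_space} \<Rightarrow> 'b::banach"
  assumes "convex S"
    and der: "\<And>i x. x \<in> S \<Longrightarrow> (f i has_derivative f' i x) (at x within S)"
    and bd: "\<And>i x h. x \<in> S \<Longrightarrow> norm (f' i x h) \<le> m i * norm h" and m: "m summable_on UNIV"
    and sf: "\<And>x. x \<in> S \<Longrightarrow> (\<lambda>i. f i x) summable_on UNIV" and x: "x \<in> S"
  shows "((\<lambda>x. \<Sum>\<^sub>\<infinity>i. f i x) has_derivative (\<lambda>h. \<Sum>\<^sub>\<infinity>i. f' i x h)) (at x within S)"
proof -
  define g where "g x = (\<Sum>\<^sub>\<infinity>i. f i x)" for x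
  define D where "D h = (\<Sum>\<^sub>\<infinity>i. f' i x h)" for h
  have lin: "linear (f' i x)" for i
    using der[OF x] has_derivative_linear by blast
  have mh: "(\<lambda>i. m i * norm h) summable_on UNIV" for h :: 'a
    using summable_on_cmult_left[OF m] .
  have sD: "(\<lambda>i. f' i x h) summable_on UNIV" for h
    by (rule summable_norm_bound(1)[OF mh]) (rule bd[OF x])
  have bl: "bounded_linear D"
  proof (rule bounded_linear_intro)
    show "D (a + b) = D a + D b" for a b
      unfolding D_def by (simp add: linear_add[OF lin] infsum_add[OF sD sD])
    show "D (r *\<^sub>R a) = r *\<^sub>R D a" for r a
      unfolding D_def by (simp add: linear_cmul[OF lin] infsum_scaleR_right)
    show "norm (D h) \<le> norm h * (\<Sum>\<^sub>\<infinity>i. m i)" for h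
      using summable_norm_bound(3)[OF mh bd[OF x], of h]
      by (simp add: D_def infsum_cmult_left'[of m] mult.commute[of "norm h"])
  qed
  have "\<exists>d>0. \<forall>y\<in>S. norm (y - x) < d \<longrightarrow> norm (g y - g x - D (y - x)) \<le> e * norm (y - x)"
    if e: "0 < e" for e
  proof -
    obtain F where F: "finite F" "(\<Sum>\<^sub>\<infinity>i. m i) - (\<Sum>i\<in>F. m i) < e / 3"
      using finite_tail_small[OF m, of "e/3"] e by auto
    have mg: "m summable_on A" for A
      using summable_on_subset_banach[OF m] by blast
    have tm: "infsum m (-F) < e / 3"
      using infsum_Un_disjoint[OF mg mg, of F "-F"] F by (simp add: Compl_partition)
    have "((\<lambda>x. \<Sum>i\<in>F. f i x) has_derivative (\<lambda>h. \<Sum>i\<in>F. f' i x h)) (at x within S)"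
      by (intro has_derivative_sum der x)
    then obtain d where d: "d > 0" "\<And>y. y \<in> S \<Longrightarrow> norm (y - x) < d \<Longrightarrow>
        norm ((\<Sum>i\<in>F. f i y) - (\<Sum>i\<in>F. f i x) - (\<Sum>i\<in>F. f' i x (y - x))) \<le> e/3 * norm (y - x)"
      unfolding has_derivative_within_alt using e by (meson divide_pos_pos zero_less_numeral)
    have "norm (g y - g x - D (y - x)) \<le> e * norm (y - x)" if y: "y \<in> S" "norm (y - x) < d" for y
    proof -
      have sA: "(\<lambda>i. f i z) summable_on A" if "z \<in> S" for A z
        using summable_on_subset_banach[OF sf[OF that]] by blast
      have sDA: "(\<lambda>i. f' i x h) summable_on A" for A h
        using summable_on_subset_banach[OF sD] by blast
      have lip: "norm (f i y - f i x) \<le> m i * norm (y - x)" for i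
      proof (rule differentiable_bound[OF assms(1) der])
        show "onorm (f' i z) \<le> m i" if "z \<in> S" for z
          by (rule onorm_le) (rule bd[OF that])
      qed (use x y in auto)
      have mn: "(\<lambda>i. m i * norm (y - x)) summable_on -F"
        using summable_on_cmult_left[OF mg] .
      have split: "g z = (\<Sum>i\<in>F. f i z) + infsum (\<lambda>i. f i z) (-F)" if "z \<in> S" for z
        using infsum_Un_disjoint[OF sA[OF that] sA[OF that], of F "-F"] F(1)
        by (simp add: g_def Compl_partition)
      have splitD: "D h = (\<Sum>i\<in>F. f' i x h) + infsum (\<lambda>i. f' i x h) (-F)" for h
        using infsum_Un_disjoint[OF sDA sDA, of F "-F"] F(1) by (simp add: D_def Compl_partition)
      have t: "infsum (\<lambda>i. m i * norm (y - x)) (-F) \<le> e/3 * norm (y - x)"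
        using mult_right_mono[OF less_imp_le[OF tm], of "norm (y - x)"] by (subst infsum_cmult_left') simp
      have t1: "norm (infsum (\<lambda>i. f i y) (-F) - infsum (\<lambda>i. f i x) (-F)) \<le> e/3 * norm (y - x)"
        using order_trans[OF summable_norm_bound(3)[OF mn lip] t]
          infsum_diff[OF sA[OF y(1)] sA[OF x]] by metis
      have t2: "norm (infsum (\<lambda>i. f' i x (y-x)) (-F)) \<le> e/3 * norm (y - x)"
        using order_trans[OF summable_norm_bound(3)[OF mn bd[OF x]] t] .
      have "g y - g x - D (y - x) =
         ((\<Sum>i\<in>F. f i y) - (\<Sum>i\<in>F. f i x) - (\<Sum>i\<in>F. f' i x (y - x)))
         + ((infsum (\<lambda>i. f i y) (-F) - infsum (\<lambda>i. f i x) (-F)) - infsum (\<lambda>i. f' i x (y-x)) (-F))"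
        using split[OF x] split[OF y(1)] splitD by simp
      also have "norm \<dots> \<le> e/3 * norm (y-x) + (e/3 * norm (y-x) + e/3 * norm (y-x))"
        by (intro norm_triangle_le add_mono order_trans[OF norm_triangle_ineq4] t1 t2 d y)
      finally show ?thesis by simp
    qed
    with d(1) show ?thesis by blast
  qed
  with bl have "(g has_derivative D) (at x within S)"
    unfolding has_derivative_within_alt by blast
  then show ?thesis by (simp add: g_def[abs_def] D_def[abs_def])
qed

lemma has_vector_derivative_infsum:
  fixes f :: "'i \<Rightarrow> real \<Rightarrow> 'b::banach"
  assumes "convex S"
    and der: "\<And>i x. x \<in> S \<Longrightarrow> (f i has_vector_derivative f' i x) (at x within S)"
    and bd: "\<And>i x. x \<in> S \<Longrightarrow> norm (f' i x) \<le> m i" and m: "m summable_on UNIV"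
    and sf: "\<And>x. x \<in> S \<Longrightarrow> (\<lambda>i. f i x) summable_on UNIV" and x: "x \<in> S"
  shows "((\<lambda>x. \<Sum>\<^sub>\<infinity>i. f i x) has_vector_derivative (\<Sum>\<^sub>\<infinity>i. f' i x)) (at x within S)"
proof -
  have "((\<lambda>x. \<Sum>\<^sub>\<infinity>i. f i x) has_derivative (\<lambda>h. \<Sum>\<^sub>\<infinity>i. h *\<^sub>R f' i x)) (at x within S)"
    using der bd by (intro has_derivative_infsum[OF assms(1) _ _ m sf x])
      (auto simp: has_vector_derivative_def mult.commute[of _ "\<bar>_\<bar>"] intro!: mult_left_mono)
  then show ?thesis
    by (simp add: has_vector_derivative_def infsum_scaleR_right)
qed

section \<open>Double series along diagonals and discrete convolution\<close>

lemma bij_diagonals: "bij (\<lambda>(k, j). (j, k - j :: 'k::ab_group_add))"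
  by (rule bij_betw_byWitness[where f' = "\<lambda>(j, l). (j + l, j)"]) auto

lemma infsum_diagonals:
  fixes F :: "'k::ab_group_add \<times> 'k \<Rightarrow> 'b::banach"
  assumes "F summable_on UNIV"
  shows "(\<Sum>\<^sub>\<infinity>p. F p) = (\<Sum>\<^sub>\<infinity>k. \<Sum>\<^sub>\<infinity>j. F (j, k - j))"
    and "(\<lambda>k. \<Sum>\<^sub>\<infinity>j. F (j, k - j)) summable_on UNIV"
proof -
  have s: "(\<lambda>(k, j). F (j, k - j)) summable_on UNIV \<times> UNIV"
    using summable_on_reindex_bij_betw[OF bij_diagonals, of F] assms
    by (simp add: case_prod_unfold)
  show "(\<lambda>k. \<Sum>\<^sub>\<infinity>j. F (j, k - j)) summable_on UNIV"
    using summable_on_Sigma_banach[OF s] .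
  show "(\<Sum>\<^sub>\<infinity>p. F p) = (\<Sum>\<^sub>\<infinity>k. \<Sum>\<^sub>\<infinity>j. F (j, k - j))"
    using infsum_Sigma'_banach[OF s] infsum_reindex_bij_betw[OF bij_diagonals, of F]
    by (simp add: case_prod_unfold)
qed

lemma summable_on_pairs:
  fixes x y :: "_ \<Rightarrow> real"
  assumes "x summable_on UNIV" "y summable_on UNIV" "\<And>i. 0 \<le> x i" "\<And>i. 0 \<le> y i"
  shows "(\<lambda>(i, j). x i * y j) summable_on UNIV"
    and "(\<Sum>\<^sub>\<infinity>(i, j). x i * y j) = (\<Sum>\<^sub>\<infinity>i. x i) * (\<Sum>\<^sub>\<infinity>j. y j)"
proof -
  have "(\<lambda>p. norm (case p of (i, j) \<Rightarrow> x i * y j)) summable_on Sigma UNIV (\<lambda>_. UNIV)"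
    unfolding Infinite_Sum.abs_summable_on_Sigma_iff using assms
    by (auto simp: abs_mult infsum_cmult_right' infsum_nonneg
        intro!: summable_on_cmult_right summable_on_cmult_left)
  then show s: "(\<lambda>(i, j). x i * y j) summable_on UNIV"
    using abs_summable_summable by fastforce
  show "(\<Sum>\<^sub>\<infinity>(i, j). x i * y j) = (\<Sum>\<^sub>\<infinity>i. x i) * (\<Sum>\<^sub>\<infinity>j. y j)"
    using infsum_Sigma'_banach[of "\<lambda>i j. x i * y j" UNIV "\<lambda>_. UNIV"] s
    by (simp add: infsum_cmult_right' infsum_cmult_left')
qed

text \<open>The discrete convolution, the Fourier image of a pointwise product; it is applied to
  scalar majorants of Fourier coefficients.\<close>

definition cv :: "('k::ab_group_add \<Rightarrow> real) \<Rightarrow> ('k \<Rightarrow> real) \<Rightarrow> 'k \<Rightarrow> real" where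
  "cv x y k = (\<Sum>\<^sub>\<infinity>j. x j * y (k - j))"

definition nonneg_summable :: "('k \<Rightarrow> real) \<Rightarrow> bool" where
  "nonneg_summable x \<longleftrightarrow> (\<forall>k. 0 \<le> x k) \<and> x summable_on UNIV"

lemma cv_term_summable:
  assumes "nonneg_summable x" "nonneg_summable y"
  shows "(\<lambda>j. x j * y (k - j)) summable_on UNIV"
proof -
  have "y i \<le> (\<Sum>\<^sub>\<infinity>i. y i)" for i
    using finite_sum_le_infsum[of y UNIV "{i}"] assms by (auto simp: nonneg_summable_def)
  then show ?thesis
    using assms summable_norm_bound(1)[OF summable_on_cmult_left[of x UNIV "\<Sum>\<^sub>\<infinity>i. y i"], of "\<lambda>j. x j * y (k - j)"]
    by (auto simp: nonneg_summable_def intro!: mult_left_mono)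
qed

lemma nonneg_summable_cv:
  fixes x y :: "'k::ab_group_add \<Rightarrow> real"
  assumes "nonneg_summable x" "nonneg_summable y"
  shows "nonneg_summable (cv x y)" "(\<Sum>\<^sub>\<infinity>k. cv x y k) = (\<Sum>\<^sub>\<infinity>k. x k) * (\<Sum>\<^sub>\<infinity>k. y k)"
  using infsum_diagonals[OF summable_on_pairs(1)[of x y]] summable_on_pairs(2)[of x y] assms
  by (auto simp: nonneg_summable_def cv_def[abs_def] intro!: infsum_nonneg)

text \<open>Monotone convergence for majorants. The last limit, convergence of the whole sum and not
  only for each \<open>k\<close>, is what allows passing to the limit inside a convolution later
  on.\<close>

lemma infsum_incseq_limit:
  fixes c :: "nat \<Rightarrow> 'k \<Rightarrow> real"
  assumes "\<And>n. nonneg_summable (c n)" and "\<And>n k. c n k \<le> c (Suc n) k"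
    and "\<And>n. (\<Sum>\<^sub>\<infinity>k. c n k) \<le> A"
  obtains c' where "nonneg_summable c'" "(\<Sum>\<^sub>\<infinity>k. c' k) \<le> A" "\<And>n k. c n k \<le> c' k"
    "\<And>k. (\<lambda>n. c n k) \<longlonglongrightarrow> c' k" "(\<lambda>n. \<Sum>\<^sub>\<infinity>k. c' k - c n k) \<longlonglongrightarrow> 0"
proof -
  have inc: "incseq (\<lambda>n. c n k)" for k by (rule incseq_SucI) (rule assms(2))
  have sm: "c n summable_on UNIV" "0 \<le> c n k" for n k
    using assms(1) by (auto simp: nonneg_summable_def)
  have finA: "sum (c n) F \<le> A" if "finite F" for n F
    using finite_sum_le_infsum[OF sm(1) that, of n] sm(2) assms(3)[of n] by fastforce
  have "\<exists>l. (\<lambda>n. c n k) \<longlonglongrightarrow> l \<and> (\<forall>n. c n k \<le> l)" for k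
    by (rule incseq_convergent[OF inc, of k A]) (use finA[of "{k}"] in auto)
  then obtain c' where lim: "\<And>k. (\<lambda>n. c n k) \<longlonglongrightarrow> c' k" and le: "\<And>n k. c n k \<le> c' k"
    by metis
  have nn: "0 \<le> c' k" for k using le[of 0 k] sm(2)[of 0 k] by linarith
  have limF: "(\<lambda>n. sum (c n) F) \<longlonglongrightarrow> sum c' F" for F by (intro tendsto_sum lim)
  have "sum c' F \<le> A" if "finite F" for F
    using LIMSEQ_le_const2[OF limF] finA[OF that] by blast
  then have s: "c' summable_on UNIV"
    using nn by (intro nonneg_bdd_above_summable_on) (auto intro!: bdd_aboveI[of _ A])
  have A: "(\<Sum>\<^sub>\<infinity>k. c' k) \<le> A"
    using \<open>\<And>F. finite F \<Longrightarrow> sum c' F \<le> A\<close> by (intro infsum_le_finite_sums[OF s]) auto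
  have mono: "incseq (\<lambda>n. \<Sum>\<^sub>\<infinity>k. c n k)"
    by (rule incseq_SucI) (intro infsum_mono sm assms(2))
  obtain S where S: "(\<lambda>n. \<Sum>\<^sub>\<infinity>k. c n k) \<longlonglongrightarrow> S" "\<And>n. (\<Sum>\<^sub>\<infinity>k. c n k) \<le> S"
    by (rule incseq_convergent[OF mono, of A]) (use assms(3) in auto)
  \<comment> \<open>Finite sums of \<open>c'\<close> are limits of finite sums of
    \<open>c n\<close>, all of which stay below \<open>S\<close>.\<close>
  have "(\<Sum>\<^sub>\<infinity>k. c' k) \<le> S"
  proof (intro infsum_le_finite_sums[OF s])
    fix F :: "'k set" assume F: "finite F"
    have "sum (c n) F \<le> S" for n
      using finite_sum_le_infsum[OF sm(1) F, of n] sm(2) S(2)[of n] by fastforce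
    then show "sum c' F \<le> S" using LIMSEQ_le_const2[OF limF] by blast
  qed
  moreover have "S \<le> (\<Sum>\<^sub>\<infinity>k. c' k)"
    by (rule LIMSEQ_le_const2[OF S(1)]) (intro exI allI impI infsum_mono sm s le)
  ultimately have "S = (\<Sum>\<^sub>\<infinity>k. c' k)" by simp
  then have "(\<lambda>n. \<Sum>\<^sub>\<infinity>k. c' k - c n k) \<longlonglongrightarrow> 0"
    using S(1) tendsto_diff[OF tendsto_const S(1), of S] by (simp add: infsum_diff[OF s sm(1)])
  with s nn A le lim show thesis by (intro that[of c']) (auto simp: nonneg_summable_def)
qed

section \<open>The heat semigroup on plane waves\<close>

abbreviation heat_kernel :: "real \<Rightarrow> real ^ 3 \<Rightarrow> real ^ 3 \<Rightarrow> real" where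
  "heat_kernel t x y \<equiv> (4 * pi * t) powr (- 3 / 2) * exp (- (norm (x - y))\<^sup>2 / (4 * t))"

text \<open>The substitution \<open>y = m + s * z\<close> reduces the Fourier transform of a
  Gaussian to the characteristic function of the standard normal distribution.\<close>

lemma normal_density_cis:
  fixes k m s :: real
  assumes "0 < s"
  shows "integrable lborel (\<lambda>y. complex_of_real (normal_density m s y) * cis (k * y))"
    and "(LINT y|lborel. complex_of_real (normal_density m s y) * cis (k * y))
      = cis (k * m) * exp (- (s * k)\<^sup>2 / 2)"
proof -
  have "integrable lborel (\<lambda>y. complex_of_real (normal_density m s y))"
    using integrable_normal_density[OF assms] by simp
  then show "integrable lborel (\<lambda>y. complex_of_real (normal_density m s y) * cis (k * y))"
    by (rule Bochner_Integration.integrable_bound)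
       (auto simp: norm_mult cis_conv_exp intro!: AE_I2)
  have nd: "s * normal_density m s (m + s * z) = std_normal_density z" for z
    using assms by (simp add: normal_density_def real_sqrt_mult power_mult_distrib)
  have "(LINT y|lborel. complex_of_real (normal_density m s y) * cis (k * y))
      = s *\<^sub>R (LINT z|lborel. complex_of_real (normal_density m s (m + s * z)) * cis (k * (m + s * z)))"
    using lborel_integral_real_affine[of s _ m] assms by simp
  also have "\<dots> = (LINT z|lborel. cis (k * m) * (complex_of_real (std_normal_density z) * cis (s * k * z)))"
    unfolding integral_scaleR_right[symmetric] nd[symmetric]
    by (intro Bochner_Integration.integral_cong)
       (simp_all add: scaleR_conv_of_real cis_mult[symmetric] algebra_simps)
  also have "\<dots> = cis (k * m) * (LINT z|lborel. complex_of_real (std_normal_density z) * cis (s * k * z))"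
    by simp
  also have "(LINT z|lborel. complex_of_real (std_normal_density z) * cis (s * k * z))
     = char std_normal_distribution (s * k)"
    unfolding char_def
    by (subst integral_density) (auto simp: cis_conv_exp scaleR_conv_of_real intro!: Bochner_Integration.integral_cong)
  also have "\<dots> = exp (- (s * k)\<^sup>2 / 2)"
    by (simp add: char_std_normal_distribution exp_of_real[symmetric])
  finally show "(LINT y|lborel. complex_of_real (normal_density m s y) * cis (k * y))
      = cis (k * m) * exp (- (s * k)\<^sup>2 / 2)" .
qed

text \<open>Fubini for a product of functions of one coordinate each. By definition
  \<open>lborel\<close> is the image of a product of copies of
  \<open>interval_measure (\<lambda>x. x)\<close>, so the facts on finite product measures apply
  after a change of variables.\<close>

lemma lborel_integral_prod:
  fixes f :: "'a::euclidean_space \<Rightarrow> real \<Rightarrow> complex"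
  assumes "\<And>b. b \<in> Basis \<Longrightarrow> integrable lborel (f b)"
  shows "integrable lborel (\<lambda>y::'a. \<Prod>b\<in>Basis. f b (y \<bullet> b))"
    "(LINT y|lborel. (\<Prod>b\<in>Basis. f b (y \<bullet> b))) = (\<Prod>b\<in>Basis. LINT x|lborel. f b x)"
proof -
  interpret product_sigma_finite "\<lambda>_::'a. interval_measure (\<lambda>x. x)"
    by standard (use lborel_eq_real lborel.sigma_finite_measure_axioms sigma_finite_measure.sigma_finite_countable in metis)
  let ?P = "\<Pi>\<^sub>M b\<in>(Basis::'a set). interval_measure (\<lambda>x. x)"
  let ?e = "\<lambda>f::'a \<Rightarrow> real. \<Sum>b\<in>Basis. f b *\<^sub>R b"
  have me[measurable]: "?e \<in> ?P \<rightarrow>\<^sub>M borel" by measurable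
  have mf[measurable]: "f b \<in> borel_measurable borel" if "b \<in> Basis" for b
    using assms[OF that] by (simp add: borel_measurable_integrable)
  have mp[measurable]: "(\<lambda>y::'a. \<Prod>b\<in>Basis. f b (y \<bullet> b)) \<in> borel_measurable borel"
    by measurable
  have e: "(\<Prod>b\<in>Basis. f b (?e x \<bullet> b)) = (\<Prod>b\<in>Basis. f b (x b))" for x
    by (intro prod.cong refl) (simp add: inner_sum_left inner_Basis if_distrib cong: if_cong)
  have "integrable ?P (\<lambda>x. \<Prod>b\<in>Basis. f b (x b))"
    using assms by (intro product_integrable_prod) (auto simp: lborel_eq_real)
  then show "integrable lborel (\<lambda>y::'a. \<Prod>b\<in>Basis. f b (y \<bullet> b))"
    unfolding lborel_def by (subst integrable_distr_eq) (simp_all add: e)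
  have "(LINT y|lborel. (\<Prod>b\<in>Basis. f b (y \<bullet> b))) = (LINT x|?P. (\<Prod>b\<in>Basis. f b (x b)))"
    unfolding lborel_def[where ?'a='a] by (subst integral_distr) (simp_all add: e)
  also have "\<dots> = (\<Prod>b\<in>Basis. LINT x|interval_measure (\<lambda>x. x). f b x)"
    using assms by (intro product_integral_prod) (auto simp: lborel_eq_real)
  finally show "(LINT y|lborel. (\<Prod>b\<in>Basis. f b (y \<bullet> b))) = (\<Prod>b\<in>Basis. LINT x|lborel. f b x)"
    by (simp add: lborel_eq_real)
qed

lemma heat_kernel_prod:
  assumes "0 < t"
  shows "heat_kernel t x y = (\<Prod>b\<in>Basis. normal_density (x \<bullet> b) (sqrt (2 * t)) (y \<bullet> b))"
proof -
  have c: "2 * pi * (sqrt (2 * t))\<^sup>2 = 4 * pi * t" "2 * (sqrt (2 * t))\<^sup>2 = 4 * t"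
    using assms by auto
  have "(\<Prod>b\<in>(Basis::(real^3) set). normal_density (x \<bullet> b) (sqrt (2 * t)) (y \<bullet> b))
    = (\<Prod>b\<in>(Basis::(real^3) set). 1 / sqrt (4 * pi * t)) * exp (\<Sum>b\<in>(Basis::(real^3) set). - (y \<bullet> b - x \<bullet> b)\<^sup>2 / (4 * t))"
    unfolding normal_density_def c prod.distrib exp_sum[OF finite_Basis] ..
  also have "(\<Sum>b\<in>(Basis::(real^3) set). - (y \<bullet> b - x \<bullet> b)\<^sup>2 / (4 * t)) = - (norm (x - y))\<^sup>2 / (4 * t)"
  proof -
    have "- (y \<bullet> b - x \<bullet> b)\<^sup>2 / (4 * t) = (- 1 / (4 * t)) * (((x - y) \<bullet> b) * ((x - y) \<bullet> b))" for b
      by (simp add: inner_diff_left power2_eq_square[symmetric] power2_commute)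
    then have "(\<Sum>b\<in>(Basis::(real^3) set). - (y \<bullet> b - x \<bullet> b)\<^sup>2 / (4 * t)) = (- 1 / (4 * t)) * ((x - y) \<bullet> (x - y))"
      unfolding euclidean_inner[of "x - y" "x - y"] sum_distrib_left by (simp only:)
    then show ?thesis by (simp add: power2_norm_eq_inner)
  qed
  also have "(\<Prod>b\<in>(Basis::(real^3) set). 1 / sqrt (4 * pi * t)) = (4 * pi * t) powr (- 3 / 2)"
  proof -
    have "(4 * pi * t) powr (- 3 / 2) = ((4 * pi * t) powr (- 1/2)) powr (of_nat 3)"
      by (simp add: powr_powr)
    also have "\<dots> = ((4 * pi * t) powr (- 1/2)) ^ 3"
      using assms by (subst powr_realpow) auto
    also have "(4 * pi * t) powr (- 1/2) = 1 / sqrt (4 * pi * t)"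
      using assms by (simp add: powr_minus_divide powr_half_sqrt)
    finally show ?thesis by (simp add: power_one_over)
  qed
  finally show ?thesis by (simp add: power_one_over)
qed

text \<open>In each coordinate the kernel is a normal density of variance \<open>2 * t\<close>,
  whose characteristic function contributes \<open>exp (- t * (k \<bullet> b)\<^sup>2)\<close>; over
  the basis the exponents add up to the squared norm of \<open>k\<close>.\<close>

lemma heat_kernel_cis:
  assumes t: "0 < t"
  shows "integrable lborel (\<lambda>y. heat_kernel t x y *\<^sub>R cis (k \<bullet> y))"
    and "(LINT y|lborel. heat_kernel t x y *\<^sub>R cis (k \<bullet> y)) = exp (- t * (norm k)\<^sup>2) *\<^sub>R cis (k \<bullet> x)"
proof -
  define f where "f b u = complex_of_real (normal_density (x \<bullet> b) (sqrt (2 * t)) u) * cis ((k \<bullet> b) * u)" for b u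
  have cis_sum: "cis (\<Sum>b\<in>A. g b) = (\<Prod>b\<in>A. cis (g b))" if "finite A" for A :: "(real^3) set" and g
    using that by induction (auto simp: cis_mult[symmetric])
  have e: "heat_kernel t x y *\<^sub>R cis (k \<bullet> y) = (\<Prod>b\<in>Basis. f b (y \<bullet> b))" for y
    unfolding heat_kernel_prod[OF t] euclidean_inner[of k y] f_def prod.distrib
    by (simp add: cis_sum scaleR_conv_of_real)
  have i: "integrable lborel (f b)" for b
    unfolding f_def using t by (intro normal_density_cis) auto
  show "integrable lborel (\<lambda>y. heat_kernel t x y *\<^sub>R cis (k \<bullet> y))"
    unfolding e using i by (intro lborel_integral_prod)
  have "(LINT y|lborel. heat_kernel t x y *\<^sub>R cis (k \<bullet> y)) = (\<Prod>b\<in>Basis. LINT u|lborel. f b u)"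
    unfolding e using i by (intro lborel_integral_prod)
  also have "\<dots> = (\<Prod>b\<in>(Basis::(real^3) set). cis ((k \<bullet> b) * (x \<bullet> b)) * complex_of_real (exp (- t * (k \<bullet> b)\<^sup>2)))"
    unfolding f_def using t by (subst normal_density_cis(2)) (auto simp: power_mult_distrib)
  also have "\<dots> = cis (k \<bullet> x) * complex_of_real (exp (\<Sum>b\<in>(Basis::(real^3) set). - t * (k \<bullet> b)\<^sup>2))"
    unfolding euclidean_inner[of k x] prod.distrib by (simp add: cis_sum exp_sum)
  also have "(\<Sum>b\<in>(Basis::(real^3) set). - t * (k \<bullet> b)\<^sup>2) = - t * (norm k)\<^sup>2"
    unfolding power2_norm_eq_inner euclidean_inner[of k k] sum_distrib_left by (simp add: power2_eq_square)
  finally show "(LINT y|lborel. heat_kernel t x y *\<^sub>R cis (k \<bullet> y)) = exp (- t * (norm k)\<^sup>2) *\<^sub>R cis (k \<bullet> x)"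
    by (simp add: scaleR_conv_of_real mult.commute)
qed

lemma heat_kernel_integral:
  assumes "0 < t"
  shows "integrable lborel (heat_kernel t x)" "(LINT y|lborel. heat_kernel t x y) = 1"
proof -
  \<comment> \<open>The total mass of the kernel is read off from the wave with
    \<open>k = 0\<close>.\<close>
  have "integrable lborel (\<lambda>y. Re (heat_kernel t x y *\<^sub>R cis (0 \<bullet> y)))"
    using heat_kernel_cis(1)[OF assms, of x 0] by (rule integrable_Re)
  then show "integrable lborel (heat_kernel t x)" by simp
  have "Re (LINT y|lborel. heat_kernel t x y *\<^sub>R cis (0 \<bullet> y)) = 1"
    using heat_kernel_cis(2)[OF assms, of x 0] by simp
  then show "(LINT y|lborel. heat_kernel t x y) = 1"
    using integral_Re[OF heat_kernel_cis(1)[OF assms, of x 0]] by simp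
qed

lemma heat_semigroup_cos_sin:
  assumes "0 < t"
  shows "heat_semigroup t (\<lambda>y. cos (k \<bullet> y) *\<^sub>R v) x = (exp (- t * (norm k)\<^sup>2) * cos (k \<bullet> x)) *\<^sub>R v"
    and "heat_semigroup t (\<lambda>y. sin (k \<bullet> y) *\<^sub>R v) x = (exp (- t * (norm k)\<^sup>2) * sin (k \<bullet> x)) *\<^sub>R v"
proof -
  note c = heat_kernel_cis[OF assms, of x k]
  have i: "integrable lborel (\<lambda>y. heat_kernel t x y * cos (k \<bullet> y))"
    "integrable lborel (\<lambda>y. heat_kernel t x y * sin (k \<bullet> y))"
    using integrable_Re[OF c(1)] integrable_Im[OF c(1)] by simp_all
  have e: "(LINT y|lborel. heat_kernel t x y * cos (k \<bullet> y)) = exp (- t * (norm k)\<^sup>2) * cos (k \<bullet> x)"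
    "(LINT y|lborel. heat_kernel t x y * sin (k \<bullet> y)) = exp (- t * (norm k)\<^sup>2) * sin (k \<bullet> x)"
    using integral_Re[OF c(1)] integral_Im[OF c(1)] c(2) by simp_all
  show "heat_semigroup t (\<lambda>y. cos (k \<bullet> y) *\<^sub>R v) x = (exp (- t * (norm k)\<^sup>2) * cos (k \<bullet> x)) *\<^sub>R v"
    "heat_semigroup t (\<lambda>y. sin (k \<bullet> y) *\<^sub>R v) x = (exp (- t * (norm k)\<^sup>2) * sin (k \<bullet> x)) *\<^sub>R v"
    unfolding heat_semigroup_def scaleR_scaleR e[symmetric]
    by (rule integral_scaleR_left[OF i(1)], rule integral_scaleR_left[OF i(2)])
qed

lemma heat_kernel_integrable:
  fixes f :: "real ^ 3 \<Rightarrow> real ^ 3"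
  assumes "0 < t" "continuous_on UNIV f" "\<And>x. norm (f x) \<le> B"
  shows "integrable lborel (\<lambda>y. heat_kernel t x y *\<^sub>R f y)"
proof (rule Bochner_Integration.integrable_bound)
  show "integrable lborel (\<lambda>y. B * heat_kernel t x y)"
    using heat_kernel_integral(1)[OF assms(1)] by (rule integrable_mult_right)
  have [measurable]: "f \<in> borel_measurable borel"
    using borel_measurable_continuous_onI[OF assms(2)] .
  show "(\<lambda>y. heat_kernel t x y *\<^sub>R f y) \<in> borel_measurable lborel" by measurable
  have "0 \<le> B" using norm_ge_zero order_trans[OF _ assms(3)[of 0]] by blast
  then show "AE y in lborel. norm (heat_kernel t x y *\<^sub>R f y) \<le> norm (B * heat_kernel t x y)"
    using assms(3) by (auto simp: abs_mult mult.commute[of B] intro!: AE_I2 mult_left_mono)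
qed

lemma heat_semigroup_diff:
  assumes "0 < t" "continuous_on UNIV f" "\<And>x. norm (f x) \<le> B" "continuous_on UNIV g" "\<And>x. norm (g x) \<le> B'"
  shows "heat_semigroup t (\<lambda>y. f y - g y) x = heat_semigroup t f x - heat_semigroup t g x"
  unfolding heat_semigroup_def scaleR_diff_right
  by (intro Bochner_Integration.integral_diff heat_kernel_integrable[OF assms(1-3)]
      heat_kernel_integrable[OF assms(1,4,5)])

lemma heat_semigroup_norm_le:
  assumes t: "0 < t" and "continuous_on UNIV f" "\<And>x. norm (f x) \<le> B"
  shows "norm (heat_semigroup t f x) \<le> B"
proof -
  have "norm (heat_semigroup t f x) \<le> (LINT y|lborel. B * heat_kernel t x y)"
    unfolding heat_semigroup_def
  proof (rule Bochner_Integration.integral_norm_bound_integral)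
    show "integrable lborel (\<lambda>y. B * heat_kernel t x y)"
      using heat_kernel_integral(1)[OF t] by (rule integrable_mult_right)
    show "norm (heat_kernel t x y *\<^sub>R f y) \<le> B * heat_kernel t x y" for y
      using assms(3)[of y] by (simp add: mult.commute[of B] mult_left_mono)
  qed (rule heat_kernel_integrable[OF assms])
  also have "\<dots> = B"
    using heat_kernel_integral[OF t] by simp
  finally show ?thesis .
qed

lemma heat_semigroup_sum:
  assumes "0 < t" "finite F" "\<And>i. i \<in> F \<Longrightarrow> continuous_on UNIV (f i)" "\<And>i x. i \<in> F \<Longrightarrow> norm (f i x) \<le> B i"
  shows "heat_semigroup t (\<lambda>y. \<Sum>i\<in>F. f i y) x = (\<Sum>i\<in>F. heat_semigroup t (f i) x)"
  unfolding heat_semigroup_def scaleR_sum_right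
  using assms(3,4) by (intro Bochner_Integration.integral_sum heat_kernel_integrable[OF assms(1)])

section \<open>Trigonometric series in two variables\<close>

type_synonym mode = "int \<times> int"

definition wv :: "mode \<Rightarrow> real ^ 3" where
  "wv k = vector [of_int (fst k), of_int (snd k), 0]"

lemma wv_nth [simp]: "wv k $ 1 = of_int (fst k)" "wv k $ 2 = of_int (snd k)" "wv k $ 3 = 0"
  by (simp_all add: wv_def)

lemma wv_add: "wv (j + k) = wv j + wv k"
  and wv_diff: "wv (j - k) = wv j - wv k"
  and wv_minus: "wv (- k) = - wv k"
  and wv_zero: "wv 0 = 0"
  by (simp_all add: vec_eq_iff forall_3)

lemma norm_wv_sq: "(norm (wv k))\<^sup>2 = (of_int (fst k))\<^sup>2 + (of_int (snd k))\<^sup>2"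
  unfolding power2_norm_eq_inner by (simp add: inner_vec_def sum_3 power2_eq_square)

lemma norm_wv_le_mult: "1 + norm (wv k) \<le> (1 + norm (wv j)) * (1 + norm (wv (k - j)))"
proof -
  have "norm (wv k) \<le> norm (wv j) + norm (wv (k - j))"
    using norm_triangle_ineq[of "wv j" "wv (k - j)"] by (simp add: wv_diff)
  moreover have "0 \<le> norm (wv j) * norm (wv (k - j))" by simp
  ultimately show ?thesis unfolding distrib_left distrib_right by linarith
qed

lemma abs_wv_nth_le: "\<bar>wv k $ j\<bar> \<le> norm (wv k)"
  by (rule component_le_norm_cart)

text \<open>The index runs over the whole lattice, so every real wave is counted at \<open>k\<close>
  and at \<open>- k\<close>. Sine series are used with odd and cosine series with even coefficients,
  which keeps all Fourier coefficients real.\<close>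

definition trig :: "(real \<Rightarrow> real) \<Rightarrow> (mode \<Rightarrow> 'v::banach) \<Rightarrow> real ^ 3 \<Rightarrow> 'v" where
  "trig \<phi> \<alpha> x = (\<Sum>\<^sub>\<infinity>k. \<phi> (wv k \<bullet> x) *\<^sub>R \<alpha> k)"

lemma norm_scaleR_le:
  assumes "\<bar>c\<bar> \<le> (1::real)" shows "norm (c *\<^sub>R v) \<le> norm v"
  using mult_right_mono[OF assms norm_ge_zero[of v]] by simp

lemma trig_summable:
  fixes \<alpha> :: "mode \<Rightarrow> 'v::banach"
  assumes "\<And>y. \<bar>\<phi> y\<bar> \<le> 1" and "m summable_on UNIV" and "\<And>k. norm (\<alpha> k) \<le> m k"
  shows "(\<lambda>k. \<phi> (wv k \<bullet> x) *\<^sub>R \<alpha> k) summable_on UNIV" "norm (trig \<phi> \<alpha> x) \<le> (\<Sum>\<^sub>\<infinity>k. m k)"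
  unfolding trig_def
  by (rule summable_norm_bound[OF assms(2)]; rule order_trans[OF norm_scaleR_le[OF assms(1)] assms(3)])+

lemma trig_add:
  assumes "\<And>y. \<bar>\<phi> y\<bar> \<le> 1" "(\<lambda>k. norm (\<alpha> k)) summable_on UNIV" "(\<lambda>k. norm (\<beta> k)) summable_on UNIV"
  shows "trig \<phi> (\<lambda>k. \<alpha> k + \<beta> k) x = trig \<phi> \<alpha> x + trig \<phi> \<beta> x"
  using infsum_add[OF trig_summable(1)[OF assms(1,2) order_refl] trig_summable(1)[OF assms(1,3) order_refl]]
  by (simp add: trig_def scaleR_add_right)

lemma trig_uminus: "trig \<phi> (\<lambda>k. - \<alpha> k) x = - trig \<phi> \<alpha> x"
  and trig_minus_fun: "trig (\<lambda>y. - \<phi> y) \<alpha> x = - trig \<phi> \<alpha> x"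
  by (simp_all add: trig_def infsum_uminus)

lemma trig_diff:
  assumes "\<And>y. \<bar>\<phi> y\<bar> \<le> 1" "(\<lambda>k. norm (\<alpha> k)) summable_on UNIV" "(\<lambda>k. norm (\<beta> k)) summable_on UNIV"
  shows "trig \<phi> (\<lambda>k. \<alpha> k - \<beta> k) x = trig \<phi> \<alpha> x - trig \<phi> \<beta> x"
  using trig_add[OF assms(1,2), where \<beta> = "\<lambda>k. - \<beta> k" and x = x] assms(3) by (simp add: trig_uminus)

lemma infsum_sum_swap:
  fixes f :: "'a \<Rightarrow> 'i \<Rightarrow> 'b::real_normed_vector"
  assumes "finite A" "\<And>a. a \<in> A \<Longrightarrow> f a summable_on X"
  shows "(\<Sum>\<^sub>\<infinity>i\<in>X. \<Sum>a\<in>A. f a i) = (\<Sum>a\<in>A. infsum (f a) X)" "(\<lambda>i. \<Sum>a\<in>A. f a i) summable_on X"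
proof -
  have "(\<Sum>\<^sub>\<infinity>i\<in>X. \<Sum>a\<in>A. f a i) = (\<Sum>a\<in>A. infsum (f a) X) \<and> (\<lambda>i. \<Sum>a\<in>A. f a i) summable_on X"
    using assms
  proof (induction A)
    case (insert a A)
    then show ?case
      using infsum_add[of "f a" X "\<lambda>i. \<Sum>a\<in>A. f a i"] summable_on_add[of "f a" X "\<lambda>i. \<Sum>a\<in>A. f a i"]
      by auto
  qed auto
  then show "(\<Sum>\<^sub>\<infinity>i\<in>X. \<Sum>a\<in>A. f a i) = (\<Sum>a\<in>A. infsum (f a) X)" "(\<lambda>i. \<Sum>a\<in>A. f a i) summable_on X"
    by auto
qed

lemma trig_bounded_linear:
  assumes "bounded_linear h" "\<And>y. \<bar>\<phi> y\<bar> \<le> 1" "(\<lambda>k. norm (\<alpha> k)) summable_on UNIV"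
  shows "h (trig \<phi> \<alpha> x) = trig \<phi> (\<lambda>k. h (\<alpha> k)) x"
proof -
  have "((\<lambda>k. h (\<phi> (wv k \<bullet> x) *\<^sub>R \<alpha> k)) has_sum h (trig \<phi> \<alpha> x)) UNIV"
    unfolding trig_def
    by (rule has_sum_bounded_linear[OF assms(1) has_sum_infsum[OF trig_summable(1)[OF assms(2,3) order_refl]]])
  from infsumI[OF this] show ?thesis
    by (simp add: trig_def linear_cmul[OF bounded_linear.linear[OF assms(1)]])
qed

lemma trig_finite:
  assumes "finite F" "\<And>k. k \<notin> F \<Longrightarrow> \<alpha> k = 0"
  shows "trig \<phi> \<alpha> x = (\<Sum>k\<in>F. \<phi> (wv k \<bullet> x) *\<^sub>R \<alpha> k)"
  unfolding trig_def using assms infsum_cong_neutral[of UNIV F "\<lambda>k. \<phi> (wv k \<bullet> x) *\<^sub>R \<alpha> k"] by auto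

lemma trig_has_derivative:
  fixes \<alpha> :: "mode \<Rightarrow> 'v::banach"
  assumes d: "\<And>y. (\<phi> has_real_derivative \<phi>' y) (at y)" and b: "\<And>y. \<bar>\<phi> y\<bar> \<le> 1" "\<And>y. \<bar>\<phi>' y\<bar> \<le> 1"
    and s: "(\<lambda>k. norm (\<alpha> k)) summable_on UNIV" "(\<lambda>k. norm (wv k) * norm (\<alpha> k)) summable_on UNIV"
  shows "(trig \<phi> \<alpha> has_derivative (\<lambda>h. \<Sum>\<^sub>\<infinity>k. (\<phi>' (wv k \<bullet> x) * (wv k \<bullet> h)) *\<^sub>R \<alpha> k)) (at x)"
  unfolding trig_def
proof (rule has_derivative_infsum[where S = UNIV, simplified])
  show "(\<lambda>k. norm (wv k) * norm (\<alpha> k)) summable_on UNIV" by (rule s(2))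
  show "(\<lambda>k. \<phi> (wv k \<bullet> x) *\<^sub>R \<alpha> k) summable_on UNIV" for x
    by (rule trig_summable(1)[OF b(1) s(1) order_refl])
  show "((\<lambda>x. \<phi> (wv k \<bullet> x) *\<^sub>R \<alpha> k) has_derivative (\<lambda>h. (\<phi>' (wv k \<bullet> x) * (wv k \<bullet> h)) *\<^sub>R \<alpha> k)) (at x)" for k x
  proof -
    have "((\<lambda>x. \<phi> (wv k \<bullet> x)) has_derivative (\<lambda>h. \<phi>' (wv k \<bullet> x) * (wv k \<bullet> h))) (at x)"
      using d[of "wv k \<bullet> x", unfolded has_field_derivative_def]
      by (rule has_derivative_compose[rotated]) (auto intro!: derivative_eq_intros)
    then show ?thesis by (rule has_derivative_scaleR_left)
  qed
  show "norm ((\<phi>' (wv k \<bullet> x) * (wv k \<bullet> h)) *\<^sub>R \<alpha> k) \<le> norm (wv k) * norm (\<alpha> k) * norm h" for k x h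
  proof -
    have "\<bar>\<phi>' (wv k \<bullet> x)\<bar> * \<bar>wv k \<bullet> h\<bar> \<le> 1 * (norm (wv k) * norm h)"
      by (intro mult_mono b Cauchy_Schwarz_ineq2) auto
    from mult_right_mono[OF this norm_ge_zero[of "\<alpha> k"]] show ?thesis by (simp add: abs_mult ac_simps)
  qed
qed

lemma trig_partial:
  fixes \<alpha> :: "mode \<Rightarrow> 'v::banach"
  assumes d: "\<And>y. (\<phi> has_real_derivative \<phi>' y) (at y)" and b: "\<And>y. \<bar>\<phi> y\<bar> \<le> 1" "\<And>y. \<bar>\<phi>' y\<bar> \<le> 1"
    and s: "(\<lambda>k. norm (\<alpha> k)) summable_on UNIV" "(\<lambda>k. norm (wv k) * norm (\<alpha> k)) summable_on UNIV"
  shows "partial j (trig \<phi> \<alpha>) x = trig \<phi>' (\<lambda>k. (wv k $ j) *\<^sub>R \<alpha> k) x" "trig \<phi> \<alpha> differentiable (at x)"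
  using frechet_derivative_at[OF trig_has_derivative[OF assms, of x], symmetric] trig_has_derivative[OF assms, of x]
  by (auto simp: partial_def trig_def inner_axis differentiable_def)

lemma trig_torus: 
  assumes "\<And>y n. \<phi> (y + 2 * pi * of_int n) = \<phi> y"
  shows "torus_fun (trig \<phi> \<alpha>)"
  unfolding torus_fun_def trig_def
proof (intro allI infsum_cong arg_cong2[of _ _ _ _ scaleR] refl)
  fix x :: "real^3" and j and k :: mode
  obtain n where n: "wv k $ j = of_int n"
    using exhaust_3[of j] by (metis wv_nth of_int_0)
  have "wv k \<bullet> (x + (2 * pi) *\<^sub>R axis j 1) = wv k \<bullet> x + 2 * pi * of_int n"
    by (simp add: inner_add_right inner_axis n)
  then show "\<phi> (wv k \<bullet> (x + (2 * pi) *\<^sub>R axis j 1)) = \<phi> (wv k \<bullet> x)"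
    by (simp only: assms)
qed

lemma sin_cos_plus_2pi_int:
  "sin (y + 2 * pi * of_int n) = sin y" "cos (y + 2 * pi * of_int n) = cos (y::real)"
  using sin.plus_of_int[of y n] cos.plus_of_int[of y n] by (simp_all add: mult_ac)

lemma trig_continuous_time:
  fixes \<alpha> :: "real \<Rightarrow> mode \<Rightarrow> 'v::banach"
  assumes "continuous_on UNIV \<phi>" "\<And>y. \<bar>\<phi> y\<bar> \<le> 1" "m summable_on UNIV"
    "\<And>t k. t \<in> I \<Longrightarrow> norm (\<alpha> t k) \<le> m k" "\<And>k. continuous_on I (\<lambda>t. \<alpha> t k)"
  shows "continuous_on (I \<times> UNIV) (\<lambda>(t, x). trig \<phi> (\<alpha> t) x)"
proof -
  have "continuous_on (I \<times> UNIV) (\<lambda>p. \<Sum>\<^sub>\<infinity>k. \<phi> (wv k \<bullet> snd p) *\<^sub>R \<alpha> (fst p) k)"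
  proof (rule continuous_on_infsum[OF _ _ assms(3)])
    show "norm (\<phi> (wv k \<bullet> snd p) *\<^sub>R \<alpha> (fst p) k) \<le> m k" if "p \<in> I \<times> UNIV" for k p
      by (rule order_trans[OF norm_scaleR_le[OF assms(2)] assms(4)]) (use that in auto)
    show "continuous_on (I \<times> UNIV) (\<lambda>p. \<phi> (wv k \<bullet> snd p) *\<^sub>R \<alpha> (fst p) k)" for k
      by (intro continuous_on_scaleR continuous_on_compose2[OF assms(1)] continuous_on_compose2[OF assms(5)]
          continuous_intros) auto
  qed
  then show ?thesis by (simp add: trig_def case_prod_unfold)
qed

lemma trig_continuous:
  assumes "continuous_on UNIV \<phi>" "\<And>y. \<bar>\<phi> y\<bar> \<le> 1" "(\<lambda>k. norm (\<alpha> k)) summable_on UNIV"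
  shows "continuous_on UNIV (trig \<phi> \<alpha>)"
proof -
  have "continuous_on ({0::real} \<times> UNIV) (\<lambda>(t, x). trig \<phi> \<alpha> x)"
    by (rule trig_continuous_time[OF assms]) auto
  from continuous_on_compose2[OF this, of UNIV "\<lambda>x. (0, x)"] show ?thesis
    by (auto simp: continuous_on_Pair)
qed

lemma trig_has_vector_derivative:
  fixes \<alpha> :: "real \<Rightarrow> mode \<Rightarrow> 'v::banach"
  assumes "convex I" "\<And>y. \<bar>\<phi> y\<bar> \<le> 1" "m summable_on UNIV" "m' summable_on UNIV"
    "\<And>t k. t \<in> I \<Longrightarrow> norm (\<alpha> t k) \<le> m k" "\<And>t k. t \<in> I \<Longrightarrow> norm (\<alpha>' t k) \<le> m' k"
    "\<And>t k. t \<in> I \<Longrightarrow> ((\<lambda>t. \<alpha> t k) has_vector_derivative \<alpha>' t k) (at t within I)" "t \<in> I"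
  shows "((\<lambda>t. trig \<phi> (\<alpha> t) x) has_vector_derivative trig \<phi> (\<alpha>' t) x) (at t within I)"
  unfolding trig_def
proof (rule has_vector_derivative_infsum[OF assms(1) _ _ assms(4) _ assms(8)])
  show "((\<lambda>t. \<phi> (wv k \<bullet> x) *\<^sub>R \<alpha> t k) has_vector_derivative \<phi> (wv k \<bullet> x) *\<^sub>R \<alpha>' t k) (at t within I)"
    if "t \<in> I" for k t
    using has_vector_derivative_scaleR[OF DERIV_const assms(7)[OF that]] by simp
  show "norm (\<phi> (wv k \<bullet> x) *\<^sub>R \<alpha>' t k) \<le> m' k" if "t \<in> I" for k t
    using order_trans[OF norm_scaleR_le[OF assms(2)] assms(6)[OF that]] .
  show "(\<lambda>k. \<phi> (wv k \<bullet> x) *\<^sub>R \<alpha> t k) summable_on UNIV" if "t \<in> I" for t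
    by (rule trig_summable(1)[OF assms(2,3) assms(5)[OF that]])
qed

text \<open>A product-to-sum formula produces both \<open>\<theta> (y + z)\<close> and \<open>\<theta> (y - z)\<close>; by the parity of
  \<open>\<beta>\<close> both contribute the same.\<close>

lemma trig_product:
  fixes \<alpha> :: "mode \<Rightarrow> real" and \<beta> :: "mode \<Rightarrow> 'v::banach"
  assumes p: "\<And>y z. \<phi> y * \<psi> z = (s * \<theta> (y + z) + s' * \<theta> (y - z)) / 2"
    and par: "\<And>l. s' *\<^sub>R \<beta> (- l) = s *\<^sub>R \<beta> l"
    and b: "\<And>y. \<bar>\<phi> y\<bar> \<le> 1" "\<And>y. \<bar>\<psi> y\<bar> \<le> 1" "\<And>y. \<bar>\<theta> y\<bar> \<le> 1"
    and sa: "(\<lambda>k. \<bar>\<alpha> k\<bar>) summable_on UNIV" and sb: "(\<lambda>k. norm (\<beta> k)) summable_on UNIV"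
  shows "trig \<phi> \<alpha> x *\<^sub>R trig \<psi> \<beta> x = s *\<^sub>R trig \<theta> (\<lambda>k. \<Sum>\<^sub>\<infinity>j. \<alpha> j *\<^sub>R \<beta> (k - j)) x"
proof -
  let ?e = "\<lambda>k. wv k \<bullet> x"
  have S: "(\<lambda>(i, l). \<bar>\<alpha> i\<bar> * norm (\<beta> l)) summable_on UNIV"
    using summable_on_pairs(1)[OF sa sb] by simp
  have sum: "(\<lambda>(i, l). (c (i, l) * \<alpha> i) *\<^sub>R \<beta> l) summable_on UNIV" if "\<And>p. \<bar>c p\<bar> \<le> 1" for c
  proof (rule summable_norm_bound(1)[OF S])
    fix p :: "mode \<times> mode"
    obtain i l where il: "p = (i, l)" by (rule prod.exhaust)
    have "\<bar>c (i,l)\<bar> * (\<bar>\<alpha> i\<bar> * norm (\<beta> l)) \<le> 1 * (\<bar>\<alpha> i\<bar> * norm (\<beta> l))"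
      by (intro mult_right_mono that) auto
    then show "norm (case p of (i, l) \<Rightarrow> (c (i, l) * \<alpha> i) *\<^sub>R \<beta> l) \<le> (case p of (i, l) \<Rightarrow> \<bar>\<alpha> i\<bar> * norm (\<beta> l))"
      by (simp add: il abs_mult mult.assoc)
  qed
  have "\<bar>\<phi> y * \<psi> z\<bar> \<le> 1" for y z
    unfolding abs_mult using mult_mono[OF b(1)[of y] b(2)[of z]] by simp
  then have s1: "(\<lambda>(i, l). (\<phi> (?e i) * \<psi> (?e l) * \<alpha> i) *\<^sub>R \<beta> l) summable_on UNIV"
    using sum[of "\<lambda>(i, l). \<phi> (?e i) * \<psi> (?e l)"] by (simp add: case_prod_unfold)
  have s2: "(\<lambda>(i, l). (\<theta> (?e (i + l)) * \<alpha> i) *\<^sub>R \<beta> l) summable_on UNIV"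
    using sum[of "\<lambda>(i, l). \<theta> (?e (i + l))"] b(3) by (simp add: case_prod_unfold)
  have s3: "(\<lambda>(i, l). (\<theta> (?e (i - l)) * \<alpha> i) *\<^sub>R \<beta> l) summable_on UNIV"
    using sum[of "\<lambda>(i, l). \<theta> (?e (i - l))"] b(3) by (simp add: case_prod_unfold)
  have flip: "bij (\<lambda>(i, l). (i, - l :: mode))"
    by (rule bij_betw_byWitness[where f' = "\<lambda>(i, l). (i, - l)"]) auto
  have "trig \<phi> \<alpha> x *\<^sub>R trig \<psi> \<beta> x = (\<Sum>\<^sub>\<infinity>i. \<Sum>\<^sub>\<infinity>l. (\<phi> (?e i) * \<psi> (?e l) * \<alpha> i) *\<^sub>R \<beta> l)"
    unfolding trig_def
    by (subst infsum_scaleR_left[symmetric])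
       (use trig_summable(1)[OF b(1) sa, of \<alpha>] in \<open>simp_all add: infsum_scaleR_right[symmetric] mult_ac\<close>)
  also have "\<dots> = (\<Sum>\<^sub>\<infinity>(i, l). (\<phi> (?e i) * \<psi> (?e l) * \<alpha> i) *\<^sub>R \<beta> l)"
    using infsum_Sigma'_banach[of "\<lambda>i l. (\<phi> (?e i) * \<psi> (?e l) * \<alpha> i) *\<^sub>R \<beta> l" UNIV "\<lambda>_. UNIV"] s1 by simp
  also have "\<dots> = (\<Sum>\<^sub>\<infinity>(i, l). (s/2) *\<^sub>R ((\<theta> (?e (i + l)) * \<alpha> i) *\<^sub>R \<beta> l) + (s'/2) *\<^sub>R ((\<theta> (?e (i - l)) * \<alpha> i) *\<^sub>R \<beta> l))"
    by (intro infsum_cong) (auto simp: p wv_add wv_diff inner_add_left inner_diff_left scaleR_add_left[symmetric] field_simps)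
  also have "\<dots> = (s/2) *\<^sub>R (\<Sum>\<^sub>\<infinity>(i, l). (\<theta> (?e (i + l)) * \<alpha> i) *\<^sub>R \<beta> l) + (s'/2) *\<^sub>R (\<Sum>\<^sub>\<infinity>(i, l). (\<theta> (?e (i - l)) * \<alpha> i) *\<^sub>R \<beta> l)"
    using infsum_add[OF summable_on_scaleR_right[OF s2, of "s/2"] summable_on_scaleR_right[OF s3, of "s'/2"]]
    by (simp only: case_prod_unfold infsum_scaleR_right)
  also have "(s'/2) *\<^sub>R (\<Sum>\<^sub>\<infinity>(i, l). (\<theta> (?e (i - l)) * \<alpha> i) *\<^sub>R \<beta> l)
     = (\<Sum>\<^sub>\<infinity>(i, l). (s'/2) *\<^sub>R ((\<theta> (?e (i + l)) * \<alpha> i) *\<^sub>R \<beta> (- l)))"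
    using infsum_reindex_bij_betw[OF flip, of "\<lambda>(i, l). (s'/2) *\<^sub>R ((\<theta> (?e (i - l)) * \<alpha> i) *\<^sub>R \<beta> l)"]
    by (simp only: case_prod_unfold infsum_scaleR_right fst_conv snd_conv diff_minus_eq_add)
  also have "\<dots> = (\<Sum>\<^sub>\<infinity>(i, l). (s/2) *\<^sub>R ((\<theta> (?e (i + l)) * \<alpha> i) *\<^sub>R \<beta> l))"
  proof (intro infsum_cong, clarify)
    fix i1 i2 l1 l2
    have "(s'/2) *\<^sub>R (c *\<^sub>R \<beta> (- l)) = (c/2) *\<^sub>R (s' *\<^sub>R \<beta> (- l))" for c l by (simp add: mult_ac)
    then show "(s'/2) *\<^sub>R ((\<theta> (?e ((i1, i2) + (l1, l2))) * \<alpha> (i1, i2)) *\<^sub>R \<beta> (- (l1, l2)))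
      = (s/2) *\<^sub>R ((\<theta> (?e ((i1, i2) + (l1, l2))) * \<alpha> (i1, i2)) *\<^sub>R \<beta> (l1, l2))"
      by (simp only: par) (simp add: mult_ac)
  qed
  also have "\<dots> = (s/2) *\<^sub>R (\<Sum>\<^sub>\<infinity>(i, l). (\<theta> (?e (i + l)) * \<alpha> i) *\<^sub>R \<beta> l)"
    by (simp only: case_prod_unfold infsum_scaleR_right)
  also have "(s/2) *\<^sub>R (\<Sum>\<^sub>\<infinity>(i, l). (\<theta> (?e (i + l)) * \<alpha> i) *\<^sub>R \<beta> l) + \<dots> = s *\<^sub>R (\<Sum>\<^sub>\<infinity>(i, l). (\<theta> (?e (i + l)) * \<alpha> i) *\<^sub>R \<beta> l)"
    by (simp add: scaleR_add_left[symmetric])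
  also have "(\<Sum>\<^sub>\<infinity>(i, l). (\<theta> (?e (i + l)) * \<alpha> i) *\<^sub>R \<beta> l) = trig \<theta> (\<lambda>k. \<Sum>\<^sub>\<infinity>j. \<alpha> j *\<^sub>R \<beta> (k - j)) x"
    using infsum_diagonals(1)[OF s2] by (simp add: trig_def infsum_scaleR_right[symmetric])
  finally show ?thesis .
qed

lemma conv_summable:
  fixes \<alpha> :: "mode \<Rightarrow> real" and \<beta> :: "mode \<Rightarrow> 'v::banach"
  assumes sa: "(\<lambda>k. \<bar>\<alpha> k\<bar>) summable_on UNIV" and sb: "(\<lambda>k. norm (\<beta> k)) summable_on UNIV"
  shows "(\<lambda>j. \<alpha> j *\<^sub>R \<beta> (k - j)) summable_on UNIV" "(\<lambda>k. norm (\<Sum>\<^sub>\<infinity>j. \<alpha> j *\<^sub>R \<beta> (k - j))) summable_on UNIV"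
proof -
  have ns: "nonneg_summable (\<lambda>k. \<bar>\<alpha> k\<bar>)" "nonneg_summable (\<lambda>k. norm (\<beta> k))"
    using assms by (auto simp: nonneg_summable_def)
  note c = cv_term_summable[OF this]
  show "(\<lambda>j. \<alpha> j *\<^sub>R \<beta> (k - j)) summable_on UNIV" for k
    by (rule summable_norm_bound(1)[OF c[of k]]) simp
  have n: "norm (\<Sum>\<^sub>\<infinity>j. \<alpha> j *\<^sub>R \<beta> (k - j)) \<le> cv (\<lambda>k. \<bar>\<alpha> k\<bar>) (\<lambda>k. norm (\<beta> k)) k" for k
    unfolding cv_def by (rule summable_norm_bound(3)[OF c]) simp
  show "(\<lambda>k. norm (\<Sum>\<^sub>\<infinity>j. \<alpha> j *\<^sub>R \<beta> (k - j))) summable_on UNIV"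
    using nonneg_summable_cv(1)[OF ns] n unfolding nonneg_summable_def
    by (intro summable_norm_bound(2)[of "cv (\<lambda>k. \<bar>\<alpha> k\<bar>) (\<lambda>k. norm (\<beta> k))"]) auto
qed

text \<open>Differentiation falls on the advected factor and gives
  \<open>\<alpha> i \<bullet> wv (k - i)\<close>. Since \<open>\<alpha> i\<close> is orthogonal to
  \<open>wv i\<close>, this equals \<open>\<alpha> i \<bullet> wv k\<close>: the derivative is
  carried by the output frequency, where the heat kernel can absorb it. The sign in
  \<open>par\<close> reflects the change of parity under differentiation.\<close>

lemma advect_trig:
  fixes \<alpha> \<beta> :: "mode \<Rightarrow> real ^ 3"
  assumes F: "\<And>j. partial j F x = trig \<psi> (\<lambda>k. (wv k $ j) *\<^sub>R \<beta> k) x"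
    and p: "\<And>y z. \<phi> y * \<psi> z = (s * \<theta> (y + z) + s' * \<theta> (y - z)) / 2"
    and par: "\<And>l. - s' *\<^sub>R \<beta> (- l) = s *\<^sub>R \<beta> l"
    and b: "\<And>y. \<bar>\<phi> y\<bar> \<le> 1" "\<And>y. \<bar>\<psi> y\<bar> \<le> 1" "\<And>y. \<bar>\<theta> y\<bar> \<le> 1"
    and sa: "(\<lambda>k. norm (\<alpha> k)) summable_on UNIV" and sb: "(\<lambda>k. norm (wv k) * norm (\<beta> k)) summable_on UNIV"
    and div: "\<And>k. wv k \<bullet> \<alpha> k = 0"
  shows "advect (trig \<phi> \<alpha>) F x = s *\<^sub>R trig \<theta> (\<lambda>k. \<Sum>\<^sub>\<infinity>j. (\<alpha> j \<bullet> wv k) *\<^sub>R \<beta> (k - j)) x"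
proof -
  have saj: "(\<lambda>k. \<bar>\<alpha> k $ j\<bar>) summable_on UNIV" for j
    using summable_norm_bound(2)[OF sa, of "\<lambda>k. \<alpha> k $ j"] component_le_norm_cart by auto
  have sbj: "(\<lambda>k. norm ((wv k $ j) *\<^sub>R \<beta> k)) summable_on UNIV" for j
    by (rule summable_norm_bound(2)[OF sb]) (simp add: abs_wv_nth_le mult_right_mono)
  have aj: "trig \<phi> \<alpha> x $ j = trig \<phi> (\<lambda>k. \<alpha> k $ j) x" for j
    using trig_bounded_linear[OF bounded_linear_vec_nth b(1) sa] .
  have parj: "s' *\<^sub>R ((wv (- l) $ j) *\<^sub>R \<beta> (- l)) = s *\<^sub>R ((wv l $ j) *\<^sub>R \<beta> l)" for l j
  proof -
    have "s' *\<^sub>R ((wv (- l) $ j) *\<^sub>R \<beta> (- l)) = (wv l $ j) *\<^sub>R (- s' *\<^sub>R \<beta> (- l))"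
      by (simp add: wv_minus)
    also have "\<dots> = s *\<^sub>R ((wv l $ j) *\<^sub>R \<beta> l)"
      by (simp only: par) simp
    finally show ?thesis .
  qed
  let ?c = "\<lambda>j k. \<Sum>\<^sub>\<infinity>i. (\<alpha> i $ j) *\<^sub>R ((wv (k - i) $ j) *\<^sub>R \<beta> (k - i))"
  have "advect (trig \<phi> \<alpha>) F x = (\<Sum>j\<in>UNIV. s *\<^sub>R trig \<theta> (?c j) x)"
    unfolding advect_def F aj by (intro sum.cong refl trig_product[OF p parj b saj sbj])
  also have "\<dots> = s *\<^sub>R trig \<theta> (\<lambda>k. \<Sum>j\<in>UNIV. ?c j k) x"
    unfolding trig_def scaleR_sum_right
    using trig_summable(1)[OF b(3) conv_summable(2)[OF saj sbj] order_refl]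
    by (subst infsum_sum_swap) (auto simp: scaleR_sum_right)
  also have "(\<lambda>k. \<Sum>j\<in>UNIV. ?c j k) = (\<lambda>k. \<Sum>\<^sub>\<infinity>i. (\<alpha> i \<bullet> wv k) *\<^sub>R \<beta> (k - i))"
  proof
    fix k
    have "(\<Sum>j\<in>UNIV. ?c j k) = (\<Sum>\<^sub>\<infinity>i. \<Sum>j\<in>UNIV. (\<alpha> i $ j) *\<^sub>R ((wv (k - i) $ j) *\<^sub>R \<beta> (k - i)))"
      by (rule infsum_sum_swap(1)[symmetric]) (simp, rule conv_summable(1)[OF saj sbj])
    also have "\<dots> = (\<Sum>\<^sub>\<infinity>i. (\<alpha> i \<bullet> wv k) *\<^sub>R \<beta> (k - i))"
    proof (rule infsum_cong)
      fix i
      have "\<alpha> i \<bullet> wv k = \<alpha> i \<bullet> wv (k - i)"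
        using div[of i] by (simp add: wv_diff inner_diff_right inner_commute)
      then show "(\<Sum>j\<in>UNIV. (\<alpha> i $ j) *\<^sub>R ((wv (k - i) $ j) *\<^sub>R \<beta> (k - i))) = (\<alpha> i \<bullet> wv k) *\<^sub>R \<beta> (k - i)"
        by (simp add: inner_vec_def scaleR_sum_left)
    qed
    finally show "(\<Sum>j\<in>UNIV. ?c j k) = (\<Sum>\<^sub>\<infinity>i. (\<alpha> i \<bullet> wv k) *\<^sub>R \<beta> (k - i))" .
  qed
  finally show ?thesis .
qed

text \<open>A finite part is treated wave by wave. The tail is uniformly small, and convolution with
  a kernel of mass one does not increase the supremum norm.\<close>

lemma heat_semigroup_trig:
  assumes "\<phi> = sin \<or> \<phi> = cos" and t: "0 < t" and s: "(\<lambda>k. norm (\<alpha> k)) summable_on UNIV"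
  shows "heat_semigroup t (trig \<phi> \<alpha>) x = trig \<phi> (\<lambda>k. exp (- t * (norm (wv k))\<^sup>2) *\<^sub>R \<alpha> k) x"
proof -
  have b: "\<bar>\<phi> y\<bar> \<le> 1" for y using assms(1) by auto
  have c: "continuous_on UNIV \<phi>" using assms(1) by (auto intro!: continuous_intros)
  have h: "heat_semigroup t (\<lambda>y. \<phi> (wv k \<bullet> y) *\<^sub>R \<alpha> k) x = \<phi> (wv k \<bullet> x) *\<^sub>R (exp (- t * (norm (wv k))\<^sup>2) *\<^sub>R \<alpha> k)" for k
    using assms(1) heat_semigroup_cos_sin[OF t, of "wv k" "\<alpha> k" x] by (auto simp: mult.commute)
  let ?g = "\<lambda>k. exp (- t * (norm (wv k))\<^sup>2) *\<^sub>R \<alpha> k"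
  have gl: "norm (?g k) \<le> norm (\<alpha> k)" for k
    by (rule norm_scaleR_le) (use t in auto)
  have "norm (heat_semigroup t (trig \<phi> \<alpha>) x - trig \<phi> ?g x) \<le> e" if e: "0 < e" for e
  proof -
    obtain F where F: "finite F" "(\<Sum>\<^sub>\<infinity>k. norm (\<alpha> k)) - (\<Sum>k\<in>F. norm (\<alpha> k)) < e/2"
      using finite_tail_small[OF s, of "e/2"] e by auto
    let ?f = "\<lambda>y. \<Sum>k\<in>F. \<phi> (wv k \<bullet> y) *\<^sub>R \<alpha> k"
    have cf: "continuous_on UNIV (\<lambda>y. \<phi> (wv k \<bullet> y) *\<^sub>R \<alpha> k)" for k
      by (intro continuous_intros continuous_on_compose2[OF c]) auto
    have nf: "norm (?f y) \<le> (\<Sum>k\<in>F. norm (\<alpha> k))" for y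
      by (intro order_trans[OF norm_sum] sum_mono norm_scaleR_le b)
    have d: "norm (trig \<phi> \<alpha> y - ?f y) \<le> e/2" for y
      using infsum_diff_finite_norm_le[OF s _ F(1), of "\<lambda>k. \<phi> (wv k \<bullet> y) *\<^sub>R \<alpha> k"] norm_scaleR_le[OF b] F(2)
      by (fastforce simp: trig_def)
    have "heat_semigroup t (trig \<phi> \<alpha>) x - heat_semigroup t ?f x = heat_semigroup t (\<lambda>y. trig \<phi> \<alpha> y - ?f y) x"
      by (rule heat_semigroup_diff[OF t trig_continuous[OF c b s] trig_summable(2)[OF b s order_refl] _ nf, symmetric])
         (intro continuous_on_sum cf)
    then have "norm (heat_semigroup t (trig \<phi> \<alpha>) x - heat_semigroup t ?f x) \<le> e/2"
      using heat_semigroup_norm_le[OF t _ d] trig_continuous[OF c b s] cf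
      by (simp add: continuous_on_diff continuous_on_sum)
    moreover have "heat_semigroup t ?f x = (\<Sum>k\<in>F. \<phi> (wv k \<bullet> x) *\<^sub>R ?g k)"
      by (subst heat_semigroup_sum[OF t F(1), where B = "\<lambda>k. norm (\<alpha> k)"])
         (auto intro: cf norm_scaleR_le b simp only: h)
    moreover have "norm (trig \<phi> ?g x - (\<Sum>k\<in>F. \<phi> (wv k \<bullet> x) *\<^sub>R ?g k)) \<le> e/2"
      using infsum_diff_finite_norm_le[OF s _ F(1), of "\<lambda>k. \<phi> (wv k \<bullet> x) *\<^sub>R ?g k"]
        order_trans[OF norm_scaleR_le[OF b] gl] F(2)
      unfolding trig_def by fastforce
    ultimately show ?thesis
      using norm_triangle_ineq4[of "heat_semigroup t (trig \<phi> \<alpha>) x - heat_semigroup t ?f x" "trig \<phi> ?g x - heat_semigroup t ?f x"]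
      by simp
  qed
  then have "norm (heat_semigroup t (trig \<phi> \<alpha>) x - trig \<phi> ?g x) \<le> 0"
    by (rule field_le_epsilon[of _ 0, simplified])
  then show ?thesis by simp
qed

section \<open>From mode equations to classical solutions\<close>

text \<open>Treats \<open>sin\<close> (with derivative \<open>cos\<close>) and \<open>cos\<close>
  (with derivative \<open>- sin\<close>) at once; in both cases the second derivative is
  \<open>- \<phi>\<close>.\<close>

definition trig_pair :: "(real \<Rightarrow> real) \<Rightarrow> (real \<Rightarrow> real) \<Rightarrow> bool" where
  "trig_pair \<phi> \<phi>' \<longleftrightarrow> (\<forall>y. (\<phi> has_real_derivative \<phi>' y) (at y) \<and> (\<phi>' has_real_derivative - \<phi> y) (at y)
     \<and> \<bar>\<phi> y\<bar> \<le> 1 \<and> \<bar>\<phi>' y\<bar> \<le> 1)"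

lemma trig_pairD:
  assumes "trig_pair \<phi> \<phi>'"
  shows "(\<phi> has_real_derivative \<phi>' y) (at y)" "(\<phi>' has_real_derivative - \<phi> y) (at y)"
    "\<bar>\<phi> y\<bar> \<le> 1" "\<bar>\<phi>' y\<bar> \<le> 1" "\<bar>- \<phi> y\<bar> \<le> 1"
    "continuous_on UNIV \<phi>" "continuous_on UNIV \<phi>'" "continuous_on UNIV (\<lambda>y. - \<phi> y)"
proof -
  have d: "(\<phi> has_real_derivative \<phi>' y) (at y)" "(\<phi>' has_real_derivative - \<phi> y) (at y)" for y
    using assms by (auto simp: trig_pair_def)
  then show "(\<phi> has_real_derivative \<phi>' y) (at y)" "(\<phi>' has_real_derivative - \<phi> y) (at y)" .
  show "\<bar>\<phi> y\<bar> \<le> 1" "\<bar>\<phi>' y\<bar> \<le> 1" "\<bar>- \<phi> y\<bar> \<le> 1"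
    using assms by (auto simp: trig_pair_def)
  show "continuous_on UNIV \<phi>" "continuous_on UNIV \<phi>'"
    using d by (auto intro!: continuous_at_imp_continuous_on DERIV_isCont)
  then show "continuous_on UNIV (\<lambda>y. - \<phi> y)" by (intro continuous_intros)
qed

lemma trig_pair_sin: "trig_pair sin cos"
  and trig_pair_cos: "trig_pair cos (\<lambda>y. - sin y)"
  by (auto simp: trig_pair_def intro!: derivative_eq_intros)

lemma torus_trig_sin: "torus_fun (trig sin \<alpha>)"
  and torus_trig_cos: "torus_fun (trig cos \<alpha>)"
  by (rule trig_torus, rule sin_cos_plus_2pi_int)+

lemma poly_weight_summable:
  fixes m :: "mode \<Rightarrow> real"
  assumes "(\<lambda>k. (1 + norm (wv k))\<^sup>2 * m k) summable_on UNIV" "\<And>k. 0 \<le> m k"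
  shows "m summable_on UNIV" "(\<lambda>k. norm (wv k) * m k) summable_on UNIV"
    "(\<lambda>k. (norm (wv k))\<^sup>2 * m k) summable_on UNIV" "(\<lambda>k. (1 + norm (wv k)) * m k) summable_on UNIV"
proof -
  have le: "1 \<le> (1 + norm (wv k))\<^sup>2" "norm (wv k) \<le> (1 + norm (wv k))\<^sup>2"
    "(norm (wv k))\<^sup>2 \<le> (1 + norm (wv k))\<^sup>2" "1 + norm (wv k) \<le> (1 + norm (wv k))\<^sup>2" for k
    by (simp_all add: power2_eq_square algebra_simps add_increasing)
  have "(\<lambda>k. c k * m k) summable_on UNIV" if "\<And>k. 0 \<le> c k" "\<And>k. c k \<le> (1 + norm (wv k))\<^sup>2" for c
    by (rule summable_norm_bound(1)[OF assms(1)]) (use that assms(2) in \<open>auto simp: abs_mult intro!: mult_right_mono\<close>)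
  from this[of "\<lambda>_. 1"] this[of "\<lambda>k. norm (wv k)"] this[of "\<lambda>k. (norm (wv k))\<^sup>2"] this[of "\<lambda>k. 1 + norm (wv k)"] le
  show "m summable_on UNIV" "(\<lambda>k. norm (wv k) * m k) summable_on UNIV"
    "(\<lambda>k. (norm (wv k))\<^sup>2 * m k) summable_on UNIV" "(\<lambda>k. (1 + norm (wv k)) * m k) summable_on UNIV"
    by auto
qed

lemma trig_second_partial:
  assumes tp: "trig_pair \<phi> \<phi>'" and s: "(\<lambda>k. (1 + norm (wv k))\<^sup>2 * norm (\<alpha> k)) summable_on UNIV"
  shows "partial j (trig \<phi> \<alpha>) = trig \<phi>' (\<lambda>k. (wv k $ j) *\<^sub>R \<alpha> k)"
    "trig \<phi> \<alpha> differentiable (at x)" "partial j (trig \<phi> \<alpha>) differentiable (at x)"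
    "partial i (partial j (trig \<phi> \<alpha>)) = trig (\<lambda>y. - \<phi> y) (\<lambda>k. (wv k $ i) *\<^sub>R (wv k $ j) *\<^sub>R \<alpha> k)"
proof -
  note t = trig_pairD[OF tp]
  note s' = poly_weight_summable[OF s norm_ge_zero]
  have a: "(\<lambda>k. norm ((wv k $ j) *\<^sub>R \<alpha> k)) summable_on UNIV" for j
    by (rule summable_norm_bound(2)[OF s'(2)]) (simp add: abs_wv_nth_le mult_right_mono)
  have b: "(\<lambda>k. norm (wv k) * norm ((wv k $ j) *\<^sub>R \<alpha> k)) summable_on UNIV" for j
    by (rule summable_norm_bound(1)[OF s'(3)])
       (auto simp: power2_eq_square mult.assoc abs_wv_nth_le intro!: mult_left_mono mult_right_mono)
  show p: "partial j (trig \<phi> \<alpha>) = trig \<phi>' (\<lambda>k. (wv k $ j) *\<^sub>R \<alpha> k)"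
    using trig_partial(1)[OF t(1,3,4) s'(1,2)] by blast
  show "trig \<phi> \<alpha> differentiable (at x)"
    using trig_partial(2)[OF t(1,3,4) s'(1,2)] .
  show "partial j (trig \<phi> \<alpha>) differentiable (at x)"
    unfolding p using trig_partial(2)[OF t(2,4,5) a b] .
  show "partial i (partial j (trig \<phi> \<alpha>)) = trig (\<lambda>y. - \<phi> y) (\<lambda>k. (wv k $ i) *\<^sub>R (wv k $ j) *\<^sub>R \<alpha> k)"
    unfolding p using trig_partial(1)[OF t(2,4,5) a b] by blast
qed

lemma trig_laplacian:
  assumes tp: "trig_pair \<phi> \<phi>'" and s: "(\<lambda>k. (1 + norm (wv k))\<^sup>2 * norm (\<alpha> k)) summable_on UNIV"
  shows "laplacian (trig \<phi> \<alpha>) x = trig \<phi> (\<lambda>k. - (norm (wv k))\<^sup>2 *\<^sub>R \<alpha> k) x"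
proof -
  note s' = poly_weight_summable[OF s norm_ge_zero]
  have b: "(\<lambda>k. norm ((wv k $ j) *\<^sub>R (wv k $ j) *\<^sub>R \<alpha> k)) summable_on UNIV" for j
  proof (rule summable_norm_bound(2)[OF s'(3)])
    show "norm ((wv k $ j) *\<^sub>R (wv k $ j) *\<^sub>R \<alpha> k) \<le> (norm (wv k))\<^sup>2 * norm (\<alpha> k)" for k
      using mult_mono[OF abs_wv_nth_le[of k j] abs_wv_nth_le[of k j]]
      by (simp add: power2_eq_square mult.assoc[symmetric] mult_right_mono)
  qed
  have "laplacian (trig \<phi> \<alpha>) x = (\<Sum>j\<in>UNIV. - trig \<phi> (\<lambda>k. (wv k $ j) *\<^sub>R (wv k $ j) *\<^sub>R \<alpha> k) x)"
    unfolding laplacian_def trig_second_partial(4)[OF tp s] trig_minus_fun ..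
  also have "\<dots> = - (\<Sum>\<^sub>\<infinity>k. \<Sum>j\<in>UNIV. \<phi> (wv k \<bullet> x) *\<^sub>R ((wv k $ j) *\<^sub>R (wv k $ j) *\<^sub>R \<alpha> k))"
    unfolding sum_negf trig_def
    by (subst infsum_sum_swap(1)) (auto simp only: finite intro!: trig_summable(1)[OF trig_pairD(3)[OF tp] b order_refl])
  also have "(\<Sum>\<^sub>\<infinity>k. \<Sum>j\<in>UNIV. \<phi> (wv k \<bullet> x) *\<^sub>R ((wv k $ j) *\<^sub>R (wv k $ j) *\<^sub>R \<alpha> k)) = trig \<phi> (\<lambda>k. (norm (wv k))\<^sup>2 *\<^sub>R \<alpha> k) x"
    unfolding trig_def scaleR_sum_right[symmetric] power2_norm_eq_inner inner_vec_def
    by (simp add: scaleR_sum_left)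
  also have "- \<dots> = trig \<phi> (\<lambda>k. - (norm (wv k))\<^sup>2 *\<^sub>R \<alpha> k) x"
    by (simp add: trig_uminus[symmetric])
  finally show ?thesis .
qed

lemma trig_divergence_free:
  assumes tp: "trig_pair \<phi> \<phi>'" and s: "(\<lambda>k. (1 + norm (wv k))\<^sup>2 * norm (\<alpha> k)) summable_on UNIV"
    and "\<And>k. wv k \<bullet> \<alpha> k = 0"
  shows "divergence (trig \<phi> \<alpha>) x = 0"
proof -
  note t = trig_pairD[OF tp]
  note s' = poly_weight_summable[OF s norm_ge_zero]
  have a: "(\<lambda>k. norm ((wv k $ j) *\<^sub>R \<alpha> k)) summable_on UNIV" for j
    by (rule summable_norm_bound(2)[OF s'(2)]) (simp add: abs_wv_nth_le mult_right_mono)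
  have a': "(\<lambda>k. norm (wv k $ j * \<alpha> k $ j)) summable_on UNIV" for j
    by (rule summable_norm_bound(2)[OF s'(2)])
       (auto simp: abs_mult intro!: mult_mono abs_wv_nth_le component_le_norm_cart)
  have "divergence (trig \<phi> \<alpha>) x = (\<Sum>j\<in>UNIV. trig \<phi>' (\<lambda>k. wv k $ j * \<alpha> k $ j) x)"
    unfolding divergence_def trig_second_partial(1)[OF tp s]
    by (simp add: trig_bounded_linear[OF bounded_linear_vec_nth t(4) a])
  also have "\<dots> = (\<Sum>\<^sub>\<infinity>k. \<Sum>j\<in>UNIV. \<phi>' (wv k \<bullet> x) *\<^sub>R (wv k $ j * \<alpha> k $ j))"
    unfolding trig_def
    by (rule infsum_sum_swap(1)[symmetric]) (auto simp only: finite intro!: trig_summable(1)[OF t(4) a' order_refl])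
  also have "\<dots> = (\<Sum>\<^sub>\<infinity>k. \<phi>' (wv k \<bullet> x) *\<^sub>R (wv k \<bullet> \<alpha> k))"
    unfolding scaleR_sum_right[symmetric] inner_vec_def by simp
  finally show ?thesis by (simp add: assms(3))
qed

text \<open>Two space derivatives cost \<open>(norm (wv k))\<^sup>2\<close>, so \<open>m\<close> has
  to be summable with a quadratic weight, while the time derivative comes with its own majorant
  \<open>m'\<close>.\<close>

lemma C12_trig:
  fixes \<alpha> \<alpha>' :: "real \<Rightarrow> mode \<Rightarrow> real ^ 3"
  assumes tp: "trig_pair \<phi> \<phi>'" and T: "0 < T" and s: "(\<lambda>k. (1 + norm (wv k))\<^sup>2 * m k) summable_on UNIV"
    and m: "\<And>t k. t \<in> {0..T} \<Longrightarrow> norm (\<alpha> t k) \<le> m k"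
    and m': "m' summable_on UNIV" "\<And>t k. t \<in> {0..T} \<Longrightarrow> norm (\<alpha>' t k) \<le> m' k"
    and d: "\<And>t k. t \<in> {0..T} \<Longrightarrow> ((\<lambda>t. \<alpha> t k) has_vector_derivative \<alpha>' t k) (at t within {0..T})"
    and c: "\<And>k. continuous_on {0..T} (\<lambda>t. \<alpha>' t k)"
  shows "C12 T (\<lambda>t. trig \<phi> (\<alpha> t))"
    "t \<in> {0..T} \<Longrightarrow> time_deriv T (\<lambda>t. trig \<phi> (\<alpha> t)) t x = trig \<phi> (\<alpha>' t) x"
proof -
  note t = trig_pairD[OF tp]
  have m0: "0 \<le> m k" for k using order_trans[OF norm_ge_zero m[of 0 k]] T by auto
  note s' = poly_weight_summable[OF s m0]
  have sa: "(\<lambda>k. (1 + norm (wv k))\<^sup>2 * norm (\<alpha> t k)) summable_on UNIV" if "t \<in> {0..T}" for t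
    by (rule summable_norm_bound(1)[OF s]) (use m[OF that] in \<open>auto simp: abs_mult intro!: mult_left_mono\<close>)
  have ca: "continuous_on {0..T} (\<lambda>t. \<alpha> t k)" for k
    unfolding continuous_on_eq_continuous_within using d[of _ k] has_vector_derivative_continuous by blast
  have td: "((\<lambda>t. trig \<phi> (\<alpha> t) x) has_vector_derivative trig \<phi> (\<alpha>' t) x) (at t within {0..T})"
    if "t \<in> {0..T}" for t x
    by (rule trig_has_vector_derivative[OF _ t(3) s'(1) m'(1) m m'(2) d that]) auto
  show tde: "time_deriv T (\<lambda>t. trig \<phi> (\<alpha> t)) t x = trig \<phi> (\<alpha>' t) x" if "t \<in> {0..T}" for t x
    unfolding time_deriv_def using vector_derivative_within_cbox[of 0 T t "\<lambda>s. trig \<phi> (\<alpha> s) x" "trig \<phi> (\<alpha>' t) x"] T that td[OF that, of x]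
    by (simp add: cbox_interval)
  have n1: "norm ((wv k $ j) *\<^sub>R \<alpha> t k) \<le> norm (wv k) * m k" if "t \<in> {0..T}" for t k j
    using m[OF that, of k] by (simp, intro mult_mono abs_wv_nth_le) auto
  have n2: "norm ((wv k $ i) *\<^sub>R (wv k $ j) *\<^sub>R \<alpha> t k) \<le> (norm (wv k))\<^sup>2 * m k" if "t \<in> {0..T}" for t k i j
  proof -
    have "\<bar>wv k $ i\<bar> * (\<bar>wv k $ j\<bar> * norm (\<alpha> t k)) \<le> norm (wv k) * (norm (wv k) * m k)"
      using m[OF that, of k] by (intro mult_mono abs_wv_nth_le) (auto simp: m0)
    then show ?thesis by (simp add: power2_eq_square abs_mult mult.assoc)
  qed
  show "C12 T (\<lambda>t. trig \<phi> (\<alpha> t))"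
    unfolding C12_def
  proof (intro conjI ballI allI)
    show "(\<lambda>s. trig \<phi> (\<alpha> s) x) differentiable (at t within {0..T})" if "t \<in> {0..T}" for t x
      using td[OF that] by (rule differentiableI_vector)
    show "trig \<phi> (\<alpha> t) differentiable (at x)" "partial j (trig \<phi> (\<alpha> t)) differentiable (at x)"
      if "t \<in> {0..T}" for t x j
      using trig_second_partial(2,3)[OF tp sa[OF that]] .
    show "continuous_on ({0..T} \<times> UNIV) (\<lambda>(t, x). trig \<phi> (\<alpha> t) x)"
      by (rule trig_continuous_time[OF t(6,3) s'(1) m ca])
    have "continuous_on ({0..T} \<times> UNIV) (\<lambda>(t, x). trig \<phi> (\<alpha>' t) x)"
      by (rule trig_continuous_time[OF t(6,3) m' c])
    then show "continuous_on ({0..T} \<times> UNIV) (\<lambda>(t, x). time_deriv T (\<lambda>t. trig \<phi> (\<alpha> t)) t x)"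
      by (rule continuous_on_eq) (auto simp: tde)
    have "continuous_on ({0..T} \<times> UNIV) (\<lambda>(t, x). trig \<phi>' (\<lambda>k. (wv k $ j) *\<^sub>R \<alpha> t k) x)" for j
      by (rule trig_continuous_time[OF t(7,4) s'(2) n1]) (auto intro!: continuous_intros ca)
    then show "continuous_on ({0..T} \<times> UNIV) (\<lambda>(t, x). partial j (trig \<phi> (\<alpha> t)) x)" for j
      by (rule continuous_on_eq) (auto simp: trig_second_partial(1)[OF tp sa])
    have "continuous_on ({0..T} \<times> UNIV) (\<lambda>(t, x). trig (\<lambda>y. - \<phi> y) (\<lambda>k. (wv k $ i) *\<^sub>R (wv k $ j) *\<^sub>R \<alpha> t k) x)" for i j
      by (rule trig_continuous_time[OF t(8,5) s'(3) n2]) (auto intro!: continuous_intros ca)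
    then show "continuous_on ({0..T} \<times> UNIV) (\<lambda>(t, x). partial i (partial j (trig \<phi> (\<alpha> t))) x)" for i j
      by (rule continuous_on_eq) (auto simp only: trig_second_partial(4)[OF tp sa] mem_Times_iff fst_conv split: prod.splits)
  qed
qed

text \<open>The Leray projection on one Fourier mode, orthogonal to \<open>wv k\<close>. At
  \<open>k = 0\<close> the quotient is \<open>0 / 0 = 0\<close> and the projection is the
  identity.\<close>

definition leray :: "mode \<Rightarrow> real ^ 3 \<Rightarrow> real ^ 3" where
  "leray k v = v - ((wv k \<bullet> v) / (norm (wv k))\<^sup>2) *\<^sub>R wv k"

lemma leray_orth: "wv k \<bullet> leray k v = 0"
  by (cases "wv k = 0") (simp_all add: leray_def inner_diff_right power2_norm_eq_inner)

lemma leray_bounded_linear: "bounded_linear (leray k)"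
  unfolding leray_def[abs_def] divide_inverse
  by (intro bounded_linear_sub bounded_linear_ident bounded_linear_scaleR_const bounded_linear_mult_const
      bounded_linear_inner_right)

lemma leray_minus: "leray (- k) v = leray k v"
  by (simp add: leray_def wv_minus)

text \<open>Pythagoras: the removed multiple of \<open>wv k\<close> is orthogonal to what
  remains.\<close>

lemma norm_leray_le: "norm (leray k v) \<le> norm v"
proof -
  define c where "c = (wv k \<bullet> v) / (norm (wv k))\<^sup>2"
  have "leray k v \<bullet> leray k v \<le> leray k v \<bullet> leray k v + c\<^sup>2 * (wv k \<bullet> wv k)" by simp
  also have "\<dots> = (leray k v + c *\<^sub>R wv k) \<bullet> (leray k v + c *\<^sub>R wv k)"
    using leray_orth[of k v] by (simp add: inner_add_left inner_add_right inner_commute power2_eq_square)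
  also have "\<dots> = v \<bullet> v" by (simp add: leray_def c_def)
  finally show ?thesis unfolding norm_eq_sqrt_inner by simp
qed

text \<open>The MHD system for the sine coefficients \<open>a\<close> of the velocity and the cosine
  coefficients \<open>b\<close> of the magnetic field, with the pressure eliminated by
  \<open>leray\<close>. The \<open>b\<close> terms in \<open>a_ode\<close> carry a plus sign
  although the system has \<open>- b \<cdot> \<nabla>b\<close>, because differentiating a cosine
  contributes a second minus.\<close>

locale mhd_modes =
  fixes T :: real and a b :: "mode \<Rightarrow> real \<Rightarrow> real ^ 3" and m :: "mode \<Rightarrow> real"
  assumes T: "0 < T"
    and weight: "(\<lambda>k. (1 + norm (wv k))\<^sup>2 * m k) summable_on UNIV"
    and a_le: "t \<in> {0..T} \<Longrightarrow> norm (a k t) \<le> m k" and b_le: "t \<in> {0..T} \<Longrightarrow> norm (b k t) \<le> m k"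
    and a_odd: "t \<in> {0..T} \<Longrightarrow> a (- k) t = - a k t" and b_even: "t \<in> {0..T} \<Longrightarrow> b (- k) t = b k t"
    and a_div: "t \<in> {0..T} \<Longrightarrow> wv k \<bullet> a k t = 0" and b_div: "t \<in> {0..T} \<Longrightarrow> wv k \<bullet> b k t = 0"
    and a_ode: "t \<in> {0..T} \<Longrightarrow> (a k has_vector_derivative - (norm (wv k))\<^sup>2 *\<^sub>R a k t
      - leray k (\<Sum>\<^sub>\<infinity>j. (a j t \<bullet> wv k) *\<^sub>R a (k - j) t + (b j t \<bullet> wv k) *\<^sub>R b (k - j) t)) (at t within {0..T})"
    and b_ode: "t \<in> {0..T} \<Longrightarrow> (b k has_vector_derivative - (norm (wv k))\<^sup>2 *\<^sub>R b k t
      - (\<Sum>\<^sub>\<infinity>j. (a j t \<bullet> wv k) *\<^sub>R b (k - j) t - (b j t \<bullet> wv k) *\<^sub>R a (k - j) t)) (at t within {0..T})"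
begin

definition "H k t = (\<Sum>\<^sub>\<infinity>j. (a j t \<bullet> wv k) *\<^sub>R a (k - j) t + (b j t \<bullet> wv k) *\<^sub>R b (k - j) t)"
definition "G k t = (\<Sum>\<^sub>\<infinity>j. (a j t \<bullet> wv k) *\<^sub>R b (k - j) t - (b j t \<bullet> wv k) *\<^sub>R a (k - j) t)"

lemma m_nonneg: "0 \<le> m k"
  using order_trans[OF norm_ge_zero a_le[of 0 k]] T by auto

lemmas sm = poly_weight_summable[OF weight m_nonneg]

lemma ns: "nonneg_summable m" "nonneg_summable (\<lambda>k. (1 + norm (wv k)) * m k)"
  using sm m_nonneg by (auto simp: nonneg_summable_def)

lemma term_le:
  assumes "norm x \<le> m j" "norm y \<le> m (k - j)"
  shows "norm ((x \<bullet> wv k) *\<^sub>R y) \<le> norm (wv k) * (m j * m (k - j))"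
proof -
  have "\<bar>x \<bullet> wv k\<bar> \<le> m j * norm (wv k)"
    using order_trans[OF Cauchy_Schwarz_ineq2 mult_right_mono[OF assms(1) norm_ge_zero]] .
  from mult_mono[OF this assms(2)] show ?thesis
    by (simp add: m_nonneg ac_simps)
qed

lemma term_summable:
  fixes x y :: "mode \<Rightarrow> real ^ 3"
  assumes "\<And>j. norm (x j) \<le> m j" "\<And>j. norm (y j) \<le> m j"
  shows "(\<lambda>j. (x j \<bullet> wv k) *\<^sub>R y (k - j)) summable_on UNIV"
    "norm (\<Sum>\<^sub>\<infinity>j. (x j \<bullet> wv k) *\<^sub>R y (k - j)) \<le> norm (wv k) * cv m m k"
proof -
  have s: "(\<lambda>j. norm (wv k) * (m j * m (k - j))) summable_on UNIV"
    by (intro summable_on_cmult_right cv_term_summable ns)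
  show "(\<lambda>j. (x j \<bullet> wv k) *\<^sub>R y (k - j)) summable_on UNIV"
    by (rule summable_norm_bound(1)[OF s]) (rule term_le[OF assms])
  have "norm (\<Sum>\<^sub>\<infinity>j. (x j \<bullet> wv k) *\<^sub>R y (k - j)) \<le> (\<Sum>\<^sub>\<infinity>j. norm (wv k) * (m j * m (k - j)))"
    by (rule summable_norm_bound(3)[OF s]) (rule term_le[OF assms])
  then show "norm (\<Sum>\<^sub>\<infinity>j. (x j \<bullet> wv k) *\<^sub>R y (k - j)) \<le> norm (wv k) * cv m m k"
    by (simp add: cv_def infsum_cmult_right')
qed

text \<open>One factor \<open>1 + norm (wv k)\<close> of the output frequency is distributed over
  the two inputs, so that \<open>M\<close> majorizes the nonlinear terms together with the
  derivative they contain.\<close>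

abbreviation M where "M k \<equiv> cv (\<lambda>k. (1 + norm (wv k)) * m k) (\<lambda>k. (1 + norm (wv k)) * m k) k"

lemma M_summable: "M summable_on UNIV"
  using nonneg_summable_cv(1)[OF ns(2,2)] by (simp add: nonneg_summable_def)

lemma weighted_cv_le: "(1 + norm (wv k)) * cv m m k \<le> M k"
proof -
  have s: "(\<lambda>j. (1 + norm (wv k)) * (m j * m (k - j))) summable_on UNIV"
    by (intro summable_on_cmult_right cv_term_summable ns)
  have "(1 + norm (wv k)) * (m j * m (k - j)) \<le> ((1 + norm (wv j)) * (1 + norm (wv (k - j)))) * (m j * m (k - j))" for j
    by (intro mult_right_mono norm_wv_le_mult) (simp add: m_nonneg)
  then have "(\<Sum>\<^sub>\<infinity>j. (1 + norm (wv k)) * (m j * m (k - j))) \<le> M k"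
    unfolding cv_def by (intro infsum_mono s cv_term_summable ns) (simp add: ac_simps)
  then show ?thesis by (simp add: cv_def infsum_cmult_right')
qed

lemma cv_nonneg: "0 \<le> cv m m k"
  unfolding cv_def by (intro infsum_nonneg) (simp add: m_nonneg)

lemma wv_cv_le_M: "norm (wv k) * cv m m k \<le> M k" and cv_le_M: "cv m m k \<le> M k"
  using weighted_cv_le[of k] cv_nonneg[of k] mult_nonneg_nonneg[OF norm_ge_zero[of "wv k"] cv_nonneg[of k]]
  unfolding distrib_right mult_1 by linarith+

context fixes t assumes t: "t \<in> {0..T}" begin

lemmas at = a_le[OF t] b_le[OF t]

lemma H_eq: "H k t = (\<Sum>\<^sub>\<infinity>j. (a j t \<bullet> wv k) *\<^sub>R a (k - j) t) + (\<Sum>\<^sub>\<infinity>j. (b j t \<bullet> wv k) *\<^sub>R b (k - j) t)"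
  unfolding H_def by (intro infsum_add term_summable at)

lemma G_eq: "G k t = (\<Sum>\<^sub>\<infinity>j. (a j t \<bullet> wv k) *\<^sub>R b (k - j) t) - (\<Sum>\<^sub>\<infinity>j. (b j t \<bullet> wv k) *\<^sub>R a (k - j) t)"
  unfolding G_def by (intro infsum_diff term_summable at)

lemma H_le: "norm (H k t) \<le> 2 * (norm (wv k) * cv m m k)" and G_le: "norm (G k t) \<le> 2 * (norm (wv k) * cv m m k)"
  unfolding H_eq G_eq
  using norm_triangle_le[OF add_mono[OF term_summable(2)[OF at(1,1), where k = k] term_summable(2)[OF at(2,2), where k = k]]]
    order_trans[OF norm_triangle_ineq4 add_mono[OF term_summable(2)[OF at(1,2), where k = k] term_summable(2)[OF at(2,1), where k = k]]]
  by simp_all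

lemma summable_terms:
  fixes x y :: "mode \<Rightarrow> real ^ 3"
  assumes "\<And>j. norm (x j) \<le> m j" "\<And>j. norm (y j) \<le> m j"
  shows "(\<lambda>k. norm (\<Sum>\<^sub>\<infinity>j. (x j \<bullet> wv k) *\<^sub>R y (k - j))) summable_on UNIV"
  by (rule summable_norm_bound(2)[OF M_summable]) (rule order_trans[OF term_summable(2)[OF assms] wv_cv_le_M])

lemma summable_a: "(\<lambda>k. norm (a k t)) summable_on UNIV" "(\<lambda>k. norm (wv k) * norm (a k t)) summable_on UNIV"
    "(\<lambda>k. (1 + norm (wv k))\<^sup>2 * norm (a k t)) summable_on UNIV"
  and summable_b: "(\<lambda>k. norm (b k t)) summable_on UNIV" "(\<lambda>k. norm (wv k) * norm (b k t)) summable_on UNIV"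
    "(\<lambda>k. (1 + norm (wv k))\<^sup>2 * norm (b k t)) summable_on UNIV"
proof -
  show a: "(\<lambda>k. (1 + norm (wv k))\<^sup>2 * norm (a k t)) summable_on UNIV"
    by (rule summable_norm_bound(1)[OF weight]) (use at in \<open>auto simp: abs_mult intro!: mult_left_mono\<close>)
  show b: "(\<lambda>k. (1 + norm (wv k))\<^sup>2 * norm (b k t)) summable_on UNIV"
    by (rule summable_norm_bound(1)[OF weight]) (use at in \<open>auto simp: abs_mult intro!: mult_left_mono\<close>)
  show "(\<lambda>k. norm (a k t)) summable_on UNIV" "(\<lambda>k. norm (wv k) * norm (a k t)) summable_on UNIV"
    "(\<lambda>k. norm (b k t)) summable_on UNIV" "(\<lambda>k. norm (wv k) * norm (b k t)) summable_on UNIV"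
    using poly_weight_summable[OF a norm_ge_zero] poly_weight_summable[OF b norm_ge_zero] by blast+
qed

abbreviation "U \<equiv> trig sin (\<lambda>k. a k t)"
abbreviation "B \<equiv> trig cos (\<lambda>k. b k t)"

lemma partial_U: "partial j U x = trig cos (\<lambda>k. (wv k $ j) *\<^sub>R a k t) x"
  and partial_B: "partial j B x = trig (\<lambda>y. - sin y) (\<lambda>k. (wv k $ j) *\<^sub>R b k t) x"
  using trig_second_partial(1)[OF trig_pair_sin summable_a(3)] trig_second_partial(1)[OF trig_pair_cos summable_b(3)]
  by simp_all

text \<open>The four advection terms differ in the signs \<open>s\<close> and \<open>s'\<close> of
  the product-to-sum formula. Among them only the product of \<open>cos\<close> with
  \<open>- sin\<close>, from \<open>b\<close> transporting itself, has
  \<open>s = - 1\<close>.\<close>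

lemma advect_UU: "advect U U x = trig sin (\<lambda>k. \<Sum>\<^sub>\<infinity>j. (a j t \<bullet> wv k) *\<^sub>R a (k - j) t) x"
  by (subst advect_trig[OF partial_U, where s = 1 and s' = 1 and \<theta> = sin])
     (auto simp: sin_add sin_diff a_odd[OF t] a_div[OF t] summable_a)

lemma advect_BB: "advect B B x = - trig sin (\<lambda>k. \<Sum>\<^sub>\<infinity>j. (b j t \<bullet> wv k) *\<^sub>R b (k - j) t) x"
  by (subst advect_trig[OF partial_B, where s = "-1" and s' = 1 and \<theta> = sin])
     (auto simp: sin_add sin_diff b_even[OF t] b_div[OF t] summable_b)

lemma advect_UB: "advect U B x = trig cos (\<lambda>k. \<Sum>\<^sub>\<infinity>j. (a j t \<bullet> wv k) *\<^sub>R b (k - j) t) x"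
  by (subst advect_trig[OF partial_B, where s = 1 and s' = "-1" and \<theta> = cos])
     (auto simp: cos_add cos_diff b_even[OF t] a_div[OF t] summable_a summable_b)

lemma advect_BU: "advect B U x = trig cos (\<lambda>k. \<Sum>\<^sub>\<infinity>j. (b j t \<bullet> wv k) *\<^sub>R a (k - j) t) x"
  by (subst advect_trig[OF partial_U, where s = 1 and s' = 1 and \<theta> = cos])
     (auto simp: cos_add cos_diff a_odd[OF t] b_div[OF t] summable_a summable_b)

lemma nonlinear_U: "advect U U x - advect B B x = trig sin (\<lambda>k. H k t) x"
  unfolding advect_UU advect_BB H_eq
  by (subst trig_add) (auto intro: summable_terms at)

lemma nonlinear_B: "advect U B x - advect B U x = trig cos (\<lambda>k. G k t) x"
  unfolding advect_UB advect_BU G_eq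
  by (subst trig_diff) (auto intro: summable_terms at)

end

lemma H_continuous: "continuous_on {0..T} (H k)" and G_continuous: "continuous_on {0..T} (G k)"
proof -
  have ca: "continuous_on {0..T} (a k)" for k
    unfolding continuous_on_eq_continuous_within using a_ode[of _ k] has_vector_derivative_continuous by blast
  have cb: "continuous_on {0..T} (b k)" for k
    unfolding continuous_on_eq_continuous_within using b_ode[of _ k] has_vector_derivative_continuous by blast
  have s: "(\<lambda>j. 2 * (norm (wv k) * (m j * m (k - j)))) summable_on UNIV"
    by (intro summable_on_cmult_right cv_term_summable ns)
  show "continuous_on {0..T} (H k)" unfolding H_def
  proof (rule continuous_on_infsum[OF _ _ s])
    fix j t assume t: "t \<in> {0..T}"
    show "norm ((a j t \<bullet> wv k) *\<^sub>R a (k - j) t + (b j t \<bullet> wv k) *\<^sub>R b (k - j) t) \<le> 2 * (norm (wv k) * (m j * m (k - j)))"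
      unfolding mult_2 by (intro norm_triangle_le add_mono term_le a_le b_le t)
  qed (intro continuous_intros ca cb)
  show "continuous_on {0..T} (G k)" unfolding G_def
  proof (rule continuous_on_infsum[OF _ _ s])
    fix j t assume t: "t \<in> {0..T}"
    show "norm ((a j t \<bullet> wv k) *\<^sub>R b (k - j) t - (b j t \<bullet> wv k) *\<^sub>R a (k - j) t) \<le> 2 * (norm (wv k) * (m j * m (k - j)))"
      unfolding mult_2 by (intro order_trans[OF norm_triangle_ineq4] add_mono term_le a_le b_le t)
  qed (intro continuous_intros ca cb)
qed

text \<open>The pressure coefficient, chosen so that \<open>P k t *\<^sub>R wv k\<close> is the part
  of \<open>H k t\<close> that the projection removes. At \<open>k = 0\<close> it is 0, which
  normalizes the mean pressure.\<close>

definition "P k t = (wv k \<bullet> H k t) / (norm (wv k))\<^sup>2"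

lemma P_le: 
  assumes "t \<in> {0..T}" shows "\<bar>P k t\<bar> \<le> 2 * M k" "norm (wv k) * \<bar>P k t\<bar> \<le> 2 * M k"
proof -
  have h: "norm (wv k) * \<bar>P k t\<bar> \<le> norm (H k t)"
    using Cauchy_Schwarz_ineq2[of "wv k" "H k t"]
    by (cases "wv k = 0") (simp_all add: P_def power2_eq_square abs_mult field_simps)
  with H_le[OF assms, of k] wv_cv_le_M[of k] show "norm (wv k) * \<bar>P k t\<bar> \<le> 2 * M k" by linarith
  show "\<bar>P k t\<bar> \<le> 2 * M k"
  proof (cases "wv k = 0")
    case True
    then show ?thesis using cv_le_M[of k] cv_nonneg[of k] by (simp add: P_def)
  next
    case False
    have "norm (wv k) * \<bar>P k t\<bar> \<le> norm (wv k) * (2 * cv m m k)"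
      using h H_le[OF assms, of k] by (simp add: ac_simps)
    then have "\<bar>P k t\<bar> \<le> 2 * cv m m k" using False by simp
    then show ?thesis using cv_le_M[of k] by linarith
  qed
qed

lemma grad_P: "grad (trig cos (\<lambda>k. P k t)) x = - trig sin (\<lambda>k. P k t *\<^sub>R wv k) x"
  and differentiable_P: "trig cos (\<lambda>k. P k t) differentiable (at x)" if t: "t \<in> {0..T}"
proof -
  have s: "(\<lambda>k. norm (P k t)) summable_on UNIV"
    by (rule summable_norm_bound(2)[OF summable_on_cmult_right[OF M_summable, of 2]]) (use P_le[OF t] in auto)
  have s1: "(\<lambda>k. norm (wv k) * norm (P k t)) summable_on UNIV"
    by (rule summable_norm_bound(1)[OF summable_on_cmult_right[OF M_summable, of 2]]) (use P_le[OF t] in \<open>auto simp: abs_mult\<close>)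
  note tp = trig_pairD[OF trig_pair_cos]
  note p = trig_partial[OF tp(1,3,4) s s1]
  show "trig cos (\<lambda>k. P k t) differentiable (at x)" by (rule p(2))
  have s2: "(\<lambda>k. norm (P k t *\<^sub>R wv k)) summable_on UNIV"
    using s1 by (simp add: mult.commute)
  show "grad (trig cos (\<lambda>k. P k t)) x = - trig sin (\<lambda>k. P k t *\<^sub>R wv k) x"
    unfolding vec_eq_iff grad_def p(1) trig_minus_fun
    by (simp add: trig_bounded_linear[OF bounded_linear_vec_nth _ s2] mult.commute)
qed

lemma C01_P: "C01 T (\<lambda>t. trig cos (\<lambda>k. P k t))"
  unfolding C01_def
proof (intro conjI ballI allI)
  have cP: "continuous_on {0..T} (P k)" for k
    unfolding P_def divide_inverse by (intro continuous_intros H_continuous)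
  note s = summable_on_cmult_right[OF M_summable, of 2]
  show "trig cos (\<lambda>k. P k t) differentiable (at x)" if "t \<in> {0..T}" for t x
    by (rule differentiable_P[OF that])
  show "continuous_on ({0..T} \<times> UNIV) (\<lambda>(t, x). trig cos (\<lambda>k. P k t) x)"
    by (rule trig_continuous_time[OF _ _ s _ cP]) (auto intro: P_le continuous_intros)
  have "continuous_on ({0..T} \<times> UNIV) (\<lambda>(t, x). trig sin (\<lambda>k. P k t *\<^sub>R wv k) x)"
    by (rule trig_continuous_time[OF _ _ s])
       (use P_le in \<open>auto intro!: continuous_intros cP simp: mult.commute[of "\<bar>_\<bar>"]\<close>)
  then have "continuous_on ({0..T} \<times> UNIV) (\<lambda>p. - (case p of (t, x) \<Rightarrow> trig sin (\<lambda>k. P k t *\<^sub>R wv k) x))"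
    by (rule continuous_on_minus)
  then show "continuous_on ({0..T} \<times> UNIV) (\<lambda>(t, x). grad (trig cos (\<lambda>k. P k t)) x)"
    by (rule continuous_on_eq) (auto simp: grad_P)
qed

theorem classical_solution:
  "mhd_solution T (\<lambda>t. trig sin (\<lambda>k. a k t)) (\<lambda>t. trig cos (\<lambda>k. b k t)) (\<lambda>t. trig cos (\<lambda>k. P k t))"
proof -
  define a' where "a' t k = - (norm (wv k))\<^sup>2 *\<^sub>R a k t - leray k (H k t)" for t k
  define b' where "b' t k = - (norm (wv k))\<^sup>2 *\<^sub>R b k t - G k t" for t k
  \<comment> \<open>Majorant of the time derivatives: the Laplacian accounts for the first summand,
    the nonlinear terms for the second.\<close>
  define m' where "m' k = (norm (wv k))\<^sup>2 * m k + 2 * M k" for k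
  have m': "m' summable_on UNIV"
    unfolding m'_def by (intro summable_on_add summable_on_cmult_right sm M_summable)
  have ca: "continuous_on {0..T} (a k)" for k
    unfolding continuous_on_eq_continuous_within using a_ode[of _ k] has_vector_derivative_continuous by blast
  have cb: "continuous_on {0..T} (b k)" for k
    unfolding continuous_on_eq_continuous_within using b_ode[of _ k] has_vector_derivative_continuous by blast
  have a'c: "continuous_on {0..T} (\<lambda>t. a' t k)" and b'c: "continuous_on {0..T} (\<lambda>t. b' t k)" for k
    unfolding a'_def b'_def
    by (intro continuous_intros ca cb H_continuous G_continuous bounded_linear.continuous_on[OF leray_bounded_linear])+
  have n: "norm (- (norm (wv k))\<^sup>2 *\<^sub>R x - y) \<le> m' k" if "norm x \<le> m k" "norm y \<le> 2 * (norm (wv k) * cv m m k)" for k and x y :: "real^3"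
    unfolding m'_def
    by (intro order_trans[OF norm_triangle_ineq4] add_mono order_trans[OF that(2)])
       (use that(1) wv_cv_le_M[of k] in \<open>auto intro: mult_left_mono\<close>)
  have a'n: "norm (a' t k) \<le> m' k" and b'n: "norm (b' t k) \<le> m' k" if "t \<in> {0..T}" for t k
    unfolding a'_def b'_def
    by (intro n a_le b_le that order_trans[OF norm_leray_le] H_le G_le)+
  have ad: "((\<lambda>t. a k t) has_vector_derivative a' t k) (at t within {0..T})"
    and bd: "((\<lambda>t. b k t) has_vector_derivative b' t k) (at t within {0..T})" if "t \<in> {0..T}" for t k
    using a_ode[OF that, of k] b_ode[OF that, of k] by (simp_all add: a'_def b'_def H_def G_def)
  have Ca: "C12 T (\<lambda>t. trig sin (\<lambda>k. a k t))" "\<And>t x. t \<in> {0..T} \<Longrightarrow> time_deriv T (\<lambda>t. trig sin (\<lambda>k. a k t)) t x = trig sin (a' t) x"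
    using C12_trig[OF trig_pair_sin T weight a_le m' a'n ad a'c] by blast+
  have Cb: "C12 T (\<lambda>t. trig cos (\<lambda>k. b k t))" "\<And>t x. t \<in> {0..T} \<Longrightarrow> time_deriv T (\<lambda>t. trig cos (\<lambda>k. b k t)) t x = trig cos (b' t) x"
    using C12_trig[OF trig_pair_cos T weight b_le m' b'n bd b'c] by blast+
  have sH: "(\<lambda>k. norm (H k t)) summable_on UNIV" and sG: "(\<lambda>k. norm (G k t)) summable_on UNIV"
    and sPw: "(\<lambda>k. norm (P k t *\<^sub>R wv k)) summable_on UNIV" and sL: "(\<lambda>k. norm (leray k (H k t))) summable_on UNIV"
    if t: "t \<in> {0..T}" for t
  proof -
    note s = summable_on_cmult_right[OF M_summable, of 2]
    have h: "norm (H k t) \<le> 2 * M k" "norm (G k t) \<le> 2 * M k" for k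
      using H_le[OF t, of k] G_le[OF t, of k] wv_cv_le_M[of k] by linarith+
    have p: "norm (P k t *\<^sub>R wv k) \<le> 2 * M k" for k
      using P_le(2)[OF t, of k] by (simp add: mult.commute)
    show "(\<lambda>k. norm (H k t)) summable_on UNIV" "(\<lambda>k. norm (G k t)) summable_on UNIV"
      "(\<lambda>k. norm (P k t *\<^sub>R wv k)) summable_on UNIV" "(\<lambda>k. norm (leray k (H k t))) summable_on UNIV"
      by (rule summable_norm_bound(2)[OF s], rule h p order_trans[OF norm_leray_le h(1)])+
  qed
  have sq: "(\<lambda>k. norm (- (norm (wv k))\<^sup>2 *\<^sub>R x k)) summable_on UNIV" if "\<And>k. norm (x k) \<le> m k" for x :: "mode \<Rightarrow> real^3"
    by (rule summable_norm_bound(2)[OF sm(3)]) (use that in \<open>auto intro: mult_left_mono\<close>)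
  have eqU: "time_deriv T (\<lambda>t. trig sin (\<lambda>k. a k t)) t x - laplacian (trig sin (\<lambda>k. a k t)) x
     + advect (trig sin (\<lambda>k. a k t)) (trig sin (\<lambda>k. a k t)) x
     - advect (trig cos (\<lambda>k. b k t)) (trig cos (\<lambda>k. b k t)) x + grad (trig cos (\<lambda>k. P k t)) x = 0"
    if t: "t \<in> {0..T}" for t x
  proof -
    have 1: "trig sin (a' t) x = trig sin (\<lambda>k. - (norm (wv k))\<^sup>2 *\<^sub>R a k t) x - trig sin (\<lambda>k. leray k (H k t)) x"
      unfolding a'_def by (rule trig_diff) (auto simp only: abs_sin_le_one intro!: sq a_le t sL)
    \<comment> \<open>This turns the projected equation back into one with a pressure
      gradient.\<close>
    have "leray k (H k t) = H k t - P k t *\<^sub>R wv k" for k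
      by (simp add: leray_def P_def)
    then have 2: "trig sin (\<lambda>k. leray k (H k t)) x = trig sin (\<lambda>k. H k t) x - trig sin (\<lambda>k. P k t *\<^sub>R wv k) x"
      using trig_diff[OF abs_sin_le_one sH[OF t] sPw[OF t], where x = x] by simp
    show ?thesis
      unfolding Ca(2)[OF t] trig_laplacian[OF trig_pair_sin summable_a(3)[OF t]] grad_P[OF t] 1 2
      using nonlinear_U[OF t, of x] by simp
  qed
  have eqB: "time_deriv T (\<lambda>t. trig cos (\<lambda>k. b k t)) t x - laplacian (trig cos (\<lambda>k. b k t)) x
     + advect (trig sin (\<lambda>k. a k t)) (trig cos (\<lambda>k. b k t)) x
     - advect (trig cos (\<lambda>k. b k t)) (trig sin (\<lambda>k. a k t)) x = 0"
    if t: "t \<in> {0..T}" for t x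
  proof -
    have 1: "trig cos (b' t) x = trig cos (\<lambda>k. - (norm (wv k))\<^sup>2 *\<^sub>R b k t) x - trig cos (\<lambda>k. G k t) x"
      unfolding b'_def by (rule trig_diff) (auto simp only: abs_cos_le_one intro!: sq b_le t sG)
    show ?thesis
      unfolding Cb(2)[OF t] trig_laplacian[OF trig_pair_cos summable_b(3)[OF t]] 1
      unfolding nonlinear_B[OF t, of x, symmetric] by simp
  qed
  show ?thesis
    unfolding mhd_solution_def
    using Ca(1) Cb(1) C01_P eqU eqB trig_divergence_free[OF trig_pair_sin summable_a(3) a_div]
      trig_divergence_free[OF trig_pair_cos summable_b(3) b_div]
    by (auto simp: torus_trig_sin torus_trig_cos)
qed

end

section \<open>Existence for the mode equations\<close>

text \<open>The Duhamel estimates that follow all have this shape: a pointwise bound of the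
  integrand is given together with an explicit antiderivative.\<close>

lemma norm_integral_le_antiderivative:
  fixes F :: "real \<Rightarrow> 'e::banach"
  assumes "0 \<le> t" "continuous_on {0..t} F"
    "\<And>s. s \<in> {0..t} \<Longrightarrow> (G has_real_derivative g s) (at s within {0..t})"
    "\<And>s. s \<in> {0..t} \<Longrightarrow> norm (F s) \<le> g s"
  shows "norm (integral {0..t} F) \<le> G t - G 0"
proof -
  have g: "(g has_integral G t - G 0) {0..t}"
    using assms(3) by (intro fundamental_theorem_of_calculus assms(1)) (auto simp: has_real_derivative_iff_has_vector_derivative)
  have "norm (integral {0..t} F) \<le> integral {0..t} g"
    using assms(4) g by (intro integral_norm_bound_integral integrable_continuous_interval[OF assms(2)] has_integral_integrable[OF g]) auto
  then show ?thesis using integral_unique[OF g] by simp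
qed

definition duhamel :: "real \<Rightarrow> (real \<Rightarrow> 'e::banach) \<Rightarrow> real \<Rightarrow> 'e" where
  "duhamel q h t = integral {0..t} (\<lambda>s. exp (- q * (t - s)) *\<^sub>R h s)"

lemma duhamel_integrable:
  fixes h :: "real \<Rightarrow> 'e::banach"
  assumes "continuous_on {0..t} h"
  shows "(\<lambda>s. exp (- q * (t - s)) *\<^sub>R h s) integrable_on {0..t}"
  by (intro integrable_continuous_interval continuous_intros assms)

lemma duhamel_le:
  assumes "t \<in> {0..T}" "continuous_on {0..T} h"
    "\<And>s. s \<in> {0..t} \<Longrightarrow> (G has_real_derivative g s) (at s)"
    "\<And>s. s \<in> {0..t} \<Longrightarrow> exp (- q * (t - s)) * norm (h s) \<le> g s"
  shows "norm (duhamel q h t) \<le> G t - G 0"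
  unfolding duhamel_def
proof (rule norm_integral_le_antiderivative[where g = g and G = G])
  show "0 \<le> t" using assms(1) by simp
  show "continuous_on {0..t} (\<lambda>s. exp (- q * (t - s)) *\<^sub>R h s)"
    using assms(1) by (intro continuous_intros continuous_on_subset[OF assms(2)]) auto
qed (use assms(3,4) in \<open>simp_all add: has_field_derivative_at_within\<close>)

lemma duhamel_add:
  assumes "t \<in> {0..T}" "continuous_on {0..T} h" "continuous_on {0..T} h'"
  shows "duhamel q (\<lambda>s. h s + h' s) t = duhamel q h t + duhamel q h' t"
    "duhamel q (\<lambda>s. h s - h' s) t = duhamel q h t - duhamel q h' t"
proof -
  have "{0..t} \<subseteq> {0..T}" using assms(1) by auto
  note i = duhamel_integrable[OF continuous_on_subset[OF assms(2) this]] duhamel_integrable[OF continuous_on_subset[OF assms(3) this]]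
  show "duhamel q (\<lambda>s. h s + h' s) t = duhamel q h t + duhamel q h' t"
    "duhamel q (\<lambda>s. h s - h' s) t = duhamel q h t - duhamel q h' t"
    unfolding duhamel_def scaleR_add_right scaleR_diff_right
    by (rule Henstock_Kurzweil_Integration.integral_add[OF i] Henstock_Kurzweil_Integration.integral_diff[OF i])+
qed

lemma duhamel_linear:
  assumes "bounded_linear l" "t \<in> {0..T}" "continuous_on {0..T} h"
  shows "l (duhamel q h t) = duhamel q (\<lambda>s. l (h s)) t"
proof -
  have "{0..t} \<subseteq> {0..T}" using assms(2) by auto
  from integral_linear[OF duhamel_integrable[OF continuous_on_subset[OF assms(3) this], of q] assms(1)]
  show ?thesis
    by (simp add: duhamel_def o_def linear_cmul[OF bounded_linear.linear[OF assms(1)]])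
qed

lemma duhamel_deriv:
  assumes "t \<in> {0..T}" "continuous_on {0..T} h"
  shows "(duhamel q h has_vector_derivative h t - q *\<^sub>R duhamel q h t) (at t within {0..T})"
proof -
  let ?I = "\<lambda>t. integral {0..t} (\<lambda>s. exp (q * s) *\<^sub>R h s)"
  \<comment> \<open>Factoring out \<open>exp (- q * t)\<close> leaves an integrand independent of
    \<open>t\<close>, to which the fundamental theorem of calculus applies.\<close>
  have eq: "duhamel q h t = exp (- q * t) *\<^sub>R ?I t" for t
    unfolding duhamel_def Henstock_Kurzweil_Integration.integral_cmul[symmetric] scaleR_scaleR exp_add[symmetric]
    by (simp add: algebra_simps)
  have "(?I has_vector_derivative exp (q * t) *\<^sub>R h t) (at t within {0..T})"
    using assms by (intro integral_has_vector_derivative continuous_intros)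
  then have "((\<lambda>t. exp (- q * t) *\<^sub>R ?I t) has_vector_derivative
      exp (- q * t) *\<^sub>R (exp (q * t) *\<^sub>R h t) + (- q * exp (- q * t)) *\<^sub>R ?I t) (at t within {0..T})"
    by (intro has_vector_derivative_scaleR) (auto intro!: derivative_eq_intros)
  moreover have "exp (- q * t) *\<^sub>R (exp (q * t) *\<^sub>R h t) + (- q * exp (- q * t)) *\<^sub>R ?I t = h t - q *\<^sub>R duhamel q h t"
    by (simp add: eq exp_minus)
  ultimately show ?thesis by (simp add: eq[abs_def])
qed

text \<open>The abstract problem for \<open>L + w\<close>, where \<open>L\<close> is the free
  evolution of the data and \<open>w\<close> the unknown remainder, with values in a Banach space so
  that velocity and magnetic field are treated as one. \<open>c1\<close> majorizes the first
  iterate. \<open>small_linear\<close> fixes \<open>lam\<close> by the size of the data and does not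
  involve the time; \<open>small_quadratic\<close> then asks for a short time. Submultiplicativity
  of \<open>W\<close> yields a weighted Wiener algebra.\<close>

locale mode_equation =
  fixes M :: "mode \<Rightarrow> 'e::banach \<Rightarrow> 'e \<Rightarrow> 'e" and L :: "mode \<Rightarrow> real \<Rightarrow> 'e" and J :: "mode set"
    and B lam T A :: real and W c1 :: "mode \<Rightarrow> real"
  assumes bil: "bounded_bilinear (M k)" and M_le: "norm (M k x y) \<le> 2 * norm (wv k) * norm x * norm y"
    and pos: "0 < T" "0 < lam" "0 \<le> B" "0 \<le> A"
    and J: "finite J" and L0: "k \<notin> J \<Longrightarrow> L k t = 0"
    and L_le: "t \<in> {0..T} \<Longrightarrow> norm (L k t) \<le> B * norm (wv k) * exp (- (norm (wv k))\<^sup>2 * t)"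
    and L_cont: "continuous_on {0..T} (L k)"
    and source: "t \<in> {0..T} \<Longrightarrow>
      norm (duhamel ((norm (wv k))\<^sup>2) (\<lambda>s. \<Sum>\<^sub>\<infinity>j. M k (L j s) (L (k - j) s)) t) \<le> c1 k"
    and W: "1 \<le> W k" "W k \<le> W j * W (k - j)" and W_J: "j \<in> J \<Longrightarrow> W j \<le> 4"
    and c1: "nonneg_summable (\<lambda>k. W k * c1 k)" "(\<Sum>\<^sub>\<infinity>k. W k * c1 k) \<le> A"
    and small_linear: "32 * B * real (card J) \<le> sqrt lam"
    and small_quadratic: "16 * exp (lam * real (card J)) * sqrt T * A \<le> 1"
begin

abbreviation "q k \<equiv> (norm (wv k))\<^sup>2"

definition "cnv k f g s = (\<Sum>\<^sub>\<infinity>j. M k (f j s) (g (k - j) s))"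

text \<open>The time integral of the sum of \<open>2 * q j * exp (- 2 * q j * s)\<close>; it never
  exceeds \<open>card J\<close>, however large the frequencies are.\<close>

definition "\<theta> t = (\<Sum>j\<in>J. 1 - exp (- 2 * q j * t))"

text \<open>The exponential weight in time that makes the terms linear in the unknown a contraction,
  whatever the size of the data.\<close>

definition "E t = exp (lam * \<theta> t)"

definition "adm f c \<longleftrightarrow> (\<forall>k. continuous_on {0..T} (f k)) \<and> (\<forall>k. \<forall>t\<in>{0..T}. norm (f k t) \<le> c k * E t)"

definition "wsm c \<longleftrightarrow> nonneg_summable (\<lambda>k. W k * c k)"

lemma E_pos: "0 < E t" by (simp add: E_def)

lemma E_mono: "0 \<le> s \<Longrightarrow> s \<le> t \<Longrightarrow> E s \<le> E t"
  unfolding E_def \<theta>_def using pos by (auto intro!: mult_left_mono sum_mono)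

lemma E_ge1: "0 \<le> t \<Longrightarrow> 1 \<le> E t"
  using E_mono[of 0 t] by (simp add: E_def[of 0] \<theta>_def)

lemma E_le: "E t \<le> exp (lam * real (card J))"
proof -
  have "\<theta> t \<le> (\<Sum>j\<in>J. 1)" unfolding \<theta>_def by (intro sum_mono) simp
  then show ?thesis unfolding E_def using pos by simp
qed

lemma wsmD:
  assumes "wsm c"
  shows "0 \<le> c k" "nonneg_summable c" "(\<Sum>\<^sub>\<infinity>k. c k) \<le> (\<Sum>\<^sub>\<infinity>k. W k * c k)" "c k \<le> (\<Sum>\<^sub>\<infinity>k. W k * c k)"
proof -
  have W0: "0 < W k" for k using W(1)[of k] by linarith
  have "0 \<le> W k * c k" for k using assms unfolding wsm_def nonneg_summable_def by blast
  then have c0: "0 \<le> c k" for k using zero_le_mult_iff[of "W k" "c k"] W0[of k] by (metis not_le)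
  then show "0 \<le> c k" .
  have s: "(\<lambda>k. W k * c k) summable_on UNIV" using assms by (simp add: wsm_def nonneg_summable_def)
  have le: "c k \<le> W k * c k" for k using mult_right_mono[OF W(1) c0, of k] by simp
  have sc: "c summable_on UNIV" by (rule summable_norm_bound(1)[OF s]) (use le c0 in auto)
  with c0 show "nonneg_summable c" by (auto simp: nonneg_summable_def)
  show "(\<Sum>\<^sub>\<infinity>k. c k) \<le> (\<Sum>\<^sub>\<infinity>k. W k * c k)" by (intro infsum_mono sc s le)
  have "sum (\<lambda>k. W k * c k) {k} \<le> (\<Sum>\<^sub>\<infinity>k. W k * c k)"
    by (intro finite_sum_le_infsum s) (simp_all add: mult_nonneg_nonneg[OF less_imp_le[OF W0] c0])
  with le[of k] show "c k \<le> (\<Sum>\<^sub>\<infinity>k. W k * c k)" by simp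
qed

lemma wsm_finite:
  assumes "finite F" "\<And>k. 0 \<le> c k" "\<And>k. k \<notin> F \<Longrightarrow> c k = 0"
  shows "wsm c"
  unfolding wsm_def nonneg_summable_def
proof (intro conjI allI)
  show "0 \<le> W k * c k" for k using W(1)[of k] assms(2)[of k] by simp
  have "{k. W k * c k \<noteq> 0} \<subseteq> F" using assms(3) by force
  then show "(\<lambda>k. W k * c k) summable_on UNIV"
    using finite_subset[OF _ assms(1)] by (intro finite_nonzero_values_imp_summable_on) simp
qed

lemma admD: 
  assumes "adm f c"
  shows "continuous_on {0..T} (f k)" "t \<in> {0..T} \<Longrightarrow> norm (f k t) \<le> c k * E t"
  using assms by (auto simp: adm_def)

text \<open>A finitely supported majorant of the free evolution, for summability and continuity. The
  quantitative estimates of the linear term keep the decay \<open>exp (- q j * t)\<close>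
  instead.\<close>

definition "cL k = (if k \<in> J then B * norm (wv k) else 0)"

lemma adm_L: "adm L cL" and wsm_cL: "wsm cL"
proof -
  have "norm (L k t) \<le> cL k * E t" if t: "t \<in> {0..T}" for k t
  proof (cases "k \<in> J")
    case True
    have "norm (L k t) \<le> B * norm (wv k) * exp (- q k * t)" by (rule L_le[OF t])
    also have "\<dots> \<le> B * norm (wv k) * E t"
    proof (rule mult_left_mono)
      have "exp (- q k * t) \<le> 1" using t by simp
      also have "1 \<le> E t" using t by (intro E_ge1) simp
      finally show "exp (- q k * t) \<le> E t" .
    qed (use pos in simp)
    finally show ?thesis using True by (simp add: cL_def)
  qed (simp add: cL_def L0)
  then show "adm L cL" by (simp add: adm_def L_cont)
  show "wsm cL" using J pos by (intro wsm_finite[of J]) (auto simp: cL_def)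
qed

lemma adm_add: "adm f c \<Longrightarrow> adm g d \<Longrightarrow> adm (\<lambda>k t. f k t + g k t) (\<lambda>k. c k + d k)"
  by (simp add: adm_def distrib_right continuous_on_add norm_triangle_le add_mono)

lemma wsm_add: "wsm c \<Longrightarrow> wsm d \<Longrightarrow> wsm (\<lambda>k. c k + d k)"
  unfolding wsm_def nonneg_summable_def by (auto simp: distrib_left intro!: summable_on_add)

lemma cnv_term_le:
  assumes "adm f c" "adm g d" "t \<in> {0..T}" "wsm c"
  shows "norm (M k (f j t) (g (k - j) t)) \<le> 2 * norm (wv k) * (E t)\<^sup>2 * (c j * d (k - j))"
proof -
  have "norm (f j t) * norm (g (k - j) t) \<le> (c j * E t) * (d (k - j) * E t)"
    using wsmD(1)[OF assms(4)] E_pos[of t] by (intro mult_mono admD(2) assms) (auto intro: less_imp_le)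
  from mult_left_mono[OF this, of "2 * norm (wv k)"]
  have "2 * norm (wv k) * (norm (f j t) * norm (g (k - j) t)) \<le> 2 * norm (wv k) * ((c j * E t) * (d (k - j) * E t))"
    by simp
  then show ?thesis using order_trans[OF M_le[of k "f j t" "g (k - j) t"]]
    by (simp add: power2_eq_square ac_simps)
qed

lemma cnv_terms:
  assumes "adm f c" "adm g d" "wsm c" "wsm d" "t \<in> {0..T}"
  shows "(\<lambda>j. M k (f j t) (g (k - j) t)) summable_on UNIV"
    "norm (cnv k f g t) \<le> 2 * norm (wv k) * (E t)\<^sup>2 * cv c d k"
proof -
  have s: "(\<lambda>j. 2 * norm (wv k) * (E t)\<^sup>2 * (c j * d (k - j))) summable_on UNIV"
    by (intro summable_on_cmult_right cv_term_summable wsmD(2) assms)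
  note b = summable_norm_bound[OF s cnv_term_le[OF assms(1,2,5,3), where k = k]]
  show "(\<lambda>j. M k (f j t) (g (k - j) t)) summable_on UNIV" by (rule b(1))
  show "norm (cnv k f g t) \<le> 2 * norm (wv k) * (E t)\<^sup>2 * cv c d k"
    using b(3) by (simp add: cnv_def cv_def infsum_cmult_right')
qed

lemma cnv_cont:
  assumes "adm f c" "adm g d" "wsm c" "wsm d"
  shows "continuous_on {0..T} (cnv k f g)"
  unfolding cnv_def
proof (rule continuous_on_infsum)
  show "(\<lambda>j. 2 * norm (wv k) * (E T)\<^sup>2 * (c j * d (k - j))) summable_on UNIV"
    by (intro summable_on_cmult_right cv_term_summable wsmD(2) assms)
  show "continuous_on {0..T} (\<lambda>t. M k (f j t) (g (k - j) t))" for j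
    by (intro bounded_bilinear.continuous_on[OF bil] admD[OF assms(1)] admD[OF assms(2)])
  show "norm (M k (f j t) (g (k - j) t)) \<le> 2 * norm (wv k) * (E T)\<^sup>2 * (c j * d (k - j))" if t: "t \<in> {0..T}" for j t
  proof -
    have "2 * norm (wv k) * (E t)\<^sup>2 * (c j * d (k - j)) \<le> 2 * norm (wv k) * (E T)\<^sup>2 * (c j * d (k - j))"
      using t E_pos wsmD(1)[OF assms(3)] wsmD(1)[OF assms(4)]
      by (intro mult_right_mono mult_left_mono power_mono E_mono) (auto intro: less_imp_le)
    with cnv_term_le[OF assms(1,2) t assms(3), of k j] show ?thesis by linarith
  qed
qed

lemma cnv_add:
  assumes "adm f c" "adm g d" "adm h e" "wsm c" "wsm d" "wsm e" "t \<in> {0..T}"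
  shows "cnv k (\<lambda>k t. f k t + g k t) h t = cnv k f h t + cnv k g h t"
    "cnv k h (\<lambda>k t. f k t + g k t) t = cnv k h f t + cnv k h g t"
proof -
  interpret bounded_bilinear "M k" by (rule bil)
  show "cnv k (\<lambda>k t. f k t + g k t) h t = cnv k f h t + cnv k g h t"
    unfolding cnv_def add_left using assms by (intro infsum_add cnv_terms)
  show "cnv k h (\<lambda>k t. f k t + g k t) t = cnv k h f t + cnv k h g t"
    unfolding cnv_def add_right using assms by (intro infsum_add cnv_terms)
qed

lemma cnv_L_left: "cnv k L f t = (\<Sum>j\<in>J. M k (L j t) (f (k - j) t))"
proof -
  interpret bounded_bilinear "M k" by (rule bil)
  have "cnv k L f t = (\<Sum>\<^sub>\<infinity>j\<in>J. M k (L j t) (f (k - j) t))"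
    unfolding cnv_def by (rule infsum_cong_neutral) (auto simp: L0 zero_left)
  then show ?thesis using J by simp
qed

lemma cnv_L_right: "cnv k f L t = (\<Sum>j\<in>J. M k (f (k - j) t) (L j t))"
proof -
  interpret bounded_bilinear "M k" by (rule bil)
  have "bij (\<lambda>j. k - j)" by (rule bij_betw_byWitness[where f' = "\<lambda>j. k - j"]) auto
  from infsum_reindex_bij_betw[OF this, of "\<lambda>j. M k (f j t) (L (k - j) t)"]
  have "cnv k f L t = (\<Sum>\<^sub>\<infinity>j. M k (f (k - j) t) (L j t))"
    by (simp add: cnv_def)
  also have "\<dots> = (\<Sum>\<^sub>\<infinity>j\<in>J. M k (f (k - j) t) (L j t))"
    by (rule infsum_cong_neutral) (auto simp: L0 zero_right)
  finally show ?thesis using J by simp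
qed

section \<open>The linear and the quadratic term: the two Duhamel estimates\<close>

definition "lin k f t = cnv k L f t + cnv k f L t"

lemma norm_lin_le:
  assumes f: "adm f c" and t: "t \<in> {0..T}"
  shows "norm (lin k f t) \<le> (\<Sum>j\<in>J. 4 * B * norm (wv k) * norm (wv j) * exp (- q j * t) * (c (k - j) * E t))"
proof -
  have fj: "norm (L j t) * norm (f (k - j) t) \<le> (B * norm (wv j) * exp (- q j * t)) * (c (k - j) * E t)" for j
    by (intro mult_mono L_le[OF t] admD(2)[OF f t]) (use pos in auto)
  have fj': "2 * norm (wv k) * (norm (L j t) * norm (f (k - j) t)) \<le> 2 * norm (wv k) * ((B * norm (wv j) * exp (- q j * t)) * (c (k - j) * E t))" for j
    by (intro mult_left_mono fj) auto
  have a: "norm (M k (L j t) (f (k - j) t)) \<le> 2 * norm (wv k) * (B * norm (wv j) * exp (- q j * t) * (c (k - j) * E t))"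
   and b: "norm (M k (f (k - j) t) (L j t)) \<le> 2 * norm (wv k) * (B * norm (wv j) * exp (- q j * t) * (c (k - j) * E t))" for j
    using order_trans[OF M_le fj'[of j, simplified mult.assoc[symmetric]]] order_trans[OF M_le[of k "f (k - j) t" "L j t"]] fj'[of j]
    by (simp_all add: ac_simps)
  have "norm (lin k f t) \<le> (\<Sum>j\<in>J. 2 * norm (wv k) * (B * norm (wv j) * exp (- q j * t) * (c (k - j) * E t)))
    + (\<Sum>j\<in>J. 2 * norm (wv k) * (B * norm (wv j) * exp (- q j * t) * (c (k - j) * E t)))"
    unfolding lin_def cnv_L_left cnv_L_right
    by (intro norm_triangle_le add_mono sum_norm_le a b)
  also have "\<dots> = (\<Sum>j\<in>J. 4 * B * norm (wv k) * norm (wv j) * exp (- q j * t) * (c (k - j) * E t))"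
    unfolding sum.distrib[symmetric] by (intro sum.cong refl) (simp add: ac_simps)
  finally show ?thesis .
qed

lemma lin_cont:
  assumes "adm f c" "wsm c" shows "continuous_on {0..T} (lin k f)"
  unfolding lin_def using assms adm_L wsm_cL by (intro continuous_intros cnv_cont)

lemma young: "0 < \<mu> \<Longrightarrow> x * y \<le> (\<mu> * x\<^sup>2 + y\<^sup>2 / \<mu>) / 2" for \<mu> x y :: real
  using zero_le_power2[of "\<mu> * x - y"] by (simp add: field_simps power2_eq_square)

lemma E_deriv: "(E has_real_derivative lam * (\<Sum>j\<in>J. 2 * q j * exp (- 2 * q j * t)) * E t) (at t)"
  unfolding E_def \<theta>_def by (auto intro!: derivative_eq_intros sum.cong)

lemma exp_kernel_deriv: "((\<lambda>s. exp (- 2 * q k * (t - s))) has_real_derivative 2 * q k * exp (- 2 * q k * (t - s))) (at s)"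
  by (auto intro!: derivative_eq_intros)

lemma exp_kernel_square: "(norm (wv k) * exp (- q k * s))\<^sup>2 = q k * exp (- 2 * q k * s)"
  by (simp add: power_mult_distrib exp_double[symmetric])

text \<open>The critical estimate. Young's inequality separates
  \<open>norm (wv k) * exp (- q k * (t - s))\<close> from
  \<open>norm (wv j) * exp (- q j * s) * (E s / E t)\<close>. The first square integrates to at most
  1 / 2. The second is at most half of \<open>th' s * (E s / E t)\<^sup>2\<close>, and
  \<open>2 * lam\<close> times this product is the derivative of \<open>(E s / E t)\<^sup>2\<close>,
  which gains a factor of order \<open>1 / lam\<close>.\<close>

lemma duhamel_lin_le:
  assumes f: "adm f c" "wsm c" and t: "t \<in> {0..T}"
  shows "norm (duhamel (q k) (lin k f) t) \<le> E t * (2 * B / sqrt lam * (\<Sum>j\<in>J. c (k - j)))"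
proof -
  \<comment> \<open>Balances the two halves of Young's inequality: both become a multiple of
    \<open>1 / sqrt lam\<close>.\<close>
  define \<mu> where "\<mu> = 1 / sqrt lam"
  have mu: "0 < \<mu>" "lam * \<mu> = 1 / \<mu>" using pos by (auto simp: \<mu>_def real_div_sqrt)
  note c0 = wsmD(1)[OF f(2)]
  define th' where "th' s = (\<Sum>j\<in>J. 2 * q j * exp (- 2 * q j * s))" for s
  define g where "g j s = (\<mu> * (q k * exp (- 2 * q k * (t - s))) + \<mu> / 2 * (th' s * (E s / E t)\<^sup>2) * lam) / 2" for j :: mode and s
  define G where "G s = (\<Sum>j\<in>J. 4 * B * E t * c (k - j) * ((\<mu> * exp (- 2 * q k * (t - s)) / 2 + \<mu> / 4 * (E s / E t)\<^sup>2) / 2))" for s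
  have "norm (duhamel (q k) (lin k f) t) \<le> G t - G 0"
  proof (rule duhamel_le[OF t lin_cont[OF f]])
    fix s assume s: "s \<in> {0..t}"
    then have sT: "s \<in> {0..T}" using t by auto
    have "((\<lambda>s. (E s / E t)\<^sup>2) has_real_derivative 2 * lam * th' s * (E s / E t)\<^sup>2) (at s)"
      using E_pos[of t] by (auto intro!: derivative_eq_intros E_deriv simp: th'_def power2_eq_square)
    then have "((\<lambda>s. 4 * B * E t * c (k - j) * ((\<mu> * exp (- 2 * q k * (t - s)) / 2 + \<mu> / 4 * (E s / E t)\<^sup>2) / 2))
       has_real_derivative 4 * B * E t * c (k - j) *
        ((\<mu> * (2 * q k * exp (- 2 * q k * (t - s))) / 2 + \<mu> / 4 * (2 * lam * th' s * (E s / E t)\<^sup>2)) / 2)) (at s)" for j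
      by (intro DERIV_cmult DERIV_cdivide DERIV_add exp_kernel_deriv)
    moreover have "(\<mu> * (2 * q k * exp (- 2 * q k * (t - s))) / 2 + \<mu> / 4 * (2 * lam * th' s * (E s / E t)\<^sup>2)) / 2 = g j s" for j
      by (simp add: g_def)
    ultimately have "((\<lambda>s. 4 * B * E t * c (k - j) * ((\<mu> * exp (- 2 * q k * (t - s)) / 2 + \<mu> / 4 * (E s / E t)\<^sup>2) / 2))
       has_real_derivative 4 * B * E t * c (k - j) * g j s) (at s)" for j
      by (simp only:)
    then show "(G has_real_derivative (\<Sum>j\<in>J. 4 * B * E t * c (k - j) * g j s)) (at s)"
      unfolding G_def by (intro DERIV_sum)
    have "exp (- q k * (t - s)) * norm (lin k f s) \<le> exp (- q k * (t - s)) *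
      (\<Sum>j\<in>J. 4 * B * norm (wv k) * norm (wv j) * exp (- q j * s) * (c (k - j) * E s))"
      by (intro mult_left_mono norm_lin_le[OF f(1) sT]) simp
    also have "\<dots> = (\<Sum>j\<in>J. 4 * B * E t * c (k - j) * ((norm (wv k) * exp (- q k * (t - s))) * (norm (wv j) * exp (- q j * s) * (E s / E t))))"
      unfolding sum_distrib_left using E_pos[of t] by (intro sum.cong refl) (simp add: ac_simps)
    also have "\<dots> \<le> (\<Sum>j\<in>J. 4 * B * E t * c (k - j) * g j s)"
    proof (intro sum_mono mult_left_mono)
      fix j assume j: "j \<in> J"
      have "norm (wv k) * exp (- q k * (t - s)) * (norm (wv j) * exp (- q j * s) * (E s / E t))
        \<le> (\<mu> * (norm (wv k) * exp (- q k * (t - s)))\<^sup>2 + (norm (wv j) * exp (- q j * s) * (E s / E t))\<^sup>2 / \<mu>) / 2"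
        by (rule young[OF mu(1)])
      also have "(norm (wv k) * exp (- q k * (t - s)))\<^sup>2 = q k * exp (- 2 * q k * (t - s))"
        by (rule exp_kernel_square)
      also have "(norm (wv j) * exp (- q j * s) * (E s / E t))\<^sup>2 = (q j * exp (- 2 * q j * s)) * (E s / E t)\<^sup>2"
        unfolding power_mult_distrib[of _ "E s / E t"] exp_kernel_square ..
      also have "\<dots> / \<mu> \<le> \<mu> / 2 * (th' s * (E s / E t)\<^sup>2) * lam"
      proof -
        \<comment> \<open>The contribution of a single \<open>j\<close> is dominated by
          \<open>th'\<close>, which is up to the factor \<open>lam\<close> the logarithmic
          derivative of \<open>E\<close>.\<close>
        have "2 * q j * exp (- 2 * q j * s) \<le> th' s"
          unfolding th'_def using J j by (intro member_le_sum) auto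
        from mult_right_mono[OF this, of "(E s / E t)\<^sup>2"]
        have "2 * ((q j * exp (- 2 * q j * s)) * (E s / E t)\<^sup>2) \<le> th' s * (E s / E t)\<^sup>2"
          by (simp add: ac_simps)
        then have "(lam * \<mu>) * ((q j * exp (- 2 * q j * s)) * (E s / E t)\<^sup>2) \<le> (lam * \<mu>) * (th' s * (E s / E t)\<^sup>2 / 2)"
          using mu pos by (intro mult_left_mono) auto
        moreover have "Z / \<mu> = (lam * \<mu>) * Z" "\<mu> / 2 * Z * lam = (lam * \<mu>) * (Z / 2)" for Z
          using mu by (simp_all add: field_simps)
        ultimately show ?thesis by presburger
      qed
      finally show "norm (wv k) * exp (- q k * (t - s)) * (norm (wv j) * exp (- q j * s) * (E s / E t)) \<le> g j s"
        by (simp add: g_def)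
    qed (use pos c0 E_pos[of t] in \<open>auto intro: less_imp_le\<close>)
    finally show "exp (- q k * (t - s)) * norm (lin k f s) \<le> (\<Sum>j\<in>J. 4 * B * E t * c (k - j) * g j s)" .
  qed
  also have "\<dots> \<le> G t"
  proof -
    have "0 \<le> G 0"
      unfolding G_def using pos c0 E_pos[of t] mu by (intro sum_nonneg mult_nonneg_nonneg divide_nonneg_nonneg add_nonneg_nonneg) auto
    then show ?thesis by linarith
  qed
  \<comment> \<open>At \<open>s = t\<close> the bracket in \<open>G\<close> equals
    \<open>3 * \<mu> / 8\<close>.\<close>
  also have "G t \<le> (\<Sum>j\<in>J. 4 * B * E t * c (k - j) * (\<mu> / 2))"
    unfolding G_def using pos c0 E_pos[of t] mu by (intro sum_mono mult_left_mono) (auto intro: less_imp_le)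
  also have "\<dots> = E t * (2 * B / sqrt lam * (\<Sum>j\<in>J. c (k - j)))"
    by (simp add: \<mu>_def sum_distrib_left sum_divide_distrib ac_simps)
  finally show ?thesis .
qed

abbreviation "ET \<equiv> exp (lam * real (card J))"

text \<open>Here \<open>norm (wv k) * exp (- q k * (t - s))\<close> is paired with the constant 1
  instead of a second decaying factor. Young's inequality with weight \<open>sqrt T\<close> gains
  \<open>sqrt T\<close>. Of the two weights \<open>E s\<close>, one is bounded by \<open>E t\<close>
  as the norm requires, the other by its maximal growth \<open>ET\<close>.\<close>

lemma duhamel_quad_le:
  assumes "adm f c" "adm g d" "wsm c" "wsm d" and t: "t \<in> {0..T}"
  shows "norm (duhamel (q k) (cnv k f g) t) \<le> E t * (2 * ET * sqrt T * cv c d k)"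
proof -
  have cv0: "0 \<le> cv c d k" unfolding cv_def by (intro infsum_nonneg) (simp add: wsmD(1) assms)
  define C where "C = 2 * E t * ET * cv c d k"
  have C0: "0 \<le> C" unfolding C_def using E_pos[of t] cv0 by (auto intro: less_imp_le)
  define G where "G s = C * ((sqrt T * exp (- 2 * q k * (t - s)) / 2 + s / sqrt T) / 2)" for s
  have sT: "0 < sqrt T" using pos by simp
  have "norm (duhamel (q k) (cnv k f g) t) \<le> G t - G 0"
  proof (rule duhamel_le[OF t cnv_cont[OF assms(1-4)]])
    fix s assume s: "s \<in> {0..t}"
    have "(G has_real_derivative C * ((sqrt T * (2 * q k * exp (- 2 * q k * (t - s))) / 2 + 1 / sqrt T) / 2)) (at s)"
      unfolding G_def by (intro DERIV_cmult DERIV_cdivide DERIV_add exp_kernel_deriv DERIV_ident)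
    then show "(G has_real_derivative C * ((sqrt T * (norm (wv k) * exp (- q k * (t - s)))\<^sup>2 + 1\<^sup>2 / sqrt T) / 2)) (at s)"
      unfolding exp_kernel_square by (simp add: mult.assoc)
    have EE: "(E s)\<^sup>2 \<le> E t * ET"
      unfolding power2_eq_square
    proof (rule mult_mono)
      show "E s \<le> E t" using s by (intro E_mono) auto
      show "E s \<le> ET" by (rule E_le)
    qed (use E_pos[of s] E_pos[of t] in simp_all)
    have "norm (cnv k f g s) \<le> 2 * norm (wv k) * (E s)\<^sup>2 * cv c d k"
      by (rule cnv_terms(2)[OF assms(1-4)]) (use s t in auto)
    also have "\<dots> \<le> 2 * norm (wv k) * (E t * ET) * cv c d k"
      using cv0 by (intro mult_right_mono mult_left_mono EE) auto
    finally have "exp (- q k * (t - s)) * norm (cnv k f g s) \<le> exp (- q k * (t - s)) * (2 * norm (wv k) * (E t * ET) * cv c d k)"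
      by (rule mult_left_mono) simp
    also have "\<dots> = C * ((norm (wv k) * exp (- q k * (t - s))) * 1)"
      by (simp add: C_def ac_simps)
    also have "\<dots> \<le> C * ((sqrt T * (norm (wv k) * exp (- q k * (t - s)))\<^sup>2 + 1\<^sup>2 / sqrt T) / 2)"
      by (intro mult_left_mono young sT C0)
    finally show "exp (- q k * (t - s)) * norm (cnv k f g s) \<le> C * ((sqrt T * (norm (wv k) * exp (- q k * (t - s)))\<^sup>2 + 1\<^sup>2 / sqrt T) / 2)" .
  qed
  also have "\<dots> \<le> G t"
  proof -
    have "0 \<le> G 0" unfolding G_def using C0 sT by (intro mult_nonneg_nonneg) auto
    then show ?thesis by linarith
  qed
  also have "G t \<le> C * sqrt T"
  proof -
    have "t / sqrt T \<le> T / sqrt T" using t sT by (intro divide_right_mono) auto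
    then have le: "t / sqrt T \<le> sqrt T" using pos by (simp add: real_div_sqrt)
    have gen: "(a * 1 / 2 + x) / 2 \<le> a" if "x \<le> a" "0 < a" for a x :: real
      using that by (simp add: field_simps)
    have "(sqrt T * 1 / 2 + t / sqrt T) / 2 \<le> sqrt T" by (rule gen[OF le sT])
    then show ?thesis unfolding G_def by (intro mult_left_mono C0) simp
  qed
  also have "\<dots> = E t * (2 * ET * sqrt T * cv c d k)" by (simp add: C_def ac_simps)
  finally show ?thesis .
qed

end

context mode_equation begin

section \<open>The weighted norm of majorants and the fixed point map\<close>

abbreviation "e1 \<equiv> 2 * B / sqrt lam"
abbreviation "e2 \<equiv> 2 * ET * sqrt T"
abbreviation "nrm c \<equiv> \<Sum>\<^sub>\<infinity>k. W k * c k"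

lemma e_nonneg: "0 \<le> e1" "0 \<le> e2"
  using pos by auto

lemma cv_mono_add:
  assumes "wsm c" "wsm d" "wsm e"
  shows "cv (\<lambda>k. c k + d k) e k = cv c e k + cv d e k" "cv e (\<lambda>k. c k + d k) k = cv e c k + cv e d k"
  unfolding cv_def distrib_left distrib_right using assms
  by (auto intro!: infsum_add cv_term_summable wsmD(2))

lemma cv_nonneg': "wsm c \<Longrightarrow> wsm d \<Longrightarrow> 0 \<le> cv c d k"
  unfolding cv_def by (intro infsum_nonneg) (simp add: wsmD(1))

text \<open>Submultiplicativity of \<open>W\<close> makes the weighted sums an algebra under
  convolution.\<close>

lemma wsm_cv:
  assumes "wsm c" "wsm d"
  shows "wsm (cv c d)" "nrm (cv c d) \<le> nrm c * nrm d"
proof -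
  have n: "nonneg_summable (\<lambda>k. W k * c k)" "nonneg_summable (\<lambda>k. W k * d k)" using assms by (auto simp: wsm_def)
  note s = nonneg_summable_cv[OF n]
  have le: "W k * cv c d k \<le> cv (\<lambda>k. W k * c k) (\<lambda>k. W k * d k) k" for k
  proof -
    have t: "W k * (c j * d (k - j)) \<le> (W j * c j) * (W (k - j) * d (k - j))" for j
    proof -
      have "W k * (c j * d (k - j)) \<le> (W j * W (k - j)) * (c j * d (k - j))"
        by (intro mult_right_mono W(2)) (simp add: wsmD(1) assms)
      then show ?thesis by (simp add: ac_simps)
    qed
    have "(\<Sum>\<^sub>\<infinity>j. W k * (c j * d (k - j))) \<le> cv (\<lambda>k. W k * c k) (\<lambda>k. W k * d k) k"
      unfolding cv_def
      by (rule infsum_mono[OF _ cv_term_summable[OF n] t])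
         (intro summable_on_cmult_right cv_term_summable wsmD(2) assms)
    then show ?thesis by (simp add: cv_def infsum_cmult_right')
  qed
  have W0: "0 \<le> W k" for k using W(1)[of k] by linarith
  have nn: "0 \<le> W k * cv c d k" for k using W0 cv_nonneg'[OF assms] by simp
  have sm: "cv (\<lambda>k. W k * c k) (\<lambda>k. W k * d k) summable_on UNIV" using s(1) by (simp add: nonneg_summable_def)
  have sW: "(\<lambda>k. W k * cv c d k) summable_on UNIV"
    by (rule summable_norm_bound(1)[OF sm]) (use le nn in auto)
  then show "wsm (cv c d)" using nn by (simp add: wsm_def nonneg_summable_def)
  show "nrm (cv c d) \<le> nrm c * nrm d"
    unfolding s(2)[symmetric] by (intro infsum_mono sW sm le)
qed

text \<open>Shifting by a data frequency \<open>j\<close> costs the factor \<open>W j\<close>, which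
  is at most 4.\<close>

lemma wsm_shift:
  assumes "wsm c" "j \<in> J"
  shows "wsm (\<lambda>k. c (k - j))" "nrm (\<lambda>k. c (k - j)) \<le> 4 * nrm c"
proof -
  have bij: "bij (\<lambda>k. k - j)" by (rule bij_betw_byWitness[where f' = "\<lambda>k. k + j"]) auto
  have "(\<lambda>k. W k * c k) summable_on UNIV" using assms by (simp add: wsm_def nonneg_summable_def)
  then have s: "(\<lambda>k. 4 * (W (k - j) * c (k - j))) summable_on UNIV"
    using summable_on_reindex_bij_betw[OF bij, of "\<lambda>k. W k * c k"] by (intro summable_on_cmult_right) simp
  have le: "W k * c (k - j) \<le> 4 * (W (k - j) * c (k - j))" for k
  proof -
    have "W k \<le> 4 * W (k - j)"
      using W(2)[of k j] mult_right_mono[OF W_J[OF assms(2)], of "W (k - j)"] W(1)[of "k - j"] by linarith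
    from mult_right_mono[OF this wsmD(1)[OF assms(1), of "k - j"]] show ?thesis by (simp add: ac_simps)
  qed
  have W0: "0 \<le> W k" for k using W(1)[of k] by linarith
  have nn: "0 \<le> W k * c (k - j)" for k using W0 wsmD(1)[OF assms(1)] by simp
  have sW: "(\<lambda>k. W k * c (k - j)) summable_on UNIV"
    by (rule summable_norm_bound(1)[OF s]) (use le nn in auto)
  then show "wsm (\<lambda>k. c (k - j))" using nn by (simp add: wsm_def nonneg_summable_def)
  have "nrm (\<lambda>k. c (k - j)) \<le> (\<Sum>\<^sub>\<infinity>k. 4 * (W (k - j) * c (k - j)))"
    by (intro infsum_mono sW s le)
  also have "\<dots> = 4 * nrm c"
    using infsum_reindex_bij_betw[OF bij, of "\<lambda>k. W k * c k"] by (simp add: infsum_cmult_right')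
  finally show "nrm (\<lambda>k. c (k - j)) \<le> 4 * nrm c" .
qed

lemma nrm_add: "wsm c \<Longrightarrow> wsm d \<Longrightarrow> nrm (\<lambda>k. c k + d k) = nrm c + nrm d"
  unfolding distrib_left by (intro infsum_add) (auto simp: wsm_def nonneg_summable_def)

lemma wsm_cmult: "wsm c \<Longrightarrow> 0 \<le> a \<Longrightarrow> wsm (\<lambda>k. a * c k)"
  and nrm_cmult: "nrm (\<lambda>k. a * c k) = a * nrm c"
proof -
  have e: "W k * (a * c k) = a * (W k * c k)" for k by simp
  show "nrm (\<lambda>k. a * c k) = a * nrm c" unfolding e by (rule infsum_cmult_right')
  show "wsm c \<Longrightarrow> 0 \<le> a \<Longrightarrow> wsm (\<lambda>k. a * c k)"
    unfolding wsm_def nonneg_summable_def e by (auto intro: summable_on_cmult_right)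
qed

lemma wsm_shifts:
  assumes "wsm c"
  shows "wsm (\<lambda>k. \<Sum>j\<in>J. c (k - j))" "nrm (\<lambda>k. \<Sum>j\<in>J. c (k - j)) \<le> 4 * real (card J) * nrm c"
proof -
  have "wsm (\<lambda>k. \<Sum>j\<in>F. c (k - j)) \<and> nrm (\<lambda>k. \<Sum>j\<in>F. c (k - j)) \<le> 4 * real (card F) * nrm c"
    if "finite F" "F \<subseteq> J" for F
    using that
  proof (induction F)
    case empty
    show ?case using wsm_finite[of "{}" "\<lambda>k. 0"] by simp
  next
    case (insert j F)
    then have F: "wsm (\<lambda>k. \<Sum>j\<in>F. c (k - j))" "nrm (\<lambda>k. \<Sum>j\<in>F. c (k - j)) \<le> 4 * real (card F) * nrm c"
      and j: "j \<in> J" by auto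
    have "(\<lambda>k. \<Sum>j\<in>insert j F. c (k - j)) = (\<lambda>k. c (k - j) + (\<Sum>j\<in>F. c (k - j)))"
      using insert by auto
    then show ?case
      using wsm_add[OF wsm_shift(1)[OF assms j] F(1)] nrm_add[OF wsm_shift(1)[OF assms j] F(1)]
        F(2) wsm_shift(2)[OF assms j] insert.hyps by (simp add: algebra_simps)
  qed
  from this[OF J order_refl]
  show "wsm (\<lambda>k. \<Sum>j\<in>J. c (k - j))" "nrm (\<lambda>k. \<Sum>j\<in>J. c (k - j)) \<le> 4 * real (card J) * nrm c" by auto
qed

text \<open>The scalar counterpart of the fixed point map: a majorant of \<open>w\<close> is sent to
  a majorant of its image, with one summand each for the source, the linear and the quadratic
  term.\<close>

definition "Psi c k = c1 k + (e1 * (\<Sum>j\<in>J. c (k - j)) + e2 * cv c c k)"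

lemma wsm_Psi:
  assumes "wsm c" "nrm c \<le> 2 * A"
  shows "wsm (Psi c)" "nrm (Psi c) \<le> 2 * A"
proof -
  have w1: "wsm c1" using c1 by (simp add: wsm_def)
  note w2 = wsm_cmult[OF wsm_shifts(1)[OF assms(1)] e_nonneg(1)]
  note w3 = wsm_cmult[OF wsm_cv(1)[OF assms(1,1)] e_nonneg(2)]
  show "wsm (Psi c)" unfolding Psi_def[abs_def] by (intro wsm_add w1 w2 w3)
  have n0: "0 \<le> nrm c" using wsmD(1,4)[OF assms(1), of undefined] by linarith
  have "nrm (Psi c) = nrm c1 + (e1 * nrm (\<lambda>k. \<Sum>j\<in>J. c (k - j)) + e2 * nrm (cv c c))"
    unfolding Psi_def[abs_def] by (simp only: nrm_add wsm_add w1 w2 w3 nrm_cmult)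
  also have "\<dots> \<le> A + (e1 * (4 * real (card J) * nrm c) + e2 * (nrm c * nrm c))"
    by (intro add_mono mult_left_mono c1 wsm_shifts wsm_cv assms e_nonneg)
  \<comment> \<open>The ball of radius \<open>2 * A\<close> is invariant: the source uses up one
    half of the radius, the linear and the quadratic term a quarter each.\<close>
  also have "\<dots> \<le> A + (A / 2 + A / 2)"
  proof (intro add_left_mono add_mono)
    have sl: "0 < sqrt lam" using pos by simp
    have "e1 * (4 * real (card J)) = 32 * B * real (card J) / sqrt lam / 4" by simp
    also have "\<dots> \<le> 1 / 4" using small_linear sl by (intro divide_right_mono) (auto simp: divide_le_eq)
    finally have "e1 * (4 * real (card J)) * nrm c \<le> 1 / 4 * (2 * A)"
      by (intro mult_mono assms n0) auto
    then show "e1 * (4 * real (card J) * nrm c) \<le> A / 2" by (simp add: mult.assoc)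
    have "nrm c * nrm c \<le> (2 * A) * (2 * A)" using assms n0 pos by (intro mult_mono) auto
    then have "e2 * (nrm c * nrm c) \<le> e2 * ((2 * A) * (2 * A))" by (intro mult_left_mono e_nonneg)
    also have "\<dots> = (16 * ET * sqrt T * A) * (A / 2)" by simp
    also have "\<dots> \<le> 1 * (A / 2)" by (intro mult_right_mono small_quadratic) (use pos in auto)
    finally show "e2 * (nrm c * nrm c) \<le> A / 2" by simp
  qed
  finally show "nrm (Psi c) \<le> 2 * A" by simp
qed

text \<open>The minus sign comes from moving the nonlinearity to the right-hand side. The initial
  data sit in \<open>L\<close>, so the remainder starts from 0.\<close>

definition "Phi w k t = - duhamel (q k) (cnv k (\<lambda>k t. L k t + w k t) (\<lambda>k t. L k t + w k t)) t"

lemma lin_add: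
  assumes "adm f c" "adm g d" "wsm c" "wsm d" "t \<in> {0..T}"
  shows "lin k (\<lambda>k t. f k t + g k t) t = lin k f t + lin k g t"
  unfolding lin_def using cnv_add[OF assms(1,2) adm_L assms(3,4) wsm_cL assms(5)] by simp

lemma cnv_expand:
  assumes w: "adm w c" "wsm c" and t: "t \<in> {0..T}"
  shows "cnv k (\<lambda>k t. L k t + w k t) (\<lambda>k t. L k t + w k t) t = cnv k L L t + (lin k w t + cnv k w w t)"
proof -
  note a = adm_L w(1) wsm_cL w(2)
  have "cnv k (\<lambda>k t. L k t + w k t) (\<lambda>k t. L k t + w k t) t
      = cnv k L (\<lambda>k t. L k t + w k t) t + cnv k w (\<lambda>k t. L k t + w k t) t"
    by (rule cnv_add(1)[OF a(1,2) adm_add[OF a(1,2)] a(3,4) wsm_add[OF a(3,4)] t])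
  also have "\<dots> = (cnv k L L t + cnv k L w t) + (cnv k w L t + cnv k w w t)"
    unfolding cnv_add(2)[OF a(1,2) a(1) a(3,4) a(3) t] cnv_add(2)[OF a(1,2) a(2) a(3,4) a(4) t] ..
  finally show ?thesis by (simp add: lin_def)
qed

lemma duhamel_cong: "(\<And>s. s \<in> {0..t} \<Longrightarrow> f s = g s) \<Longrightarrow> duhamel r f t = duhamel r g t"
  unfolding duhamel_def by (intro Henstock_Kurzweil_Integration.integral_cong) simp

lemma Phi_expand:
  assumes w: "adm w c" "wsm c" and t: "t \<in> {0..T}"
  shows "Phi w k t = - duhamel (q k) (cnv k L L) t - (duhamel (q k) (lin k w) t + duhamel (q k) (cnv k w w) t)"
proof -
  note c = cnv_cont[OF adm_L adm_L wsm_cL wsm_cL, of k] lin_cont[OF w, of k] cnv_cont[OF w(1,1) w(2,2), of k]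
  have "duhamel (q k) (cnv k (\<lambda>k t. L k t + w k t) (\<lambda>k t. L k t + w k t)) t
    = duhamel (q k) (\<lambda>t. cnv k L L t + (lin k w t + cnv k w w t)) t"
    by (rule duhamel_cong) (use t in \<open>auto intro!: cnv_expand[OF w]\<close>)
  also have "\<dots> = duhamel (q k) (cnv k L L) t + (duhamel (q k) (lin k w) t + duhamel (q k) (cnv k w w) t)"
    unfolding duhamel_add(1)[OF t c(1) continuous_on_add[OF c(2,3)]] duhamel_add(1)[OF t c(2,3)] ..
  finally show ?thesis by (simp add: Phi_def)
qed

lemma Phi_cont:
  assumes "adm w c" "wsm c"
  shows "continuous_on {0..T} (Phi w k)"
proof -
  note z = adm_add[OF adm_L assms(1)] wsm_add[OF wsm_cL assms(2)]
  have "continuous_on {0..T} (duhamel (q k) (cnv k (\<lambda>k t. L k t + w k t) (\<lambda>k t. L k t + w k t)))"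
    unfolding continuous_on_eq_continuous_within
    using duhamel_deriv[OF _ cnv_cont[OF z(1,1) z(2,2)]] has_vector_derivative_continuous by blast
  then show ?thesis unfolding Phi_def[abs_def] by (rule continuous_on_minus)
qed

text \<open>The bound has the form of the increment of \<open>Psi\<close> from \<open>c\<close> to
  \<open>c + d\<close>, see \<open>Psi_diff\<close>. Hence increments of the scalar iteration
  majorize increments of the true one.\<close>

lemma Phi_diff:
  assumes w: "adm w c" "wsm c" and w': "adm w' c'" "wsm c'"
    and d: "adm (\<lambda>k t. w' k t - w k t) d" "wsm d" and t: "t \<in> {0..T}"
  shows "norm (Phi w' k t - Phi w k t) \<le> (e1 * (\<Sum>j\<in>J. d (k - j)) + e2 * (cv c d k + cv d c' k)) * E t"
proof -
  let ?d = "\<lambda>k t. w' k t - w k t"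
  have eq: "w' = (\<lambda>k t. w k t + ?d k t)" by simp
  have 1: "lin k w' s = lin k w s + lin k ?d s" if "s \<in> {0..T}" for s
    using lin_add[OF w(1) d(1) w(2) d(2) that] by simp
  \<comment> \<open>Telescoping of the quadratic term, one factor being replaced at a time.\<close>
  have 2: "cnv k w' w' s = cnv k w w s + (cnv k w ?d s + cnv k ?d w' s)" if "s \<in> {0..T}" for s
    using cnv_add(1)[OF w(1) d(1) w'(1) w(2) d(2) w'(2) that] cnv_add(2)[OF w(1) d(1) w(1) w(2) d(2) w(2) that]
    by simp
  have sub: "s \<in> {0..T}" if "s \<in> {0..t}" for s using that t by auto
  note c = lin_cont[OF w, of k] lin_cont[OF d, of k] cnv_cont[OF w(1,1) w(2,2), of k]
    cnv_cont[OF w(1) d(1) w(2) d(2), of k] cnv_cont[OF d(1) w'(1) d(2) w'(2), of k]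
  have "duhamel (q k) (lin k w') t = duhamel (q k) (\<lambda>s. lin k w s + lin k ?d s) t"
    by (rule duhamel_cong) (rule 1[OF sub])
  also have "\<dots> = duhamel (q k) (lin k w) t + duhamel (q k) (lin k ?d) t"
    by (rule duhamel_add(1)[OF t c(1,2)])
  finally have 3: "duhamel (q k) (lin k w') t = duhamel (q k) (lin k w) t + duhamel (q k) (lin k ?d) t" .
  have "duhamel (q k) (cnv k w' w') t = duhamel (q k) (\<lambda>s. cnv k w w s + (cnv k w ?d s + cnv k ?d w' s)) t"
    by (rule duhamel_cong) (rule 2[OF sub])
  also have "\<dots> = duhamel (q k) (cnv k w w) t + (duhamel (q k) (cnv k w ?d) t + duhamel (q k) (cnv k ?d w') t)"
    unfolding duhamel_add(1)[OF t c(3) continuous_on_add[OF c(4,5)]] duhamel_add(1)[OF t c(4,5)] ..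
  finally have 4: "duhamel (q k) (cnv k w' w') t = duhamel (q k) (cnv k w w) t + (duhamel (q k) (cnv k w ?d) t + duhamel (q k) (cnv k ?d w') t)" .
  have "Phi w' k t - Phi w k t = - (duhamel (q k) (lin k ?d) t + (duhamel (q k) (cnv k w ?d) t + duhamel (q k) (cnv k ?d w') t))"
    unfolding Phi_expand[OF w t] Phi_expand[OF w' t] 3 4 by simp
  then have "norm (Phi w' k t - Phi w k t) \<le> norm (duhamel (q k) (lin k ?d) t) + (norm (duhamel (q k) (cnv k w ?d) t) + norm (duhamel (q k) (cnv k ?d w') t))"
    by (simp only: norm_minus_cancel) (intro norm_triangle_le add_left_mono norm_triangle_ineq)
  also have "\<dots> \<le> E t * (e1 * (\<Sum>j\<in>J. d (k - j))) + (E t * (e2 * cv c d k) + E t * (e2 * cv d c' k))"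
    by (intro add_mono duhamel_lin_le[OF d t] duhamel_quad_le[OF w(1) d(1) w(2) d(2) t] duhamel_quad_le[OF d(1) w'(1) d(2) w'(2) t])
  also have "\<dots> = (e1 * (\<Sum>j\<in>J. d (k - j)) + e2 * (cv c d k + cv d c' k)) * E t"
    by (simp add: algebra_simps)
  finally show ?thesis .
qed

section \<open>Picard iterates and their majorants\<close>

definition "ws n = (Phi ^^ n) (\<lambda>_ _. 0)"
definition "cs n = (Psi ^^ n) (\<lambda>_. 0)"

lemma ws_Suc: "ws (Suc n) = Phi (ws n)" and cs_Suc: "cs (Suc n) = Psi (cs n)"
  by (simp_all add: ws_def cs_def)

lemma wsm_zero: "wsm (\<lambda>_. 0)" and adm_zero: "adm (\<lambda>_ _. 0) (\<lambda>_. 0)"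
  by (rule wsm_finite[of "{}"]) (auto simp: adm_def)

lemma cs_wsm: "wsm (cs n)" "nrm (cs n) \<le> 2 * A"
proof -
  have "wsm (cs n) \<and> nrm (cs n) \<le> 2 * A"
  proof (induction n)
    case 0 then show ?case using wsm_zero pos by (simp add: cs_def)
  next
    case (Suc n) then show ?case unfolding cs_Suc using wsm_Psi[of "cs n"] by blast
  qed
  then show "wsm (cs n)" "nrm (cs n) \<le> 2 * A" by auto
qed

lemma wsm_diff:
  assumes "wsm c" "wsm d" "\<And>k. c k \<le> d k"
  shows "wsm (\<lambda>k. d k - c k)"
proof -
  have W0: "0 \<le> W k" for k using W(1)[of k] by linarith
  have "(\<lambda>k. W k * c k) summable_on UNIV" "(\<lambda>k. W k * d k) summable_on UNIV"
    using assms by (auto simp: wsm_def nonneg_summable_def)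
  then have "(\<lambda>k. W k * d k - W k * c k) summable_on UNIV"
    using summable_on_add[of "\<lambda>k. W k * d k" UNIV "\<lambda>k. - (W k * c k)"] by (simp add: summable_on_uminus)
  then show ?thesis
    using assms(3) W0 by (simp add: wsm_def nonneg_summable_def right_diff_distrib mult_left_mono)
qed

lemma Psi_diff:
  assumes "wsm c" "wsm d"
  shows "Psi (\<lambda>k. c k + d k) k - Psi c k = e1 * (\<Sum>j\<in>J. d (k - j)) + e2 * (cv c d k + cv d (\<lambda>k. c k + d k) k)"
proof -
  have "cv (\<lambda>k. c k + d k) (\<lambda>k. c k + d k) k = cv c c k + cv c d k + cv d (\<lambda>k. c k + d k) k"
    using cv_mono_add(1)[OF assms wsm_add[OF assms], of k] cv_mono_add(2)[OF assms assms(1), of k] by simp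
  then show ?thesis
    by (simp add: Psi_def sum.distrib distrib_left)
qed

text \<open>The method of majorants: the scalar iterates increase and are bounded, and their
  increments dominate those of \<open>ws\<close>, so convergence of \<open>cs\<close> forces
  convergence of \<open>ws\<close>. The three claims support each other and are proved in one
  induction.\<close>

lemma iterates:
  "adm (ws n) (cs n) \<and> (\<forall>k. cs n k \<le> cs (Suc n) k)
    \<and> adm (\<lambda>k t. ws (Suc n) k t - ws n k t) (\<lambda>k. cs (Suc n) k - cs n k)"
proof (induction n)
  case 0
  have c0: "cs 0 = (\<lambda>_. 0)" and w0: "ws 0 = (\<lambda>_ _. 0)" by (simp_all add: cs_def ws_def)
  have c1': "cs (Suc 0) k = c1 k" for k
    unfolding cs_Suc c0 by (simp add: Psi_def cv_def)
  have c1nn: "0 \<le> c1 k" for k using wsmD(1)[of c1 k] c1 by (simp add: wsm_def)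
  have z: "duhamel (q k) (lin k (\<lambda>_ _. 0)) t = 0" "duhamel (q k) (cnv k (\<lambda>_ _. 0) (\<lambda>_ _. 0)) t = 0" for k t
    by (simp_all add: lin_def cnv_def duhamel_def bounded_bilinear.zero_left[OF bil] bounded_bilinear.zero_right[OF bil])
  have "norm (Phi (\<lambda>_ _. 0) k t) \<le> c1 k * E t" if t: "t \<in> {0..T}" for k t
  proof -
    have "norm (Phi (\<lambda>_ _. 0) k t) \<le> c1 k"
    proof -
      have "norm (duhamel (q k) (cnv k L L) t) \<le> c1 k"
        using source[OF t, of k] by (simp add: cnv_def[abs_def])
      then show ?thesis by (simp add: Phi_expand[OF adm_zero wsm_zero t] z)
    qed
    also have "\<dots> \<le> c1 k * E t" using mult_left_mono[OF E_ge1 c1nn, of t k] t by simp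
    finally show ?thesis .
  qed
  then have "adm (\<lambda>k t. ws (Suc 0) k t - ws 0 k t) (\<lambda>k. cs (Suc 0) k - cs 0 k)"
    using Phi_cont[OF adm_zero wsm_zero] by (simp add: adm_def c1' c0 w0 ws_Suc)
  then show ?case using c1' c1nn adm_zero by (simp add: c0 w0)
next
  case (Suc n)
  let ?d = "\<lambda>k. cs (Suc n) k - cs n k"
  have d: "wsm ?d" using Suc by (intro wsm_diff cs_wsm) auto
  have a: "adm (ws n) (cs n)" and ad: "adm (\<lambda>k t. ws (Suc n) k t - ws n k t) ?d" using Suc by auto
  have a': "adm (ws (Suc n)) (cs (Suc n))" using adm_add[OF a ad] by simp
  have D: "cs (Suc (Suc n)) k - cs (Suc n) k = e1 * (\<Sum>j\<in>J. ?d (k - j)) + e2 * (cv (cs n) ?d k + cv ?d (cs (Suc n)) k)" for k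
    using Psi_diff[OF cs_wsm(1) d, of n k] by (simp add: cs_Suc[symmetric])
  have "0 \<le> cs (Suc (Suc n)) k - cs (Suc n) k" for k
    unfolding D
    by (intro add_nonneg_nonneg mult_nonneg_nonneg[OF e_nonneg(1)] mult_nonneg_nonneg[OF e_nonneg(2)] sum_nonneg
        cv_nonneg'[OF cs_wsm(1) d] cv_nonneg'[OF d cs_wsm(1)] wsmD(1)[OF d])
  moreover have "adm (\<lambda>k t. ws (Suc (Suc n)) k t - ws (Suc n) k t) (\<lambda>k. cs (Suc (Suc n)) k - cs (Suc n) k)"
    unfolding adm_def D
  proof (intro conjI allI ballI)
    show "continuous_on {0..T} (\<lambda>t. ws (Suc (Suc n)) k t - ws (Suc n) k t)" for k
      unfolding ws_Suc[of "Suc n"] using Phi_cont[OF a' cs_wsm(1)] admD(1)[OF a'] by (intro continuous_on_diff)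
    show "norm (ws (Suc (Suc n)) k t - ws (Suc n) k t) \<le> (e1 * (\<Sum>j\<in>J. ?d (k - j)) + e2 * (cv (cs n) ?d k + cv ?d (cs (Suc n)) k)) * E t"
      if "t \<in> {0..T}" for k t
      unfolding ws_Suc[of "Suc n"] using Phi_diff[OF a cs_wsm(1) a' cs_wsm(1) ad d that, of k] by (simp only: ws_Suc)
  qed
  ultimately show ?case using a' by simp
qed

lemma ws_adm: "adm (ws n) (cs n)" and cs_mono: "cs n k \<le> cs (Suc n) k"
  and ws_step: "adm (\<lambda>k t. ws (Suc n) k t - ws n k t) (\<lambda>k. cs (Suc n) k - cs n k)"
  using iterates[of n] by blast+

lemma ws_Cauchy_bound:
  assumes "n \<le> m" "t \<in> {0..T}"
  shows "norm (ws m k t - ws n k t) \<le> (cs m k - cs n k) * E t"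
  using assms(1)
proof (induction m rule: dec_induct)
  case (step m)
  have "norm (ws (Suc m) k t - ws m k t) \<le> (cs (Suc m) k - cs m k) * E t"
    by (rule admD(2)[OF ws_step assms(2)])
  with step.IH show ?case
    using norm_triangle_ineq[of "ws (Suc m) k t - ws m k t" "ws m k t - ws n k t"] by (simp add: algebra_simps)
qed simp

lemma cv_le_nrm:
  assumes "wsm c" "wsm d"
  shows "cv c d k \<le> nrm c * nrm d"
  using wsmD(4)[OF wsm_cv(1)[OF assms], of k] wsm_cv(2)[OF assms] by linarith

text \<open>Besides the fixed point property, the convergence of the iterates is part of the
  conclusion because symmetries of \<open>w\<close> are obtained from those of
  \<open>ws n\<close>.\<close>

theorem mode_solution:
  obtains w c where "adm w c" "wsm c" "nrm c \<le> 2 * A"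
    "\<And>k t. t \<in> {0..T} \<Longrightarrow> w k t = Phi w k t"
    "\<And>k t. t \<in> {0..T} \<Longrightarrow> (\<lambda>n. ws n k t) \<longlonglongrightarrow> w k t"
proof -
  have W0: "0 < W k" for k using W(1)[of k] by linarith
  have 1: "nonneg_summable (\<lambda>k. W k * cs n k)" for n using cs_wsm(1)[of n] by (simp add: wsm_def)
  have 2: "W k * cs n k \<le> W k * cs (Suc n) k" for n k using less_imp_le[OF W0] by (intro mult_left_mono cs_mono)
  \<comment> \<open>Monotone convergence is applied to the weighted majorants, so that the error
    tends to 0 in the norm \<open>nrm\<close>.\<close>
  obtain c' where c': "nonneg_summable c'" "(\<Sum>\<^sub>\<infinity>k. c' k) \<le> 2 * A" "\<And>n k. W k * cs n k \<le> c' k"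
    "\<And>k. (\<lambda>n. W k * cs n k) \<longlonglongrightarrow> c' k" "(\<lambda>n. \<Sum>\<^sub>\<infinity>k. c' k - W k * cs n k) \<longlonglongrightarrow> 0"
    by (rule infsum_incseq_limit[where c = "\<lambda>n k. W k * cs n k", OF 1 2 cs_wsm(2)]) blast
  define c where "c k = c' k / W k" for k
  have Wc: "W k * c k = c' k" for k using W0[of k] by (simp add: c_def)
  have wc: "wsm c" and nc: "nrm c \<le> 2 * A" using c'(1,2) by (simp_all add: wsm_def Wc)
  have le: "cs n k \<le> c k" for n k
    using c'(3)[of k n] W0[of k] by (simp add: c_def pos_le_divide_eq mult.commute)
  have lim: "(\<lambda>n. cs n k) \<longlonglongrightarrow> c k" for k
    using tendsto_divide[OF c'(4)[of k] tendsto_const[of "W k"]] W0[of k] by (simp add: c_def)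
  have dw: "wsm (\<lambda>k. c k - cs n k)" for n by (intro wsm_diff cs_wsm wc le)
  have dn: "(\<lambda>n. nrm (\<lambda>k. c k - cs n k)) \<longlonglongrightarrow> 0"
    using c'(5) by (simp add: right_diff_distrib Wc)
  define w where "w k t = lim (\<lambda>n. ws n k t)" for k t
  have w: "(\<lambda>n. ws n k t) \<longlonglongrightarrow> w k t" if t: "t \<in> {0..T}" for k t
  proof -
    have "Cauchy (\<lambda>n. cs n k * E t)"
      using tendsto_mult[OF lim[of k] tendsto_const[of "E t"]] by (intro LIMSEQ_imp_Cauchy)
    have "Cauchy (\<lambda>n. ws n k t)"
    proof (rule metric_CauchyI)
      fix e :: real assume "0 < e"
      with \<open>Cauchy (\<lambda>n. cs n k * E t)\<close> obtain N where N: "\<And>m n. m \<ge> N \<Longrightarrow> n \<ge> N \<Longrightarrow> dist (cs m k * E t) (cs n k * E t) < e"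
        unfolding Cauchy_def by blast
      have ordered: "dist (ws m k t) (ws n k t) < e" if "N \<le> n" "n \<le> m" for m n
      proof -
        have "norm (ws m k t - ws n k t) \<le> cs m k * E t - cs n k * E t"
          using ws_Cauchy_bound[OF that(2) t, of k] by (simp only: left_diff_distrib)
        also have "\<dots> \<le> dist (cs m k * E t) (cs n k * E t)" by (simp add: dist_real_def)
        also have "\<dots> < e" using that by (intro N) auto
        finally show ?thesis by (simp add: dist_norm)
      qed
      have "dist (ws m k t) (ws n k t) < e" if "N \<le> m" "N \<le> n" for m n
        using ordered[of n m] ordered[of m n] that by (cases "n \<le> m") (auto simp: dist_commute)
      then show "\<exists>M. \<forall>m\<ge>M. \<forall>n\<ge>M. dist (ws m k t) (ws n k t) < e" by blast
    qed
    then have "convergent (\<lambda>n. ws n k t)" by (rule Cauchy_convergent)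
    then show ?thesis by (simp only: w_def convergent_LIMSEQ_iff)
  qed
  have wd: "norm (w k t - ws n k t) \<le> (c k - cs n k) * E t" if t: "t \<in> {0..T}" for k t n
  proof (rule LIMSEQ_le)
    show "(\<lambda>m. norm (ws m k t - ws n k t)) \<longlonglongrightarrow> norm (w k t - ws n k t)"
      by (intro tendsto_intros w t)
    show "(\<lambda>m. (cs m k - cs n k) * E t) \<longlonglongrightarrow> (c k - cs n k) * E t"
      by (intro tendsto_intros lim)
    show "\<exists>N. \<forall>m\<ge>N. norm (ws m k t - ws n k t) \<le> (cs m k - cs n k) * E t"
      using ws_Cauchy_bound[OF _ t] by blast
  qed
  have cw: "continuous_on {0..T} (w k)" for k
  proof (rule uniform_limit_theorem)
    show "uniform_limit {0..T} (\<lambda>n t. ws n k t) (w k) sequentially"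
    proof (rule uniform_limitI)
      fix e :: real assume e: "0 < e"
      have "(\<lambda>n. (c k - cs n k) * E T) \<longlonglongrightarrow> (c k - c k) * E T" by (intro tendsto_intros lim)
      then have "\<forall>\<^sub>F n in sequentially. (c k - cs n k) * E T < e" using e by (intro order_tendstoD) auto
      then show "\<forall>\<^sub>F n in sequentially. \<forall>t\<in>{0..T}. dist (ws n k t) (w k t) < e"
      proof eventually_elim
        case (elim n)
        show ?case
        proof
          fix t assume t: "t \<in> {0..T}"
          have "(c k - cs n k) * E t \<le> (c k - cs n k) * E T"
            using t le[of n k] by (intro mult_left_mono E_mono) auto
          with wd[OF t, of k n] elim show "dist (ws n k t) (w k t) < e" by (simp add: dist_norm norm_minus_commute)
        qed
      qed
    qed
    show "\<forall>\<^sub>F n in sequentially. continuous_on {0..T} (ws n k)"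
      by (intro always_eventually allI admD(1)[OF ws_adm])
  qed simp
  have aw: "adm w c" unfolding adm_def
  proof (intro conjI allI ballI cw)
    fix k t assume "t \<in> {0..T}"
    from wd[OF this, of k 0] show "norm (w k t) \<le> c k * E t" by (simp add: ws_def cs_def)
  qed
  have ad: "adm (\<lambda>k t. w k t - ws n k t) (\<lambda>k. c k - cs n k)" for n
    unfolding adm_def using wd by (intro conjI allI ballI continuous_on_diff cw admD(1)[OF ws_adm])
  have "w k t = Phi w k t" if t: "t \<in> {0..T}" for k t
  proof (rule LIMSEQ_unique)
    show "(\<lambda>n. Phi (ws n) k t) \<longlonglongrightarrow> w k t"
      using LIMSEQ_Suc[OF w[OF t, of k]] by (simp add: ws_Suc)
    let ?r = "\<lambda>n. nrm (\<lambda>k. c k - cs n k)"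
    \<comment> \<open>The convolutions are bounded by products of norms, so the error in
      \<open>Phi\<close> is controlled by the norm \<open>?r n\<close> of the majorant of
      \<open>w - ws n\<close>, which tends to 0.\<close>
    have b: "norm (Phi w k t - Phi (ws n) k t) \<le> (e1 * (real (card J) * ?r n) + e2 * (2 * A * ?r n + ?r n * (2 * A))) * E t" for n
    proof (rule order_trans[OF Phi_diff[OF _ cs_wsm(1) aw wc ad dw t]])
      show "adm (ws n) (cs n)" by (rule ws_adm)
      have r0: "0 \<le> ?r n" using wsmD(1,4)[OF dw[of n], of undefined] by linarith
      have "cv (cs n) (\<lambda>k. c k - cs n k) k \<le> 2 * A * ?r n"
        using cv_le_nrm[OF cs_wsm(1) dw, of n n k] mult_right_mono[OF cs_wsm(2) r0] by (rule order_trans)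
      moreover have "cv (\<lambda>k. c k - cs n k) c k \<le> ?r n * (2 * A)"
        using cv_le_nrm[OF dw wc, of n k] mult_left_mono[OF nc r0] by (rule order_trans)
      moreover have "(\<Sum>j\<in>J. c (k - j) - cs n (k - j)) \<le> real (card J) * ?r n"
        using wsmD(4)[OF dw[of n]] by (intro sum_bounded_above) auto
      ultimately show "(e1 * (\<Sum>j\<in>J. c (k - j) - cs n (k - j)) + e2 * (cv (cs n) (\<lambda>k. c k - cs n k) k + cv (\<lambda>k. c k - cs n k) c k)) * E t
        \<le> (e1 * (real (card J) * ?r n) + e2 * (2 * A * ?r n + ?r n * (2 * A))) * E t"
        using E_pos[of t] by (intro mult_right_mono add_mono mult_left_mono e_nonneg) auto
    qed
    have "(\<lambda>n. (e1 * (real (card J) * ?r n) + e2 * (2 * A * ?r n + ?r n * (2 * A))) * E t)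
       \<longlonglongrightarrow> (e1 * (real (card J) * 0) + e2 * (2 * A * 0 + 0 * (2 * A))) * E t"
      by (intro tendsto_intros dn)
    then have "(\<lambda>n. Phi w k t - Phi (ws n) k t) \<longlonglongrightarrow> 0"
      by (intro Lim_null_comparison[OF always_eventually[OF allI[OF b]]]) simp
    from tendsto_diff[OF tendsto_const[of "Phi w k t"] this] show "(\<lambda>n. Phi (ws n) k t) \<longlonglongrightarrow> Phi w k t" by simp
  qed
  with aw wc nc w show thesis by (intro that)
qed

end

context mode_equation begin

section \<open>Equation, symmetry and size of the constructed solution\<close>

lemma solution_ode:
  assumes w: "adm w c" "wsm c" "\<And>k t. t \<in> {0..T} \<Longrightarrow> w k t = Phi w k t"
    and L: "(L k has_vector_derivative - q k *\<^sub>R L k t) (at t within {0..T})" and t: "t \<in> {0..T}"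
  shows "((\<lambda>t. L k t + w k t) has_vector_derivative - q k *\<^sub>R (L k t + w k t)
     - cnv k (\<lambda>k t. L k t + w k t) (\<lambda>k t. L k t + w k t) t) (at t within {0..T})"
proof -
  let ?z = "\<lambda>k t. L k t + w k t"
  note z = adm_add[OF adm_L w(1)] wsm_add[OF wsm_cL w(2)]
  have "(Phi w k has_vector_derivative - (cnv k ?z ?z t - q k *\<^sub>R duhamel (q k) (cnv k ?z ?z) t)) (at t within {0..T})"
    unfolding Phi_def[abs_def]
    by (intro has_vector_derivative_minus duhamel_deriv[OF t cnv_cont[OF z(1,1) z(2,2)]])
  then have "(w k has_vector_derivative - (cnv k ?z ?z t - q k *\<^sub>R duhamel (q k) (cnv k ?z ?z) t)) (at t within {0..T})"
    by (rule has_vector_derivative_transform[OF t, rotated]) (simp add: w(3))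
  from has_vector_derivative_add[OF L this] show ?thesis
    using w(3)[OF t, of k] by (simp add: Phi_def algebra_simps)
qed

text \<open>The symmetry holds for the iterate 0, is preserved by each step after the reindexing
  \<open>j \<mapsto> - j\<close> in the convolution, and passes to the limit because \<sigma> is
  continuous.\<close>

lemma solution_symmetric:
  assumes lim: "\<And>k t. t \<in> {0..T} \<Longrightarrow> (\<lambda>n. ws n k t) \<longlonglongrightarrow> w k t" and sg: "bounded_linear \<sigma>"
    and M: "\<And>k x y. M (- k) (\<sigma> x) (\<sigma> y) = \<sigma> (M k x y)" and L: "\<And>k t. L (- k) t = \<sigma> (L k t)"
    and t: "t \<in> {0..T}"
  shows "w (- k) t = \<sigma> (w k t)"
proof -
  have bij: "bij (uminus :: mode \<Rightarrow> mode)" by (rule bij_uminus)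
  have "ws n (- k) t = \<sigma> (ws n k t)" if "t \<in> {0..T}" for n k t
    using that
  proof (induction n arbitrary: k t)
    case 0
    show ?case using linear_0[OF bounded_linear.linear[OF sg]] by (simp add: ws_def)
  next
    case (Suc n)
    let ?z = "\<lambda>k t. L k t + ws n k t"
    note z = adm_add[OF adm_L ws_adm] wsm_add[OF wsm_cL cs_wsm(1)]
    have zs: "?z (- j) s = \<sigma> (?z j s)" if "s \<in> {0..T}" for j s
      using Suc.IH[OF that] L by (simp add: linear_add[OF bounded_linear.linear[OF sg]])
    have "cnv (- k) ?z ?z s = \<sigma> (cnv k ?z ?z s)" if s: "s \<in> {0..T}" for s
    proof -
      have "cnv (- k) ?z ?z s = (\<Sum>\<^sub>\<infinity>j. M (- k) (?z (- j) s) (?z (- (k - j)) s))"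
        unfolding cnv_def using infsum_reindex_bij_betw[OF bij, of "\<lambda>j. M (- k) (?z j s) (?z (- k - j) s)"] by simp
      also have "\<dots> = (\<Sum>\<^sub>\<infinity>j. \<sigma> (M k (?z j s) (?z (k - j) s)))"
        unfolding zs[OF s] M ..
      also have "\<dots> = \<sigma> (cnv k ?z ?z s)"
        unfolding cnv_def
        by (rule infsumI[OF has_sum_bounded_linear[OF sg has_sum_infsum[OF cnv_terms(1)[OF z(1,1) z(2,2) s]]]])
      finally show ?thesis .
    qed
    then have "duhamel (q k) (cnv (- k) ?z ?z) t = duhamel (q k) (\<lambda>s. \<sigma> (cnv k ?z ?z s)) t"
      using Suc.prems by (intro duhamel_cong) auto
    also have "\<dots> = \<sigma> (duhamel (q k) (cnv k ?z ?z) t)"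
      by (rule duhamel_linear[OF sg Suc.prems cnv_cont[OF z(1,1) z(2,2)], symmetric])
    finally show ?case
      by (simp add: ws_Suc Phi_def wv_minus linear_neg[OF bounded_linear.linear[OF sg]])
  qed
  then have "(\<lambda>n. \<sigma> (ws n k t)) \<longlonglongrightarrow> w (- k) t" using lim[OF t, of "- k"] t by simp
  moreover have "(\<lambda>n. \<sigma> (ws n k t)) \<longlonglongrightarrow> \<sigma> (w k t)"
    by (rule bounded_linear.tendsto[OF sg lim[OF t]])
  ultimately show ?thesis by (rule LIMSEQ_unique)
qed

text \<open>What is left after the first iterate is measured differently: a factor
  \<open>norm (wv k)\<close> stays outside, to be absorbed later by the Besov norm of order -1. The
  time integral of \<open>norm (wv j) * exp (- q j * s)\<close> is then at most
  \<open>1 / K\<close>, and the quadratic term gains a full factor \<open>T\<close>. This makes the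
  remainder small rather than merely bounded.\<close>

lemma solution_remainder:
  assumes w: "adm w c" "wsm c" "nrm c \<le> 2 * A" "\<And>k t. t \<in> {0..T} \<Longrightarrow> w k t = Phi w k t"
    and K: "0 < K" "\<And>j. j \<in> J \<Longrightarrow> K \<le> norm (wv j)"
  obtains \<rho> where "nonneg_summable \<rho>"
    "(\<Sum>\<^sub>\<infinity>k. \<rho> k) \<le> 32 * B * ET * real (card J) * A / K + 8 * ET\<^sup>2 * T * A\<^sup>2"
    "\<And>k t. t \<in> {0..T} \<Longrightarrow> norm (w k t + duhamel (q k) (cnv k L L) t) \<le> norm (wv k) * \<rho> k"
proof -
  define \<rho> where "\<rho> k = 4 * B * ET / K * (\<Sum>j\<in>J. c (k - j)) + 2 * ET\<^sup>2 * T * cv c c k" for k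
  have n0: "0 \<le> 4 * B * ET / K" "0 \<le> 2 * ET\<^sup>2 * T" using pos K by auto
  note s = wsm_cmult[OF wsm_shifts(1)[OF w(2)] n0(1)] wsm_cmult[OF wsm_cv(1)[OF w(2,2)] n0(2)]
  have r: "wsm \<rho>" unfolding \<rho>_def[abs_def] by (rule wsm_add[OF s])
  have nc: "0 \<le> nrm c" using wsmD(1,4)[OF w(2), of undefined] by linarith
  have "nrm \<rho> = 4 * B * ET / K * nrm (\<lambda>k. \<Sum>j\<in>J. c (k - j)) + 2 * ET\<^sup>2 * T * nrm (cv c c)"
    unfolding \<rho>_def[abs_def] nrm_add[OF s] nrm_cmult ..
  also have "\<dots> \<le> 4 * B * ET / K * (4 * real (card J) * (2 * A)) + 2 * ET\<^sup>2 * T * ((2 * A) * (2 * A))"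
  proof (intro add_mono mult_left_mono n0)
    show "nrm (\<lambda>k. \<Sum>j\<in>J. c (k - j)) \<le> 4 * real (card J) * (2 * A)"
      by (rule order_trans[OF wsm_shifts(2)[OF w(2)]]) (intro mult_left_mono w(3), simp)
    show "nrm (cv c c) \<le> (2 * A) * (2 * A)"
      by (rule order_trans[OF wsm_cv(2)[OF w(2,2)]]) (intro mult_mono w(3) nc, use pos in simp)
  qed
  also have "\<dots> = 32 * B * ET * real (card J) * A / K + 8 * ET\<^sup>2 * T * A\<^sup>2"
    by (simp add: power2_eq_square)
  finally have R: "(\<Sum>\<^sub>\<infinity>k. \<rho> k) \<le> 32 * B * ET * real (card J) * A / K + 8 * ET\<^sup>2 * T * A\<^sup>2"
    using wsmD(3)[OF r] by linarith
  have "norm (w k t + duhamel (q k) (cnv k L L) t) \<le> norm (wv k) * \<rho> k" if t: "t \<in> {0..T}" for k t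
  proof -
    note c0 = wsmD(1)[OF w(2)]
    have cv0: "0 \<le> cv c c k" by (rule cv_nonneg'[OF w(2,2)])
    have EE: "E s \<le> ET" for s by (rule E_le)
    \<comment> \<open>The heat factor is estimated by 1, since the derivative
      \<open>norm (wv k)\<close> is kept in the bound.\<close>
    have kill: "exp (- q k * (t - s)) * x \<le> x" if "s \<in> {0..t}" "0 \<le> x" for s x
      using that mult_right_mono[of "exp (- q k * (t - s))" 1 x] by simp
    let ?C = "\<lambda>j. 4 * B * norm (wv k) * ET * c (k - j)"
    let ?G = "\<lambda>s. \<Sum>j\<in>J. ?C j * (- exp (- q j * s) / norm (wv j))"
    have "norm (duhamel (q k) (lin k w) t) \<le> ?G t - ?G 0"
    proof (rule duhamel_le[OF t lin_cont[OF w(1,2)]])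
      fix s assume s: "s \<in> {0..t}"
      then have sT: "s \<in> {0..T}" using t by auto
      have "((\<lambda>s. - exp (- q j * s) / norm (wv j)) has_real_derivative norm (wv j) * exp (- q j * s)) (at s)" if "j \<in> J" for j
        using K(2)[OF that] K(1) by (auto intro!: derivative_eq_intros simp: power2_eq_square)
      then show "(?G has_real_derivative (\<Sum>j\<in>J. ?C j * (norm (wv j) * exp (- q j * s)))) (at s)"
        by (intro DERIV_sum DERIV_cmult)
      have "exp (- q k * (t - s)) * norm (lin k w s) \<le> norm (lin k w s)" by (rule kill[OF s]) simp
      also have "\<dots> \<le> (\<Sum>j\<in>J. 4 * B * norm (wv k) * norm (wv j) * exp (- q j * s) * (c (k - j) * E s))"
        by (rule norm_lin_le[OF w(1) sT])
      also have "\<dots> \<le> (\<Sum>j\<in>J. 4 * B * norm (wv k) * norm (wv j) * exp (- q j * s) * (c (k - j) * ET))"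
        using pos c0 by (intro sum_mono mult_left_mono EE) auto
      also have "\<dots> = (\<Sum>j\<in>J. ?C j * (norm (wv j) * exp (- q j * s)))"
        by (intro sum.cong refl) (simp add: ac_simps)
      finally show "exp (- q k * (t - s)) * norm (lin k w s) \<le> (\<Sum>j\<in>J. ?C j * (norm (wv j) * exp (- q j * s)))" .
    qed
    also have "?G t - ?G 0 = (\<Sum>j\<in>J. ?C j * ((1 - exp (- q j * t)) / norm (wv j)))"
      unfolding sum_subtractf[symmetric] by (intro sum.cong refl) (simp add: right_diff_distrib diff_divide_distrib)
    also have "\<dots> \<le> (\<Sum>j\<in>J. ?C j * (1 / K))"
    proof (intro sum_mono mult_left_mono)
      show "(1 - exp (- q j * t)) / norm (wv j) \<le> 1 / K" if "j \<in> J" for j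
        using K(1) K(2)[OF that] by (intro frac_le) auto
    qed (use pos c0 in auto)
    also have "\<dots> = norm (wv k) * (4 * B * ET / K * (\<Sum>j\<in>J. c (k - j)))"
      unfolding sum_distrib_left by (intro sum.cong refl) (simp add: ac_simps)
    finally have 1: "norm (duhamel (q k) (lin k w) t) \<le> norm (wv k) * (4 * B * ET / K * (\<Sum>j\<in>J. c (k - j)))" .
    let ?D = "2 * norm (wv k) * ET\<^sup>2 * cv c c k"
    have "norm (duhamel (q k) (cnv k w w) t) \<le> ?D * t - ?D * 0"
    proof (rule duhamel_le[OF t cnv_cont[OF w(1,1) w(2,2)]])
      fix s assume s: "s \<in> {0..t}"
      then have sT: "s \<in> {0..T}" using t by auto
      show "((\<lambda>s. ?D * s) has_real_derivative ?D) (at s)"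
        using DERIV_cmult[OF DERIV_ident, of ?D] by simp
      have "exp (- q k * (t - s)) * norm (cnv k w w s) \<le> norm (cnv k w w s)" by (rule kill[OF s]) simp
      also have "\<dots> \<le> 2 * norm (wv k) * (E s)\<^sup>2 * cv c c k"
        by (rule cnv_terms(2)[OF w(1,1) w(2,2) sT])
      also have "\<dots> \<le> ?D"
        using cv0 E_pos[of s] by (intro mult_right_mono mult_left_mono power_mono EE) auto
      finally show "exp (- q k * (t - s)) * norm (cnv k w w s) \<le> ?D" .
    qed
    also have "\<dots> \<le> ?D * T" using t cv0 by (simp add: mult_left_mono)
    finally have 2: "norm (duhamel (q k) (cnv k w w) t) \<le> norm (wv k) * (2 * ET\<^sup>2 * T * cv c c k)"
      by (simp add: ac_simps)
    have "w k t + duhamel (q k) (cnv k L L) t = - (duhamel (q k) (lin k w) t + duhamel (q k) (cnv k w w) t)"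
      using w(4)[OF t, of k] Phi_expand[OF w(1,2) t, of k] by simp
    then have "norm (w k t + duhamel (q k) (cnv k L L) t) \<le> norm (duhamel (q k) (lin k w) t) + norm (duhamel (q k) (cnv k w w) t)"
      by (simp only: norm_minus_cancel norm_triangle_ineq)
    with 1 2 show ?thesis by (simp add: \<rho>_def distrib_left)
  qed
  with R wsmD(2)[OF r] show thesis by (intro that)
qed

end

section \<open>The MHD nonlinearity on Fourier modes\<close>

text \<open>Acts on pairs of a velocity and a magnetic coefficient, with the signs of the sine and
  cosine formulation.\<close>

definition mhd_form :: "mode \<Rightarrow> ((real ^ 3) \<times> (real ^ 3)) \<Rightarrow> ((real ^ 3) \<times> (real ^ 3)) \<Rightarrow> (real ^ 3) \<times> (real ^ 3)" where
  "mhd_form k x y =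
     (leray k ((fst x \<bullet> wv k) *\<^sub>R fst y + (snd x \<bullet> wv k) *\<^sub>R snd y),
      (fst x \<bullet> wv k) *\<^sub>R snd y - (snd x \<bullet> wv k) *\<^sub>R fst y)"

text \<open>Cauchy-Schwarz in the norm of pairs bounds each component with constant 1; the factor 2
  is the triangle inequality for the pair.\<close>

lemma norm_mhd_form_le: "norm (mhd_form k x y) \<le> 2 * norm (wv k) * norm x * norm y"
proof -
  have CS: "a * c + b * d \<le> norm (a, b) * norm (c, d)" for a b c d :: real
    using Cauchy_Schwarz_ineq2[of "(a, b)" "(c, d)"] by simp
  have n: "norm (norm (fst z), norm (snd z)) = norm z" for z :: "(real^3) \<times> (real^3)"
    by (cases z) (simp add: norm_Pair)
  have t: "norm ((a \<bullet> wv k) *\<^sub>R b) \<le> norm (wv k) * (norm a * norm b)" for a b :: "real^3"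
    using mult_right_mono[OF Cauchy_Schwarz_ineq2[of a "wv k"] norm_ge_zero[of b]] by (simp add: ac_simps)
  have "norm (leray k ((fst x \<bullet> wv k) *\<^sub>R fst y + (snd x \<bullet> wv k) *\<^sub>R snd y))
      \<le> norm (wv k) * (norm (fst x) * norm (fst y)) + norm (wv k) * (norm (snd x) * norm (snd y))"
    by (intro order_trans[OF norm_leray_le] norm_triangle_le add_mono t)
  also have "\<dots> \<le> norm (wv k) * (norm x * norm y)"
    using CS[of "norm (fst x)" "norm (fst y)" "norm (snd x)" "norm (snd y)"]
    unfolding n distrib_left[symmetric] by (intro mult_left_mono) auto
  finally have 1: "norm (leray k ((fst x \<bullet> wv k) *\<^sub>R fst y + (snd x \<bullet> wv k) *\<^sub>R snd y)) \<le> norm (wv k) * (norm x * norm y)" .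
  have "norm ((fst x \<bullet> wv k) *\<^sub>R snd y - (snd x \<bullet> wv k) *\<^sub>R fst y)
      \<le> norm (wv k) * (norm (fst x) * norm (snd y)) + norm (wv k) * (norm (snd x) * norm (fst y))"
    by (intro order_trans[OF norm_triangle_ineq4] add_mono t)
  also have "\<dots> \<le> norm (wv k) * (norm x * norm y)"
    using CS[of "norm (fst x)" "norm (snd y)" "norm (snd x)" "norm (fst y)"] n[of x] n[of "prod.swap y"]
    unfolding distrib_left[symmetric] by (intro mult_left_mono) (auto simp: norm_prod_def add.commute)
  finally have 2: "norm ((fst x \<bullet> wv k) *\<^sub>R snd y - (snd x \<bullet> wv k) *\<^sub>R fst y) \<le> norm (wv k) * (norm x * norm y)" .
  show ?thesis
    unfolding mhd_form_def by (rule order_trans[OF norm_Pair_le]) (use add_mono[OF 1 2] in \<open>simp add: ac_simps\<close>)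
qed

lemma mhd_form_bilinear: "bounded_bilinear (mhd_form k)"
proof -
  note l = bounded_linear.linear[OF leray_bounded_linear]
  show ?thesis
  proof
    show "mhd_form k (a + a') b = mhd_form k a b + mhd_form k a' b" for a a' b
      by (simp add: mhd_form_def inner_add_left scaleR_add_left linear_add[OF l])
    show "mhd_form k a (b + b') = mhd_form k a b + mhd_form k a b'" for a b b'
      by (simp add: mhd_form_def scaleR_add_right linear_add[OF l])
    show "mhd_form k (r *\<^sub>R a) b = r *\<^sub>R mhd_form k a b" for r a b
      by (simp add: mhd_form_def linear_cmul[OF l, symmetric] scaleR_add_right scaleR_diff_right)
    show "mhd_form k a (r *\<^sub>R b) = r *\<^sub>R mhd_form k a b" for r a b
      by (simp add: mhd_form_def linear_cmul[OF l, symmetric] scaleR_add_right scaleR_diff_right mult.commute)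
    show "\<exists>C. \<forall>a b. norm (mhd_form k a b) \<le> norm a * norm b * C"
      using norm_mhd_form_le[of k] by (intro exI[of _ "2 * norm (wv k)"]) (simp add: ac_simps)
  qed
qed

text \<open>The condition \<open>z (- k) = parity (z k)\<close> says that the velocity coefficients
  are odd and the magnetic ones even, as sine and cosine series demand.\<close>

definition parity :: "(real ^ 3) \<times> (real ^ 3) \<Rightarrow> (real ^ 3) \<times> (real ^ 3)" where
  "parity z = (- fst z, snd z)"

lemma parity_linear: "bounded_linear parity"
  unfolding parity_def[abs_def]
  by (intro bounded_linear_Pair bounded_linear_minus bounded_linear_fst bounded_linear_snd)

lemma mhd_form_parity: "mhd_form (- k) (parity x) (parity y) = parity (mhd_form k x y)"
  by (simp add: mhd_form_def parity_def leray_minus wv_minus linear_neg[OF bounded_linear.linear[OF leray_bounded_linear], symmetric])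

section \<open>The initial data\<close>

text \<open>The amplitude of the wave \<open>(m, - 1, 0)\<close>. Its second component must be 1 /
  2, orthogonality to the wave vector forces the first, and the unit length determines the third up
  to sign.\<close>

definition slanted :: "real \<Rightarrow> real ^ 3" where
  "slanted m = vector [1 / (2 * m), 1 / 2, sqrt (3 / 4 - 1 / (4 * m\<^sup>2))]"

lemma slanted_nth [simp]: "slanted m $ 1 = 1 / (2 * m)" "slanted m $ 2 = 1 / 2"
    "slanted m $ 3 = sqrt (3 / 4 - 1 / (4 * m\<^sup>2))"
  by (simp_all add: slanted_def)

lemma inner_3: "x \<bullet> y = x $ 1 * y $ 1 + x $ 2 * y $ 2 + x $ 3 * (y $ 3 :: real)" for x y :: "real ^ 3"
  by (simp add: inner_vec_def sum_3)

lemma norm_slanted: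
  assumes "1 \<le> m" shows "norm (slanted m) = 1"
proof -
  have "1 / (4 * m\<^sup>2) \<le> 1 / 4" using one_le_power[OF assms, of 2] by (intro frac_le) auto
  then have "slanted m \<bullet> slanted m = 1"
    by (simp add: inner_3 power2_eq_square[symmetric] power_divide)
  then show ?thesis by (simp add: norm_eq_sqrt_inner)
qed

text \<open>\<open>S\<close> is the set of the integers \<open>|k\<^sub>s|\<close>: the plane waves have wave vectors \<open>(m, 0, 0)\<close> and
  \<open>(m, - 1, 0)\<close> for \<open>m \<in> S\<close>, and \<open>K\<close> is the least element of \<open>S\<close>. The number \<open>B0\<close> is \<open>Q / sqrt r\<close>.\<close>

locale mhd_data =
  fixes S :: "int set" and B0 K :: real
  assumes S: "finite S" "S \<noteq> {}" and K1: "2 \<le> K" and K: "m \<in> S \<Longrightarrow> K \<le> of_int m"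
    and gap: "m \<in> S \<Longrightarrow> m' \<in> S \<Longrightarrow> m \<noteq> m' \<Longrightarrow> K \<le> \<bar>of_int m - of_int m'\<bar>"
    and B0: "0 < B0"
    and lacunary: "0 < \<tau> \<Longrightarrow> (\<Sum>m\<in>S. sqrt \<tau> * of_int m * exp (- (of_int m)\<^sup>2 * \<tau>)) \<le> 4"
    and small: "16 * exp ((128 * B0 * real (card S))\<^sup>2 * (4 * real (card S))) * (1 / K) * (256 * B0\<^sup>2 * (real (card S))\<^sup>2) \<le> 1"
begin

text \<open>Each real wave is split evenly between \<open>k\<close> and \<open>- k\<close>, which
  halves the amplitude \<open>B0\<close>.\<close>

definition "\<beta> k = (if snd k = 0 \<and> \<bar>fst k\<bar> \<in> S then (B0 / 2 * norm (wv k)) *\<^sub>R axis 3 1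
   else if snd k = - 1 \<and> fst k \<in> S then (B0 / 2 * norm (wv k)) *\<^sub>R slanted (of_int (fst k))
   else if snd k = 1 \<and> - fst k \<in> S then (B0 / 2 * norm (wv k)) *\<^sub>R slanted (of_int (- fst k))
   else (0 :: real ^ 3))"

definition "J = {k :: mode. snd k = 0 \<and> \<bar>fst k\<bar> \<in> S \<or> snd k = - 1 \<and> fst k \<in> S \<or> snd k = 1 \<and> - fst k \<in> S}"

lemma S1: "m \<in> S \<Longrightarrow> 1 \<le> m"
  using K[of m] K1 by linarith

lemma J_eq: "J = (\<lambda>m. (m, 0)) ` S \<union> (\<lambda>m. (- m, 0)) ` S \<union> (\<lambda>m. (m, - 1)) ` S \<union> (\<lambda>m. (- m, 1)) ` S"
proof -
  have i1: "(\<lambda>m. (m, c)) ` S = {k. snd k = c \<and> fst k \<in> S}" for c :: int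
    by (auto simp: image_iff)
  have i2: "(\<lambda>m. (- m, c)) ` S = {k. snd k = c \<and> - fst k \<in> S}" for c :: int
  proof (intro equalityI subsetI)
    fix k assume "k \<in> {k. snd k = c \<and> - fst k \<in> S}"
    then show "k \<in> (\<lambda>m. (- m, c)) ` S" by (intro image_eqI[where x = "- fst k"]) (auto simp: prod_eq_iff)
  qed auto
  have a: "\<bar>m\<bar> \<in> S \<longleftrightarrow> m \<in> S \<or> - m \<in> S" for m
    using S1[of m] S1[of "- m"] by (cases "0 \<le> m") auto
  show ?thesis unfolding i1 i2 J_def a by blast
qed

lemma finite_J: "finite J" using S(1) by (simp add: J_eq)

lemma sum_J: "(\<Sum>k\<in>J. f k) = (\<Sum>m\<in>S. f (m, 0) + f (- m, 0) + f (m, - 1) + f (- m, 1))" for f :: "mode \<Rightarrow> 'z::comm_monoid_add"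
proof -
  have "(\<Sum>k\<in>J. f k) = (\<Sum>k\<in>(\<lambda>m. (m, 0)) ` S. f k) + (\<Sum>k\<in>(\<lambda>m. (- m, 0)) ` S. f k)
     + (\<Sum>k\<in>(\<lambda>m. (m, - 1)) ` S. f k) + (\<Sum>k\<in>(\<lambda>m. (- m, 1)) ` S. f k)"
  proof -
    have "(\<lambda>m. (m, 0 :: int)) ` S \<inter> (\<lambda>m. (- m, 0)) ` S = {}" by (auto dest!: S1)
    moreover have "((\<lambda>m. (m, 0 :: int)) ` S \<union> (\<lambda>m. (- m, 0)) ` S) \<inter> (\<lambda>m. (m, - 1)) ` S = {}" by auto
    moreover have "((\<lambda>m. (m, 0 :: int)) ` S \<union> (\<lambda>m. (- m, 0)) ` S \<union> (\<lambda>m. (m, - 1)) ` S) \<inter> (\<lambda>m. (- m, 1)) ` S = {}" by auto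
    ultimately show ?thesis unfolding J_eq using S(1) by (simp only: sum.union_disjoint finite_imageI finite_Un)
  qed
  also have "\<dots> = (\<Sum>m\<in>S. f (m, 0)) + (\<Sum>m\<in>S. f (- m, 0)) + (\<Sum>m\<in>S. f (m, - 1)) + (\<Sum>m\<in>S. f (- m, 1))"
    by (simp add: sum.reindex inj_on_def)
  finally show ?thesis by (simp add: sum.distrib)
qed

lemma card_J: "card J = 4 * card S"
proof -
  have "card J = (\<Sum>k\<in>J. 1)" by simp
  also have "\<dots> = (\<Sum>m\<in>S. 1 + 1 + 1 + 1)" by (rule sum_J)
  finally show ?thesis by simp
qed

lemma norm_wv_ge: "\<bar>of_int (fst k)\<bar> \<le> norm (wv k)"
  using abs_wv_nth_le[of k 1] by simp

lemma norm_wv_le: "norm (wv k) \<le> 2 * \<bar>of_int (fst k)\<bar>" if "\<bar>snd k\<bar> \<le> 1" "fst k \<noteq> 0"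
proof -
  have "(norm (wv k))\<^sup>2 \<le> (2 * \<bar>of_int (fst k)\<bar>)\<^sup>2"
  proof -
    have "\<bar>snd k\<bar> \<le> \<bar>fst k\<bar>" using that by linarith
    then have "(of_int (snd k))\<^sup>2 \<le> (of_int (fst k) :: real)\<^sup>2"
      by (simp add: abs_le_square_iff[symmetric] flip: of_int_abs)
    moreover have "0 \<le> (of_int (fst k) :: real)\<^sup>2" by simp
    ultimately have "(of_int (fst k))\<^sup>2 + (of_int (snd k))\<^sup>2 \<le> 4 * (of_int (fst k) :: real)\<^sup>2" by linarith
    then show ?thesis by (simp add: norm_wv_sq power_mult_distrib)
  qed
  then show ?thesis by (rule power2_le_imp_le) simp
qed

lemma J_cases:
  assumes "k \<in> J"
  obtains (straight) m where "m \<in> S" "k = (m, 0) \<or> k = (- m, 0)" "\<beta> k = (B0 / 2 * norm (wv k)) *\<^sub>R axis 3 1"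
    | (slant) m where "m \<in> S" "k = (m, - 1) \<or> k = (- m, 1)" "\<beta> k = (B0 / 2 * norm (wv k)) *\<^sub>R slanted (of_int m)"
  using assms unfolding J_eq
proof (elim UnE imageE)
  fix m assume "m \<in> S"
  note that(1)[OF this] that(2)[OF this]
  then show "k = (m, 0) \<Longrightarrow> thesis" "k = (- m, 0) \<Longrightarrow> thesis" "k = (m, - 1) \<Longrightarrow> thesis" "k = (- m, 1) \<Longrightarrow> thesis"
    using \<open>m \<in> S\<close> S1[of m] by (auto simp: \<beta>_def)
qed

lemma \<beta>_outside: "k \<notin> J \<Longrightarrow> \<beta> k = 0"
  by (auto simp: \<beta>_def J_def)

lemma \<beta>_even: "\<beta> (- k) = \<beta> k"
proof -
  have n: "norm (wv (- k)) = norm (wv k)" by (simp add: wv_minus)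
  show ?thesis unfolding \<beta>_def n by auto
qed

lemma norm_\<beta>: "norm (\<beta> k) \<le> B0 / 2 * norm (wv k)"
proof (cases "k \<in> J")
  case True
  then show ?thesis
  proof (cases rule: J_cases)
    case (slant m)
    have "norm (slanted (of_int m)) = 1" using S1[OF slant(1)] by (intro norm_slanted) simp
    then show ?thesis using slant B0 by simp
  qed (use B0 in simp)
qed (use B0 in \<open>simp add: \<beta>_outside\<close>)

lemma \<beta>_div: "wv k \<bullet> \<beta> k = 0"
proof (cases "k \<in> J")
  case True
  then show ?thesis
  proof (cases rule: J_cases)
    case (slant m)
    then have "wv k \<bullet> slanted (of_int m) = 0" using S1[OF slant(1)] by (auto simp: inner_3)
    then show ?thesis using slant by simp
  qed (simp add: inner_axis)
qed (simp add: \<beta>_outside)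

lemma J_norm_ge: "k \<in> J \<Longrightarrow> K \<le> norm (wv k)"
  by (rule order_trans[OF _ norm_wv_ge]) (auto elim!: J_cases dest!: K)

text \<open>This is where the orthogonality relations of the data enter: without them the bound would be
  the product of \<open>norm (wv j)\<close>, \<open>norm (wv l)\<close> and \<open>norm (wv (j + l))\<close>.\<close>

lemma interaction_le:
  assumes j: "j \<in> J" and l: "l \<in> J"
  shows "norm ((\<beta> j \<bullet> wv (j + l)) *\<^sub>R \<beta> l) \<le> B0\<^sup>2 * ((norm (wv j))\<^sup>2 + (norm (wv l))\<^sup>2)"
proof -
  have e: "\<beta> j \<bullet> wv (j + l) = \<beta> j \<bullet> wv l"
    using \<beta>_div[of j] by (simp add: wv_add inner_add_right inner_commute)
  have "\<bar>\<beta> j \<bullet> wv l\<bar> \<le> B0 / 2 * (norm (wv j) + norm (wv l))"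
    using j
  proof (cases rule: J_cases)
    case (straight m)
    \<comment> \<open>The amplitude points along the third axis, to which every wave vector is
      orthogonal, so the left-hand side is 0.\<close>
    then show ?thesis using B0 by (simp add: inner_axis')
  next
    case (slant m)
    have m1: "1 \<le> real_of_int m" using S1[OF slant(1)] by simp
    have jm: "norm (wv j) \<le> 2 * real_of_int m"
      using norm_wv_le[of j] slant m1 by auto
    have l2: "\<bar>real_of_int (snd l)\<bar> \<le> 1" using l by (auto simp: J_def)
    \<comment> \<open>The two components of \<open>slanted\<close> are treated separately: the first
      has a denominator \<open>2 * m\<close> that cancels \<open>norm (wv j)\<close>, the second
      meets a frequency of \<open>l\<close> that is at most 1. Either way one factor is
      saved.\<close>
    have a: "norm (wv j) / (2 * of_int m) * \<bar>of_int (fst l)\<bar> \<le> 1 * norm (wv l)"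
      using jm m1 by (intro mult_mono norm_wv_ge) auto
    have b: "norm (wv j) / 2 * \<bar>of_int (snd l)\<bar> \<le> norm (wv j) * 1"
      by (intro mult_mono l2) auto
    have "\<bar>\<beta> j \<bullet> wv l\<bar> = B0 / 2 * (norm (wv j) * \<bar>of_int (fst l) / (2 * of_int m) + of_int (snd l) / 2\<bar>)"
    proof -
      have "\<beta> j \<bullet> wv l = (B0 / 2 * norm (wv j)) * (of_int (fst l) / (2 * of_int m) + of_int (snd l) / 2)"
        unfolding slant(3) inner_scaleR_left by (simp add: inner_3)
      then show ?thesis using B0 by (simp only: abs_mult) simp
    qed
    also have "\<dots> \<le> B0 / 2 * (norm (wv j) * (\<bar>of_int (fst l) / (2 * of_int m)\<bar> + \<bar>of_int (snd l) / 2\<bar>))"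
      using B0 by (intro mult_left_mono abs_triangle_ineq) auto
    also have "\<dots> = B0 / 2 * (norm (wv j) / (2 * of_int m) * \<bar>of_int (fst l)\<bar> + norm (wv j) / 2 * \<bar>of_int (snd l)\<bar>)"
      using m1 by (simp add: distrib_left abs_mult)
    also have "\<dots> \<le> B0 / 2 * (norm (wv j) + norm (wv l))"
      using a b B0 by (intro mult_left_mono) auto
    finally show ?thesis .
  qed
  then have "norm ((\<beta> j \<bullet> wv (j + l)) *\<^sub>R \<beta> l) \<le> B0 / 2 * (norm (wv j) + norm (wv l)) * (B0 / 2 * norm (wv l))"
    unfolding e norm_scaleR using B0 by (intro mult_mono norm_\<beta>) auto
  also have "\<dots> = B0\<^sup>2 * ((norm (wv j) + norm (wv l)) * norm (wv l) / 4)"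
    by (simp add: power2_eq_square)
  also have "\<dots> \<le> B0\<^sup>2 * ((norm (wv j))\<^sup>2 + (norm (wv l))\<^sup>2)"
  proof (rule mult_left_mono)
    have "2 * norm (wv j) * norm (wv l) \<le> (norm (wv j))\<^sup>2 + (norm (wv l))\<^sup>2"
      by (rule sum_squares_bound)
    moreover have "0 \<le> (norm (wv j))\<^sup>2" "0 \<le> (norm (wv l))\<^sup>2" by simp_all
    moreover have "(norm (wv j) + norm (wv l)) * norm (wv l) = norm (wv j) * norm (wv l) + (norm (wv l))\<^sup>2"
      by (simp add: distrib_right power2_eq_square)
    ultimately show "(norm (wv j) + norm (wv l)) * norm (wv l) / 4 \<le> (norm (wv j))\<^sup>2 + (norm (wv l))\<^sup>2"
      by linarith
  qed simp
  finally show ?thesis .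
qed

text \<open>A straight \<open>j\<close> does not interact at all. For a slanted one, the first
  frequencies of \<open>j\<close> and \<open>l\<close> either add up to a nonzero integer, of size
  \<open>m + m'\<close> or \<open>\<bar>m - m'\<bar>\<close> and thus at least \<open>K\<close>, or
  cancel. In the latter case \<open>m = m'\<close>, and \<open>l\<close> is straight because two
  slanted waves would give \<open>j + l = 0\<close>.\<close>

lemma resonance:
  assumes j: "j \<in> J" and l: "l \<in> J" and n: "\<beta> j \<bullet> wv (j + l) \<noteq> 0"
  shows "K \<le> norm (wv (j + l)) \<or> (\<exists>m\<in>S. j = (- m, 1) \<and> l = (m, 0) \<or> j = (m, - 1) \<and> l = (- m, 0))"
  using j
proof (cases rule: J_cases)
  case (straight m)
  then show ?thesis using n by (simp add: inner_axis')
next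
  case (slant m)
  have jl: "j + l \<noteq> 0" using n by (auto simp: wv_zero)
  have fj: "fst j = m \<or> fst j = - m" using slant(2) by auto
  obtain m' where m': "m' \<in> S" "l = (m', 0) \<or> l = (- m', 0) \<or> l = (m', - 1) \<or> l = (- m', 1)"
    using l unfolding J_eq by blast
  then have fl: "fst l = m' \<or> fst l = - m'" by auto
  note pos = S1[OF slant(1)] S1[OF m'(1)]
  have "K \<le> norm (wv (j + l))" if "fst (j + l) \<noteq> 0"
  proof -
    have "\<bar>fst (j + l)\<bar> = m + m' \<or> m \<noteq> m' \<and> \<bar>fst (j + l)\<bar> = \<bar>m - m'\<bar>"
      using fj fl that pos by (elim disjE) auto
    then have "\<bar>real_of_int (fst (j + l))\<bar> = of_int m + of_int m' \<or> m \<noteq> m' \<and> \<bar>real_of_int (fst (j + l))\<bar> = \<bar>of_int m - of_int m'\<bar>"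
      by (simp only: of_int_abs[symmetric] of_int_add[symmetric] of_int_diff[symmetric] of_int_eq_iff)
    then have "K \<le> \<bar>real_of_int (fst (j + l))\<bar>"
      using gap[OF slant(1) m'(1)] K[OF slant(1)] K[OF m'(1)] K1 by linarith
    with norm_wv_ge[of "j + l"] show ?thesis by linarith
  qed
  moreover have "\<exists>m\<in>S. j = (- m, 1) \<and> l = (m, 0) \<or> j = (m, - 1) \<and> l = (- m, 0)" if "fst (j + l) = 0"
  proof -
    have "m' = m" using fj fl that pos by (elim disjE) auto
    with m'(2) have "l = (m, 0) \<or> l = (- m, 0) \<or> l = (m, - 1) \<or> l = (- m, 1)" by simp
    with that slant S1[OF slant(1)] jl show ?thesis by (auto simp: zero_prod_def)
  qed
  ultimately show ?thesis by blast
qed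

text \<open>Measuring frequencies in units of \<open>R\<close> keeps \<open>W\<close> at most 4 on
  \<open>J\<close>, however large the data frequencies are, so the constants do not depend on them.
  For fixed \<open>R\<close> the weight still grows quadratically and provides the two derivatives
  of a classical solution.\<close>

definition "R = 1 + (\<Sum>j\<in>J. norm (wv j))"
definition "W k = (1 + norm (wv k) / R)\<^sup>2"
definition "L k t = (0 :: real ^ 3, exp (- (norm (wv k))\<^sup>2 * t) *\<^sub>R \<beta> k)"
text \<open>Counts the ordered pairs of data frequencies with sum \<open>k\<close>, each of which
  contributes at most \<open>B0\<^sup>2\<close>.\<close>

definition "c1 k = B0\<^sup>2 * real (card {j \<in> J. k - j \<in> J})"
definition "T = 1 / K\<^sup>2"
abbreviation "r \<equiv> real (card S)"
text \<open>\<open>sqrt lam\<close> is \<open>32 * B0 * card J\<close> with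
  \<open>card J = 4 * card S\<close>. Likewise \<open>A\<close> is
  \<open>16 * B0\<^sup>2 * (card J)\<^sup>2\<close>: the factor 16 bounds \<open>W\<close> on sums
  of two data frequencies, and \<open>(card J)\<^sup>2\<close> counts the ordered pairs.\<close>

definition "lam = (128 * B0 * r)\<^sup>2"
definition "A = 256 * B0\<^sup>2 * r\<^sup>2"

lemma r_pos: "1 \<le> r" using S by (simp add: Suc_leI card_gt_0_iff)

lemma R1: "1 \<le> R" by (simp add: R_def sum_nonneg)

lemma W_ge1: "1 \<le> W k" using R1 by (simp add: W_def)

lemma W_mult: "W k \<le> W j * W (k - j)"
proof -
  have "norm (wv k) / R \<le> norm (wv j) / R + norm (wv (k - j)) / R"
    using R1 norm_triangle_ineq[of "wv j" "wv (k - j)"] by (simp add: wv_diff add_divide_distrib[symmetric] divide_right_mono)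
  moreover have "0 \<le> norm (wv j) / R * (norm (wv (k - j)) / R)" using R1 by simp
  ultimately have "1 + norm (wv k) / R \<le> (1 + norm (wv j) / R) * (1 + norm (wv (k - j)) / R)"
    unfolding distrib_left distrib_right by linarith
  then show ?thesis unfolding W_def power_mult_distrib[symmetric] using R1 by (intro power_mono) auto
qed

lemma W_J: "j \<in> J \<Longrightarrow> W j \<le> 4"
proof -
  assume "j \<in> J"
  then have "norm (wv j) \<le> (\<Sum>j\<in>J. norm (wv j))" using finite_J by (intro member_le_sum) auto
  then have "norm (wv j) \<le> R" by (simp add: R_def)
  then have "1 + norm (wv j) / R \<le> 2" using R1 by simp
  then have "(1 + norm (wv j) / R)\<^sup>2 \<le> 2\<^sup>2" using R1 by (intro power_mono) auto
  then show ?thesis by (simp add: W_def)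
qed

text \<open>\<open>L\<close> has no velocity component, so only the term with two magnetic factors
  survives, and it forces the velocity alone.\<close>

lemma self_interaction:
  "(\<Sum>\<^sub>\<infinity>j. mhd_form k (L j s) (L (k - j) s)) = (\<Sum>j\<in>{j \<in> J. k - j \<in> J}.
     exp (- ((norm (wv j))\<^sup>2 + (norm (wv (k - j)))\<^sup>2) * s) *\<^sub>R (leray k ((\<beta> j \<bullet> wv k) *\<^sub>R \<beta> (k - j)), 0))"
proof -
  have "mhd_form k (L j s) (L (k - j) s) = exp (- ((norm (wv j))\<^sup>2 + (norm (wv (k - j)))\<^sup>2) * s) *\<^sub>R (leray k ((\<beta> j \<bullet> wv k) *\<^sub>R \<beta> (k - j)), 0)" for j
    by (simp add: mhd_form_def L_def linear_cmul[OF bounded_linear.linear[OF leray_bounded_linear], symmetric]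
        exp_add[symmetric] algebra_simps)
  moreover have "(\<Sum>\<^sub>\<infinity>j. exp (- ((norm (wv j))\<^sup>2 + (norm (wv (k - j)))\<^sup>2) * s) *\<^sub>R (leray k ((\<beta> j \<bullet> wv k) *\<^sub>R \<beta> (k - j)), 0 :: real^3))
    = (\<Sum>\<^sub>\<infinity>j\<in>{j \<in> J. k - j \<in> J}. exp (- ((norm (wv j))\<^sup>2 + (norm (wv (k - j)))\<^sup>2) * s) *\<^sub>R (leray k ((\<beta> j \<bullet> wv k) *\<^sub>R \<beta> (k - j)), 0))"
    by (rule infsum_cong_neutral)
       (auto simp: \<beta>_outside linear_0[OF bounded_linear.linear[OF leray_bounded_linear]] zero_prod_def)
  ultimately show ?thesis using finite_J by simp
qed

text \<open>By \<open>interaction_le\<close> a pair contributes at most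
  \<open>B0\<^sup>2 * (p * exp (- p * s))\<close> with \<open>p\<close> the sum of the two squared
  frequencies. The integral over time is below \<open>B0\<^sup>2\<close>, uniformly in the
  frequencies.\<close>

lemma source_le:
  assumes t: "t \<in> {0..T}"
  shows "norm (duhamel ((norm (wv k))\<^sup>2) (\<lambda>s. \<Sum>\<^sub>\<infinity>j. mhd_form k (L j s) (L (k - j) s)) t) \<le> c1 k"
proof -
  let ?J = "{j \<in> J. k - j \<in> J}"
  let ?p = "\<lambda>j. (norm (wv j))\<^sup>2 + (norm (wv (k - j)))\<^sup>2"
  let ?G = "\<lambda>s. \<Sum>j\<in>?J. B0\<^sup>2 * - exp (- ?p j * s)"
  have "norm (duhamel ((norm (wv k))\<^sup>2) (\<lambda>s. \<Sum>\<^sub>\<infinity>j. mhd_form k (L j s) (L (k - j) s)) t) \<le> ?G t - ?G 0"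
    unfolding self_interaction
  proof (rule duhamel_le[OF t])
    show "continuous_on {0..T} (\<lambda>s. \<Sum>j\<in>?J. exp (- ?p j * s) *\<^sub>R (leray k ((\<beta> j \<bullet> wv k) *\<^sub>R \<beta> (k - j)), 0 :: real^3))"
      by (intro continuous_intros)
    fix s assume s: "s \<in> {0..t}"
    show "(?G has_real_derivative (\<Sum>j\<in>?J. B0\<^sup>2 * (?p j * exp (- ?p j * s)))) (at s)"
    proof (intro DERIV_sum DERIV_cmult)
      show "((\<lambda>s. - exp (- p * s)) has_real_derivative p * exp (- p * s)) (at s)" for p :: real
        by (auto intro!: derivative_eq_intros)
    qed
    have "norm (\<Sum>j\<in>?J. exp (- ?p j * s) *\<^sub>R (leray k ((\<beta> j \<bullet> wv k) *\<^sub>R \<beta> (k - j)), 0 :: real^3)) \<le> (\<Sum>j\<in>?J. B0\<^sup>2 * (?p j * exp (- ?p j * s)))"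
    proof (rule sum_norm_le)
      fix j assume j: "j \<in> ?J"
      have "norm (leray k ((\<beta> j \<bullet> wv k) *\<^sub>R \<beta> (k - j))) \<le> B0\<^sup>2 * ?p j"
        using order_trans[OF norm_leray_le interaction_le[of j "k - j"]] j by simp
      from mult_left_mono[OF this, of "exp (- ?p j * s)"]
      show "norm (exp (- ?p j * s) *\<^sub>R (leray k ((\<beta> j \<bullet> wv k) *\<^sub>R \<beta> (k - j)), 0 :: real^3)) \<le> B0\<^sup>2 * (?p j * exp (- ?p j * s))"
        by (simp add: norm_Pair ac_simps)
    qed
    moreover have "exp (- (norm (wv k))\<^sup>2 * (t - s)) * y \<le> y" if "0 \<le> y" for y
      using s that mult_right_mono[of "exp (- (norm (wv k))\<^sup>2 * (t - s))" 1 y] by simp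
    ultimately show "exp (- (norm (wv k))\<^sup>2 * (t - s)) * norm (\<Sum>j\<in>?J. exp (- ?p j * s) *\<^sub>R (leray k ((\<beta> j \<bullet> wv k) *\<^sub>R \<beta> (k - j)), 0 :: real^3))
      \<le> (\<Sum>j\<in>?J. B0\<^sup>2 * (?p j * exp (- ?p j * s)))"
      using order_trans[OF _ \<open>norm _ \<le> _\<close>] norm_ge_zero by blast
  qed
  also have "?G t - ?G 0 = (\<Sum>j\<in>?J. B0\<^sup>2 * (1 - exp (- ?p j * t)))"
    unfolding sum_subtractf[symmetric] by (intro sum.cong refl) (simp add: right_diff_distrib)
  also have "\<dots> \<le> (\<Sum>j\<in>?J. B0\<^sup>2 * 1)" by (intro sum_mono mult_left_mono) auto
  also have "\<dots> = c1 k" by (simp add: c1_def)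
  finally show ?thesis .
qed

lemma c1_nonneg: "0 \<le> c1 k" by (simp add: c1_def)

text \<open>On a sum of two frequencies of \<open>J\<close> the weight is at most
  \<open>4 * 4\<close>; exchanging the order of summation counts every ordered pair once.\<close>

lemma c1_sum: "nonneg_summable (\<lambda>k. W k * c1 k)" "(\<Sum>\<^sub>\<infinity>k. W k * c1 k) \<le> A"
proof -
  let ?F = "(\<lambda>(j, l). j + l) ` (J \<times> J)"
  have F: "finite ?F" using finite_J by simp
  have out: "c1 k = 0" if "k \<notin> ?F" for k
  proof -
    have e: "{j \<in> J. k - j \<in> J} = {}" using that by (force simp: image_iff)
    show ?thesis unfolding c1_def e by simp
  qed
  have W0: "0 \<le> W k" for k using W_ge1[of k] by linarith
  have fin: "{k. W k * c1 k \<noteq> 0} \<subseteq> ?F" using out by force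
  show "nonneg_summable (\<lambda>k. W k * c1 k)"
    unfolding nonneg_summable_def using W0 c1_nonneg finite_subset[OF fin F]
    by (intro conjI allI mult_nonneg_nonneg finite_nonzero_values_imp_summable_on) auto
  have "(\<Sum>\<^sub>\<infinity>k. W k * c1 k) = (\<Sum>k\<in>?F. W k * c1 k)"
    using infsum_cong_neutral[of UNIV ?F "\<lambda>k. W k * c1 k"] out F by simp
  also have "\<dots> \<le> (\<Sum>k\<in>?F. 16 * c1 k)"
  proof (intro sum_mono mult_right_mono c1_nonneg)
    fix k assume "k \<in> ?F"
    then obtain j l where jl: "j \<in> J" "l \<in> J" "k = j + l" by auto
    have "W k \<le> W j * W l" using W_mult[of k j] jl(3) by simp
    also have "\<dots> \<le> 4 * 4" using W_J jl W0 by (intro mult_mono) auto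
    finally show "W k \<le> 16" by simp
  qed
  also have "\<dots> = 16 * B0\<^sup>2 * (\<Sum>k\<in>?F. \<Sum>j\<in>J. if k - j \<in> J then 1 else 0)"
    unfolding c1_def using finite_J by (simp add: sum_distrib_left sum.If_cases Int_def mult.assoc)
  also have "(\<Sum>k\<in>?F. \<Sum>j\<in>J. if k - j \<in> J then 1 else 0) = (\<Sum>j\<in>J. \<Sum>k\<in>?F. if k - j \<in> J then 1 else (0::real))"
    by (rule sum.swap)
  also have "\<dots> \<le> (\<Sum>j\<in>J. real (card J))"
  proof (rule sum_mono)
    fix j assume "j \<in> J"
    have "(\<Sum>k\<in>?F. if k - j \<in> J then 1 else (0::real)) = real (card {k \<in> ?F. k - j \<in> J})"
      using F by (simp add: sum.If_cases Int_def)
    also have "card {k \<in> ?F. k - j \<in> J} \<le> card J"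
      by (rule card_inj_on_le[of "\<lambda>k. k - j"]) (auto simp: inj_on_def finite_J)
    finally show "(\<Sum>k\<in>?F. if k - j \<in> J then 1 else (0::real)) \<le> real (card J)" by simp
  qed
  also have "16 * B0\<^sup>2 * (\<Sum>j\<in>J. real (card J)) = A"
    by (simp add: A_def card_J power2_eq_square)
  finally show "(\<Sum>\<^sub>\<infinity>k. W k * c1 k) \<le> A" by (simp add: mult_left_mono)
qed

lemma mode_equation_data: "mode_equation mhd_form L J B0 lam T A W c1"
proof (rule mode_equation.intro)
  show "bounded_bilinear (mhd_form k)" for k by (rule mhd_form_bilinear)
  show "norm (mhd_form k x y) \<le> 2 * norm (wv k) * norm x * norm y" for k x y by (rule norm_mhd_form_le)
  show "0 < T" "0 < lam" "0 \<le> B0" "0 \<le> A"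
    using K1 B0 r_pos by (auto simp: T_def lam_def A_def)
  show "finite J" by (rule finite_J)
  show "k \<notin> J \<Longrightarrow> L k t = 0" for k t by (simp add: L_def \<beta>_outside zero_prod_def)
  show "norm (L k t) \<le> B0 * norm (wv k) * exp (- (norm (wv k))\<^sup>2 * t)" for k t
  proof -
    have "B0 / 2 * norm (wv k) = (B0 * norm (wv k)) / 2" "0 \<le> B0 * norm (wv k)" using B0 by simp_all
    then have "norm (\<beta> k) \<le> B0 * norm (wv k)" using norm_\<beta>[of k] by linarith
    from mult_left_mono[OF this, of "exp (- (norm (wv k))\<^sup>2 * t)"] show ?thesis
      by (simp add: L_def norm_Pair ac_simps)
  qed
  show "continuous_on {0..T} (L k)" for k unfolding L_def by (intro continuous_intros)
  show "t \<in> {0..T} \<Longrightarrow> norm (duhamel ((norm (wv k))\<^sup>2) (\<lambda>s. \<Sum>\<^sub>\<infinity>j. mhd_form k (L j s) (L (k - j) s)) t) \<le> c1 k" for k t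
    by (rule source_le)
  show "1 \<le> W k" for k by (rule W_ge1)
  show "W k \<le> W j * W (k - j)" for k j by (rule W_mult)
  show "j \<in> J \<Longrightarrow> W j \<le> 4" for j by (rule W_J)
  show "nonneg_summable (\<lambda>k. W k * c1 k)" "(\<Sum>\<^sub>\<infinity>k. W k * c1 k) \<le> A" by (rule c1_sum)+
  show "32 * B0 * real (card J) \<le> sqrt lam" using B0 by (simp add: lam_def card_J)
  show "16 * exp (lam * real (card J)) * sqrt T * A \<le> 1"
    using small K1 by (simp add: lam_def card_J T_def A_def real_sqrt_divide)
qed

sublocale mode_equation mhd_form L J B0 lam T A W c1
  by (rule mode_equation_data)

end

section \<open>Besov norms\<close>

lemma norm_fst_snd_le: "norm (fst z) \<le> norm z" "norm (snd z) \<le> norm z"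
  by (metis norm_fst_le norm_snd_le prod.collapse)+

lemma Linfty_norm_le:
  assumes "continuous_on UNIV f" "\<And>x. norm (f x) \<le> C"
  shows "Linfty_norm f \<le> ennreal C"
proof -
  have [measurable]: "f \<in> borel_measurable borel" using assms(1) by (rule borel_measurable_continuous_onI)
  show ?thesis unfolding Linfty_norm_def
    by (rule esssup_I) (use assms(2) in \<open>auto intro!: AE_I2 ennreal_leI\<close>)
qed

text \<open>A nonempty open set is not negligible, so a lower bound on it is seen by the essential
  supremum.\<close>

lemma Linfty_norm_ge:
  assumes U: "open U" "U \<noteq> {}" and f: "\<And>x. x \<in> U \<Longrightarrow> C \<le> norm (f x)"
  shows "ennreal C \<le> Linfty_norm f"
proof (rule ccontr)
  assume "\<not> ennreal C \<le> Linfty_norm f"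
  then have lt: "esssup lborel (\<lambda>x. ennreal (norm (f x))) < ennreal C" by (simp add: Linfty_norm_def)
  have "AE x in lborel. ennreal (norm (f x)) \<le> esssup lborel (\<lambda>x. ennreal (norm (f x)))"
    by (rule esssup_AE)
  then have "AE x in lborel. x \<notin> U"
  proof (rule AE_mp, intro AE_I2 impI notI)
    fix x assume "ennreal (norm (f x)) \<le> esssup lborel (\<lambda>x. ennreal (norm (f x)))" "x \<in> U"
    with lt ennreal_leI[OF f[OF \<open>x \<in> U\<close>]] show False by (meson leD le_less_trans)
  qed
  then have "U \<in> null_sets lborel" using U(1) by (subst (asm) AE_iff_null_sets[symmetric]) auto
  then have "negligible U" by (simp add: negligible_iff_null_sets null_sets_completionI)
  with open_not_negligible[OF U] show False by blast
qed

lemma mult_exp_minus_square_le: "x * exp (- x\<^sup>2) \<le> (1 :: real)"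
proof -
  have "x \<le> 1 + x\<^sup>2" using zero_le_power2[of "x - 1 / 2"] by (simp add: power2_eq_square algebra_simps)
  also have "\<dots> \<le> exp (x\<^sup>2)" by (rule exp_ge_add_one_self)
  finally show ?thesis by (simp add: exp_minus field_simps)
qed

text \<open>With \<open>x = sqrt \<tau> * norm (wv k)\<close> this is
  \<open>x * exp (- x\<^sup>2) \<le> 1\<close>: a Besov norm of order -1 absorbs one derivative,
  uniformly in \<tau>.\<close>

lemma heat_weight_le: "0 < \<tau> \<Longrightarrow> sqrt \<tau> * norm (wv k) * exp (- \<tau> * (norm (wv k))\<^sup>2) \<le> 1"
  using mult_exp_minus_square_le[of "sqrt \<tau> * norm (wv k)"] by (simp add: power_mult_distrib)

lemma scaled_heat_trig_le:
  assumes \<phi>: "\<phi> = sin \<or> \<phi> = cos" and \<tau>: "0 < \<tau>" and s: "(\<lambda>k. norm (\<alpha> k)) summable_on UNIV"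
    and m: "\<And>k. sqrt \<tau> * (exp (- \<tau> * (norm (wv k))\<^sup>2) * norm (\<alpha> k)) \<le> m k" "m summable_on UNIV"
  shows "ennreal (\<tau> powr (1 / 2)) * Linfty_norm (heat_semigroup \<tau> (trig \<phi> \<alpha>)) \<le> ennreal (\<Sum>\<^sub>\<infinity>k. m k)"
proof -
  let ?g = "\<lambda>k. exp (- \<tau> * (norm (wv k))\<^sup>2) *\<^sub>R \<alpha> k"
  have b: "\<bar>\<phi> y\<bar> \<le> 1" and c: "continuous_on UNIV \<phi>" for y
    using \<phi> by (auto intro!: continuous_intros)
  have h: "heat_semigroup \<tau> (trig \<phi> \<alpha>) = trig \<phi> ?g"
    using heat_semigroup_trig[OF \<phi> \<tau> s] by blast
  have sg: "(\<lambda>k. norm (?g k)) summable_on UNIV"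
    by (rule summable_norm_bound(2)[OF s]) (rule norm_scaleR_le, use \<tau> in simp)
  have n: "norm (trig \<phi> ?g x) \<le> (\<Sum>\<^sub>\<infinity>k. norm (?g k))" for x
    by (rule trig_summable(2)[OF b sg order_refl])
  have "sqrt \<tau> * (\<Sum>\<^sub>\<infinity>k. norm (?g k)) = (\<Sum>\<^sub>\<infinity>k. sqrt \<tau> * norm (?g k))"
    by (rule infsum_cmult_right'[symmetric])
  also have "\<dots> \<le> (\<Sum>\<^sub>\<infinity>k. m k)"
    using m(1) by (intro infsum_mono summable_on_cmult_right sg m(2)) simp
  finally have le: "sqrt \<tau> * (\<Sum>\<^sub>\<infinity>k. norm (?g k)) \<le> (\<Sum>\<^sub>\<infinity>k. m k)" .
  have "ennreal (\<tau> powr (1 / 2)) * Linfty_norm (heat_semigroup \<tau> (trig \<phi> \<alpha>)) \<le> ennreal (sqrt \<tau>) * ennreal (\<Sum>\<^sub>\<infinity>k. norm (?g k))"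
    unfolding h using \<tau> n by (intro mult_mono Linfty_norm_le trig_continuous c b sg) (auto simp: powr_half_sqrt)
  also have "\<dots> = ennreal (sqrt \<tau> * (\<Sum>\<^sub>\<infinity>k. norm (?g k)))"
    using \<tau> by (intro ennreal_mult[symmetric] infsum_nonneg) auto
  also have "\<dots> \<le> ennreal (\<Sum>\<^sub>\<infinity>k. m k)" by (rule ennreal_leI[OF le])
  finally show ?thesis .
qed

section \<open>The solution for the given data\<close>

context mhd_data begin

text \<open>The bound from \<open>solution_remainder\<close>; since
  \<open>T = 1 / K\<^sup>2\<close>, it is of order \<open>1 / K\<close> for fixed \<open>B0\<close>
  and \<open>card S\<close>.\<close>

definition "Rem = 32 * B0 * ET * real (card J) * A / K + 8 * ET\<^sup>2 * T * A\<^sup>2"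

lemma \<beta>_summable: "(\<lambda>k. norm (\<beta> k)) summable_on UNIV"
  by (rule finite_nonzero_values_imp_summable_on, rule finite_subset[OF _ finite_J]) (use \<beta>_outside in force)

text \<open>The four waves belonging to \<open>m\<close> have norms at most \<open>m\<close>,
  \<open>m\<close>, \<open>2 * m\<close>, \<open>2 * m\<close> and at least \<open>m\<close>. With
  the amplitude \<open>B0 / 2\<close> this gives \<open>3 * B0\<close>, and \<open>lacunary\<close>
  contributes the factor 4, independently of the number of waves.\<close>

lemma data_heat_le:
  assumes \<tau>: "0 < \<tau>"
  shows "(\<lambda>k. sqrt \<tau> * (exp (- \<tau> * (norm (wv k))\<^sup>2) * norm (\<beta> k))) summable_on UNIV"
    "(\<Sum>\<^sub>\<infinity>k. sqrt \<tau> * (exp (- \<tau> * (norm (wv k))\<^sup>2) * norm (\<beta> k))) \<le> 12 * B0"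
proof -
  let ?f = "\<lambda>k. sqrt \<tau> * (exp (- \<tau> * (norm (wv k))\<^sup>2) * norm (\<beta> k))"
  let ?g = "\<lambda>k. B0 / 2 * (sqrt \<tau> * (exp (- \<tau> * (norm (wv k))\<^sup>2) * norm (wv k)))"
  show "?f summable_on UNIV"
    by (rule finite_nonzero_values_imp_summable_on, rule finite_subset[OF _ finite_J]) (use \<beta>_outside in force)
  have "(\<Sum>\<^sub>\<infinity>k. ?f k) = (\<Sum>k\<in>J. ?f k)"
    using infsum_cong_neutral[of UNIV J ?f ?f] \<beta>_outside finite_J by simp
  also have "\<dots> \<le> (\<Sum>k\<in>J. ?g k)"
  proof (rule sum_mono)
    fix k
    have "sqrt \<tau> * (exp (- \<tau> * (norm (wv k))\<^sup>2) * norm (\<beta> k)) \<le> sqrt \<tau> * (exp (- \<tau> * (norm (wv k))\<^sup>2) * (B0 / 2 * norm (wv k)))"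
      using \<tau> by (intro mult_left_mono norm_\<beta>) auto
    then show "?f k \<le> ?g k" by (simp add: ac_simps)
  qed
  also have "\<dots> = (\<Sum>m\<in>S. ?g (m, 0) + ?g (- m, 0) + ?g (m, - 1) + ?g (- m, 1))"
    by (rule sum_J)
  also have "\<dots> \<le> (\<Sum>m\<in>S. 3 * B0 * (sqrt \<tau> * of_int m * exp (- (of_int m)\<^sup>2 * \<tau>)))"
  proof (rule sum_mono)
    fix m assume m: "m \<in> S"
    let ?X = "sqrt \<tau> * of_int m * exp (- (of_int m)\<^sup>2 * \<tau>)"
    have m1: "1 \<le> m" by (rule S1[OF m])
    have g: "?g k \<le> B0 / 2 * (c * ?X)" if "norm (wv k) \<le> c * of_int m" "(of_int m)\<^sup>2 \<le> (norm (wv k))\<^sup>2" for k and c :: real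
    proof -
      have "exp (- \<tau> * (norm (wv k))\<^sup>2) * norm (wv k) \<le> exp (- (of_int m)\<^sup>2 * \<tau>) * (c * of_int m)"
        using that \<tau> by (intro mult_mono) (auto simp: mult.commute)
      then have "B0 / 2 * (sqrt \<tau> * (exp (- \<tau> * (norm (wv k))\<^sup>2) * norm (wv k))) \<le> B0 / 2 * (sqrt \<tau> * (exp (- (of_int m)\<^sup>2 * \<tau>) * (c * of_int m)))"
        using B0 \<tau> by (intro mult_left_mono) auto
      then show ?thesis by (simp add: ac_simps)
    qed
    have n0: "norm (wv (m, 0)) = of_int m" "norm (wv (- m, 0)) = of_int m"
      using m1 norm_wv_sq[of "(m, 0)"] norm_wv_sq[of "(- m, 0)"] by (simp_all add: power2_eq_iff_nonneg)
    have n1: "norm (wv (m, - 1)) \<le> 2 * of_int m" "norm (wv (- m, 1)) \<le> 2 * of_int m"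
      using norm_wv_le[of "(m, - 1)"] norm_wv_le[of "(- m, 1)"] m1 by auto
    have "?g (m, 0) + ?g (- m, 0) + ?g (m, - 1) + ?g (- m, 1)
        \<le> B0 / 2 * (1 * ?X) + B0 / 2 * (1 * ?X) + B0 / 2 * (2 * ?X) + B0 / 2 * (2 * ?X)"
      by (intro add_mono g) (use n0 n1 in \<open>auto simp: norm_wv_sq\<close>)
    also have "\<dots> = 3 * B0 * ?X" by simp
    finally show "?g (m, 0) + ?g (- m, 0) + ?g (m, - 1) + ?g (- m, 1) \<le> 3 * B0 * ?X" .
  qed
  also have "\<dots> = 3 * B0 * (\<Sum>m\<in>S. sqrt \<tau> * of_int m * exp (- (of_int m)\<^sup>2 * \<tau>))"
    by (rule sum_distrib_left[symmetric])
  also have "\<dots> \<le> 3 * B0 * 4" using B0 by (intro mult_left_mono lacunary \<tau>) auto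
  finally show "(\<Sum>\<^sub>\<infinity>k. ?f k) \<le> 12 * B0" by simp
qed

lemma data_hom_besov: "hom_besov_norm (trig cos \<beta>) \<le> ennreal (12 * B0)"
  unfolding hom_besov_norm_def
proof (rule SUP_least)
  fix \<tau> :: real assume "\<tau> \<in> {0<..}"
  then have \<tau>: "0 < \<tau>" by simp
  show "ennreal (\<tau> powr (1 / 2)) * Linfty_norm (heat_semigroup \<tau> (trig cos \<beta>)) \<le> ennreal (12 * B0)"
    by (rule order_trans[OF scaled_heat_trig_le[OF _ \<tau> \<beta>_summable order_refl data_heat_le(1)[OF \<tau>]] ennreal_leI[OF data_heat_le(2)[OF \<tau>]]]) simp
qed

section \<open>The first Picard iterate and its resonant mode\<close>

abbreviation "X k \<equiv> duhamel (q k) (cnv k L L)"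

lemma cnv_LL: "cnv k L L s = (\<Sum>j\<in>{j \<in> J. k - j \<in> J}.
     exp (- ((norm (wv j))\<^sup>2 + (norm (wv (k - j)))\<^sup>2) * s) *\<^sub>R (leray k ((\<beta> j \<bullet> wv k) *\<^sub>R \<beta> (k - j)), 0))"
  unfolding cnv_def by (rule self_interaction)

lemma cnv_LL_cont: "continuous_on {0..T} (cnv k L L)"
  by (rule cnv_cont[OF adm_L adm_L wsm_cL wsm_cL])

lemma snd_X: "t \<in> {0..T} \<Longrightarrow> snd (X k t) = 0"
  using duhamel_linear[OF bounded_linear_snd _ cnv_LL_cont, of t "q k" k]
  by (simp add: cnv_LL snd_sum duhamel_def)

lemma norm_X_le: "t \<in> {0..T} \<Longrightarrow> norm (X k t) \<le> c1 k"
  using source[of t k] by (simp add: cnv_def[abs_def])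

text \<open>Below frequency \<open>K\<close> the interacting pairs are the resonant ones, and these
  meet at \<open>(0, 1)\<close> or \<open>(0, - 1)\<close>.\<close>

lemma X_eq_0:
  assumes "k \<noteq> (0, 1)" "k \<noteq> (0, - 1)" "norm (wv k) < K"
  shows "X k t = 0"
proof -
  have "(\<beta> j \<bullet> wv k) = 0" if "j \<in> J" "k - j \<in> J" for j
  proof (rule ccontr)
    assume n: "\<beta> j \<bullet> wv k \<noteq> 0"
    have "K \<le> norm (wv k) \<or> (\<exists>m\<in>S. j = (- m, 1) \<and> k - j = (m, 0) \<or> j = (m, - 1) \<and> k - j = (- m, 0))"
      using resonance[OF that] n by simp
    then obtain m where "j = (- m, 1) \<and> k - j = (m, 0) \<or> j = (m, - 1) \<and> k - j = (- m, 0)"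
      using assms(3) by auto
    moreover have "k = j + (k - j)" by simp
    ultimately have "k = (0, 1) \<or> k = (0, - 1)" by (elim disjE conjE) (simp_all only: plus_prod_def, auto)
    with assms(1,2) show False by blast
  qed
  then have "(leray k ((\<beta> j \<bullet> wv k) *\<^sub>R \<beta> (k - j)), 0 :: real ^ 3) = 0" if "j \<in> J" "k - j \<in> J" for j
    using that by (simp add: linear_0[OF bounded_linear.linear[OF leray_bounded_linear]] zero_prod_def)
  then have "cnv k L L s = 0" for s unfolding cnv_LL by (intro sum.neutral) auto
  then show ?thesis by (simp add: duhamel_def)
qed

text \<open>The only pairs of waves that interact at the wave vector \<open>(0, 1, 0)\<close> are those with the same
  \<open>m \<in> S\<close>, and all of them push in the same direction.\<close>

lemma main_term: "B0\<^sup>2 * r / 144 \<le> fst (X (0, 1) T) $ 3"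
proof -
  let ?k = "(0, 1) :: mode"
  let ?p = "\<lambda>m::int. 2 * (of_int m)\<^sup>2 + (1 :: real)"
  define h where "h s = (\<Sum>m\<in>S. B0\<^sup>2 / 8 * (norm (wv (- m, 1)) * of_int m) * exp (- ?p m * s))" for s :: real
  have KS: "2 \<le> real_of_int m" if "m \<in> S" for m using K[OF that] K1 by linarith
  have e3: "wv ?k = axis 2 1" by (simp add: vec_eq_iff forall_3 axis_def)
  have h: "fst (cnv ?k L L s) $ 3 = h s" for s
  proof -
    let ?J = "{j \<in> J. ?k - j \<in> J}"
    let ?f = "\<lambda>j. exp (- ((norm (wv j))\<^sup>2 + (norm (wv (?k - j)))\<^sup>2) * s) * (leray ?k ((\<beta> j \<bullet> wv ?k) *\<^sub>R \<beta> (?k - j)) $ 3)"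
    have "fst (cnv ?k L L s) $ 3 = (\<Sum>j\<in>?J. ?f j)"
      by (simp add: cnv_LL fst_sum)
    also have "\<dots> = (\<Sum>j\<in>(\<lambda>m. (- m, 1)) ` S. ?f j)"
    proof (rule sum.mono_neutral_right)
      show "finite ?J" using finite_J by simp
      show "(\<lambda>m. (- m, 1)) ` S \<subseteq> ?J" by (auto simp: J_eq)
      show "\<forall>j\<in>?J - (\<lambda>m. (- m, 1)) ` S. ?f j = 0"
      proof
        fix j assume j: "j \<in> ?J - (\<lambda>m. (- m, 1)) ` S"
        have "\<beta> j \<bullet> wv ?k = 0"
        proof (rule ccontr)
          assume n: "\<beta> j \<bullet> wv ?k \<noteq> 0"
          have "K \<le> norm (wv ?k) \<or> (\<exists>m\<in>S. j = (- m, 1) \<and> ?k - j = (m, 0) \<or> j = (m, - 1) \<and> ?k - j = (- m, 0))"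
            using resonance[of j "?k - j"] j n by simp
          \<comment> \<open>Here \<open>norm (wv ?k) = 1 < K\<close>, and \<open>j\<close> was taken
            outside the image. The alternative left over contradicts
            \<open>?k - (m, - 1) = (- m, 2)\<close>.\<close>
          then have "\<exists>m\<in>S. j = (m, - 1) \<and> ?k - j = (- m, 0)" using j K1 by (auto simp: e3)
          then show False by auto
        qed
        then show "?f j = 0" by (simp add: leray_def)
      qed
    qed
    also have "\<dots> = (\<Sum>m\<in>S. ?f (- m, 1))" by (simp add: sum.reindex inj_on_def)
    also have "\<dots> = h s" unfolding h_def
    proof (rule sum.cong[OF refl])
      fix m assume m: "m \<in> S"
      have kj: "?k - (- m, 1) = (m, 0)" by simp
      have n0: "norm (wv (m, 0)) = of_int m"
        using KS[OF m] norm_wv_sq[of "(m, 0)"] by (simp add: power2_eq_iff_nonneg)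
      \<comment> \<open>The component of \<open>slanted\<close> along the mode \<open>(0, 1)\<close>
        is 1 / 2, so this factor is B0 / 4 times a norm. Multiplied by the B0 / 2 of the straight
        wave it gives the positive coefficient \<open>B0\<^sup>2 / 8\<close> for every
        \<open>m\<close>.\<close>
      have b1: "\<beta> (- m, 1) \<bullet> wv ?k = B0 / 4 * norm (wv (- m, 1))"
        using m by (simp add: \<beta>_def e3 inner_axis)
      have b2: "\<beta> (m, 0) = (B0 / 2 * of_int m) *\<^sub>R axis 3 1"
        using m S1[OF m] by (simp add: \<beta>_def n0)
      have pp: "(norm (wv (- m, 1)))\<^sup>2 + (norm (wv (m, 0)))\<^sup>2 = ?p m"
        by (simp add: norm_wv_sq)
      have l: "leray ?k (c *\<^sub>R axis 3 1) $ 3 = c" for c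
        by (simp add: leray_def e3 inner_axis axis_def)
      show "?f (- m, 1) = B0\<^sup>2 / 8 * (norm (wv (- m, 1)) * of_int m) * exp (- ?p m * s)"
        unfolding kj b1 b2 pp scaleR_scaleR l by (simp add: power2_eq_square)
    qed
    finally show ?thesis .
  qed
  have T0: "0 < T" "T \<le> 1" "T = 1 / K\<^sup>2" using pos(1) K1 one_le_power[of K 2] by (auto simp: T_def)
  have bl: "bounded_linear (\<lambda>z :: (real^3) \<times> (real^3). fst z $ 3)"
    by (intro bounded_linear_compose[OF bounded_linear_vec_nth] bounded_linear_fst)
  have X: "fst (X ?k T) $ 3 = integral {0..T} (\<lambda>s. exp (- q ?k * (T - s)) *\<^sub>R h s)"
    using duhamel_linear[OF bl _ cnv_LL_cont, of T "q ?k" ?k] T0 by (simp add: h duhamel_def)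
  \<comment> \<open>A lower bound for the integrand with an elementary antiderivative:
    \<open>norm (wv (- m, 1))\<close> is at least \<open>m\<close>, and the heat factor of the mode
    \<open>(0, 1)\<close> is at least \<open>exp (- 1) \<ge> 1 / 3\<close> on a time interval of
    length at most 1. Hence 24 = 8 * 3.\<close>
  define g where "g s = (\<Sum>m\<in>S. B0\<^sup>2 / 24 * (of_int m)\<^sup>2 * exp (- ?p m * s))" for s :: real
  define G where "G s = (\<Sum>m\<in>S. B0\<^sup>2 / 24 * (of_int m)\<^sup>2 * (- exp (- ?p m * s) / ?p m))" for s :: real
  have p0: "0 < ?p m" for m by (rule add_nonneg_pos) auto
  have "(g has_integral G T - G 0) {0..T}"
  proof (rule fundamental_theorem_of_calculus)
    fix s
    have d: "((\<lambda>s. - exp (- p * s) / p) has_real_derivative exp (- p * s)) (at s)" if "0 < p" for p :: real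
      using that by (auto intro!: derivative_eq_intros)
    have "(G has_real_derivative g s) (at s)"
      unfolding G_def g_def by (intro DERIV_sum DERIV_cmult d p0)
    then show "(G has_vector_derivative g s) (at s within {0..T})"
      by (simp add: has_real_derivative_iff_has_vector_derivative has_vector_derivative_at_within)
  qed (use T0 in simp)
  moreover have "((\<lambda>s. exp (- q ?k * (T - s)) *\<^sub>R h s) has_integral fst (X ?k T) $ 3) {0..T}"
    unfolding X h_def by (intro integrable_integral integrable_continuous_interval continuous_intros)
  ultimately have "G T - G 0 \<le> fst (X ?k T) $ 3"
  proof (rule has_integral_le)
    fix s assume s: "s \<in> {0..T}"
    have "exp (- 1) \<le> exp (- q ?k * (T - s))" using s T0(1,2) by (simp add: e3)
    moreover have "1 / 3 \<le> exp (- 1 :: real)" using e_less_272 by (simp add: exp_minus field_simps)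
    ultimately have e: "1 / 3 \<le> exp (- q ?k * (T - s))" by linarith
    have "g s = (\<Sum>m\<in>S. 1 / 3 * (B0\<^sup>2 / 8 * (of_int m * of_int m) * exp (- ?p m * s)))"
      unfolding g_def by (intro sum.cong refl) (simp add: power2_eq_square)
    also have "\<dots> \<le> (\<Sum>m\<in>S. exp (- q ?k * (T - s)) * (B0\<^sup>2 / 8 * (norm (wv (- m, 1)) * of_int m) * exp (- ?p m * s)))"
    proof (intro sum_mono mult_mono e order_refl mult_nonneg_nonneg)
      fix m assume "m \<in> S"
      then show "of_int m \<le> norm (wv (- m, 1))" using norm_wv_ge[of "(- m, 1)"] by simp
    qed (use KS in force)+
    also have "\<dots> = exp (- q ?k * (T - s)) *\<^sub>R h s" by (simp add: h_def sum_distrib_left)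
    finally show "g s \<le> exp (- q ?k * (T - s)) *\<^sub>R h s" .
  qed
  moreover have "B0\<^sup>2 * r / 144 \<le> G T - G 0"
  proof -
    \<comment> \<open>The constant is 144 = 24 * 6, where 1 / 6 is the product of
      \<open>m\<^sup>2 / (2 * m\<^sup>2 + 1) \<ge> 1 / 3\<close> and
      \<open>1 - exp (- ?p m * T) \<ge> 1 / 2\<close>. The second bound explains
      \<open>T = 1 / K\<^sup>2\<close>: this is at least one decay time even for the slowest
      pair.\<close>
    have "(\<Sum>m\<in>S. B0\<^sup>2 / 24 * (1 / 6)) \<le> (\<Sum>m\<in>S. B0\<^sup>2 / 24 * ((of_int m)\<^sup>2 * ((1 - exp (- ?p m * T)) / ?p m)))"
    proof (intro sum_mono mult_left_mono)
      fix m assume m: "m \<in> S"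
      have "K\<^sup>2 \<le> (of_int m)\<^sup>2" using K[OF m] K1 by (intro power_mono) auto
      then have "T * K\<^sup>2 \<le> T * ?p m" using T0 by (intro mult_left_mono) auto
      moreover have "T * K\<^sup>2 = 1" using K1 T0(3) by simp
      ultimately have "1 \<le> ?p m * T" by (simp add: mult.commute)
      then have "exp (- ?p m * T) \<le> exp (- 1)" unfolding exp_le_cancel_iff by linarith
      moreover have "exp (- 1 :: real) \<le> 1 / 2" using exp_ge_add_one_self[of 1] by (simp add: exp_minus field_simps)
      ultimately have "1 / 2 \<le> 1 - exp (- ?p m * T)" by linarith
      moreover have "1 / 3 \<le> (of_int m)\<^sup>2 / ?p m"
        using KS[OF m] one_le_power[of "real_of_int m" 2] p0[of m] by (simp add: divide_simps)
      ultimately have "1 / 3 * (1 / 2) \<le> (of_int m)\<^sup>2 / ?p m * (1 - exp (- ?p m * T))"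
        using p0[of m] by (intro mult_mono) auto
      then show "1 / 6 \<le> (of_int m)\<^sup>2 * ((1 - exp (- ?p m * T)) / ?p m)" by simp
    qed auto
    also have "\<dots> = G T - G 0"
      unfolding G_def sum_subtractf[symmetric] by (intro sum.cong refl) (simp add: right_diff_distrib diff_divide_distrib)
    finally show ?thesis by (simp add: mult.commute)
  qed
  ultimately show ?thesis by linarith
qed

end

context mhd_data begin

text \<open>The first iterate has no magnetic part, so \<open>b\<close> deviates from its free
  evolution by the remainder only. In the lower bound 432 = 144 * 3, the 3 coming from the heat flow
  at time 1. One \<open>Rem\<close> covers the error at the mode \<open>(0, 1)\<close>, the other
  that of all remaining modes, where the first iterate costs \<open>A / K\<close>.\<close>

theorem data_solution:
  obtains u b p where "mhd_solution T u b p" "\<And>x. u 0 x = 0" "\<And>x. b 0 x = trig cos \<beta> x"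
    "\<And>t. t \<in> {0..T} \<Longrightarrow> besov_norm (b t) \<le> ennreal (12 * B0 + Rem)"
    "ennreal (B0\<^sup>2 * r / 432 - A / K - 2 * Rem) \<le> hom_besov_norm (u T)"
proof -
  obtain w c where w: "adm w c" "wsm c" "nrm c \<le> 2 * A" "\<And>k t. t \<in> {0..T} \<Longrightarrow> w k t = Phi w k t"
    and lim: "\<And>k t. t \<in> {0..T} \<Longrightarrow> (\<lambda>n. ws n k t) \<longlonglongrightarrow> w k t"
    by (rule mode_solution) blast
  have K0: "0 < K" using K1 by linarith
  obtain \<rho> where \<rho>: "nonneg_summable \<rho>" "(\<Sum>\<^sub>\<infinity>k. \<rho> k) \<le> Rem"
    "\<And>k t. t \<in> {0..T} \<Longrightarrow> norm (w k t + X k t) \<le> norm (wv k) * \<rho> k"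
    using solution_remainder[OF w K0 J_norm_ge] unfolding Rem_def by metis
  have \<rho>0: "0 \<le> \<rho> k" and \<rho>s: "\<rho> summable_on UNIV" for k using \<rho>(1) unfolding nonneg_summable_def by blast+
  define z where "z k t = L k t + w k t" for k t
  define c' where "c' k = cL k + c k" for k
  have z: "adm z c'" and wc': "wsm c'"
    unfolding z_def[abs_def] c'_def[abs_def] by (rule adm_add[OF adm_L w(1)], rule wsm_add[OF wsm_cL w(2)])
  define a where "a k t = fst (z k t)" for k t
  define b where "b k t = snd (z k t)" for k t
  define m where "m k = c' k * E T" for k
  have T0: "0 < T" by (rule pos(1))
  have z_le: "norm (z k t) \<le> m k" if t: "t \<in> {0..T}" for k t
  proof -
    have "c' k * E t \<le> c' k * E T" using t wsmD(1)[OF wc'] by (intro mult_left_mono E_mono) auto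
    then show ?thesis using admD(2)[OF z t, of k] by (simp add: m_def)
  qed
  have w_z: "w k t = - duhamel (q k) (cnv k z z) t" if "t \<in> {0..T}" for k t
    using w(4)[OF that, of k] by (simp add: Phi_def z_def[abs_def])
  have cz: "continuous_on {0..T} (cnv k z z)" for k by (rule cnv_cont[OF z z wc' wc'])
  have terms: "(\<lambda>j. mhd_form k (z j t) (z (k - j) t)) summable_on UNIV" if "t \<in> {0..T}" for k t
    by (rule cnv_terms(1)[OF z z wc' wc' that])
  have cnv_linear: "l (cnv k z z t) = (\<Sum>\<^sub>\<infinity>j. l (mhd_form k (z j t) (z (k - j) t)))"
    if "bounded_linear l" "t \<in> {0..T}" for l :: "_ \<Rightarrow> 'y::real_normed_vector" and k t
    unfolding cnv_def by (rule infsumI[OF has_sum_bounded_linear[OF that(1) has_sum_infsum[OF terms[OF that(2)]]], symmetric])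
  \<comment> \<open>A linear constraint satisfied by the free evolution and by the nonlinearity is
    inherited by the solution through the Duhamel formula. It is used for the two divergence
    conditions.\<close>
  have zero: "l (z k t) = 0" if l: "bounded_linear l" and t: "t \<in> {0..T}" and "l (L k t) = 0"
    "\<And>s. s \<in> {0..T} \<Longrightarrow> l (cnv k z z s) = 0" for l :: "_ \<Rightarrow> real" and k t
  proof -
    have "l (duhamel (q k) (cnv k z z) t) = duhamel (q k) (\<lambda>s. l (cnv k z z s)) t"
      by (rule duhamel_linear[OF l t cz])
    also have "\<dots> = duhamel (q k) (\<lambda>_. 0) t" by (rule duhamel_cong) (use t that(4) in auto)
    finally show ?thesis using that(3) w_z[OF t, of k]
      by (simp add: z_def duhamel_def linear_add[OF bounded_linear.linear[OF l]] linear_neg[OF bounded_linear.linear[OF l]] linear_diff[OF bounded_linear.linear[OF l]])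
  qed
  have form_summable: "(\<lambda>j. (fst (z j t) \<bullet> wv k) *\<^sub>R fst (z (k - j) t) + (snd (z j t) \<bullet> wv k) *\<^sub>R snd (z (k - j) t)) summable_on UNIV"
    if t: "t \<in> {0..T}" for k t
  proof (rule summable_norm_bound(1))
    have "nonneg_summable m" unfolding m_def[abs_def] using wsmD(2)[OF wc'] E_pos[of T]
      unfolding nonneg_summable_def by (auto intro!: summable_on_cmult_left)
    then show "(\<lambda>j. 2 * (norm (wv k) * (m j * m (k - j)))) summable_on UNIV"
      by (intro summable_on_cmult_right cv_term_summable)
    fix j
    have t: "norm ((x \<bullet> wv k) *\<^sub>R y) \<le> norm (wv k) * (m j * m (k - j))" if "norm x \<le> m j" "norm y \<le> m (k - j)" for x y :: "real ^ 3"
    proof -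
      have "\<bar>x \<bullet> wv k\<bar> * norm y \<le> (m j * norm (wv k)) * m (k - j)"
        using order_trans[OF norm_ge_zero that(1)]
        by (intro mult_mono that order_trans[OF Cauchy_Schwarz_ineq2 mult_right_mono[OF that(1)]]) auto
      then show ?thesis by (simp add: ac_simps)
    qed
    show "norm ((fst (z j t) \<bullet> wv k) *\<^sub>R fst (z (k - j) t) + (snd (z j t) \<bullet> wv k) *\<^sub>R snd (z (k - j) t)) \<le> 2 * (norm (wv k) * (m j * m (k - j)))"
      unfolding mult_2 using \<open>t \<in> {0..T}\<close>
      by (intro norm_triangle_le add_mono t order_trans[OF norm_fst_snd_le(1) z_le] order_trans[OF norm_fst_snd_le(2) z_le])
  qed
  have zder: "(z k has_vector_derivative - q k *\<^sub>R z k t - cnv k z z t) (at t within {0..T})" if t: "t \<in> {0..T}" for k t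
  proof -
    have "((\<lambda>t. exp (- q k * t) *\<^sub>R \<beta> k) has_vector_derivative (- q k * exp (- q k * t)) *\<^sub>R \<beta> k) (at t within {0..T})"
      by (auto intro!: derivative_eq_intros simp: has_vector_derivative_def)
    then have "(L k has_vector_derivative - q k *\<^sub>R L k t) (at t within {0..T})"
      unfolding L_def[abs_def] by (auto intro!: derivative_eq_intros has_vector_derivative_Pair)
    from solution_ode[OF w(1,2,4) this t] show ?thesis by (simp add: z_def[abs_def])
  qed
  interpret sol: mhd_modes T a b m
  proof
    show "0 < T" by (rule T0)
    \<comment> \<open>Since \<open>R \<ge> 1\<close>, the quadratic weight exceeds \<open>W\<close>
      by at most the constant \<open>R\<^sup>2\<close>, so summability with \<open>W\<close> yields
      two derivatives.\<close>
    have e: "(1 + norm (wv k))\<^sup>2 * m k \<le> R\<^sup>2 * E T * (W k * c' k)" for k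
    proof -
      have "1 + norm (wv k) \<le> R * (1 + norm (wv k) / R)" using R1 by (simp add: distrib_left)
      then have "(1 + norm (wv k))\<^sup>2 \<le> R\<^sup>2 * W k"
        unfolding W_def power_mult_distrib[symmetric] by (intro power_mono) auto
      from mult_right_mono[OF this, of "c' k * E T"] wsmD(1)[OF wc', of k] E_pos[of T]
      show ?thesis by (simp add: m_def ac_simps)
    qed
    have m0: "0 \<le> m k" for k using order_trans[OF norm_ge_zero z_le[of 0 k]] T0 by auto
    show "(\<lambda>k. (1 + norm (wv k))\<^sup>2 * m k) summable_on UNIV"
      by (rule summable_norm_bound(1)[of "\<lambda>k. R\<^sup>2 * E T * (W k * c' k)"])
         (use e m0 wc' in \<open>auto simp: abs_mult wsm_def nonneg_summable_def intro!: summable_on_cmult_right\<close>)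
    show "norm (a k t) \<le> m k" "norm (b k t) \<le> m k" if "t \<in> {0..T}" for k t
      using order_trans[OF norm_fst_snd_le(1) z_le[OF that]] order_trans[OF norm_fst_snd_le(2) z_le[OF that]] by (simp_all add: a_def b_def)
    have Lp: "L (- k) t = parity (L k t)" for k t by (simp add: L_def parity_def \<beta>_even wv_minus)
    have "z (- k) t = parity (z k t)" if "t \<in> {0..T}" for k t
    proof -
      have "w (- k) t = parity (w k t)"
        by (rule solution_symmetric[OF lim parity_linear mhd_form_parity Lp that])
      then show ?thesis by (simp add: z_def Lp parity_def)
    qed
    then show "a (- k) t = - a k t" "b (- k) t = b k t" if "t \<in> {0..T}" for k t
      using that by (simp_all add: a_def b_def parity_def)
    show "wv k \<bullet> a k t = 0" if t: "t \<in> {0..T}" for k t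
    proof -
      have bl: "bounded_linear (\<lambda>x :: (real^3) \<times> (real^3). wv k \<bullet> fst x)"
        by (intro bounded_linear_compose[OF bounded_linear_inner_right] bounded_linear_fst)
      show ?thesis unfolding a_def
        by (rule zero[OF bl t]) (simp_all add: L_def cnv_linear[OF bl] mhd_form_def leray_orth)
    qed
    show "wv k \<bullet> b k t = 0" if t: "t \<in> {0..T}" for k t
    proof -
      have bl: "bounded_linear (\<lambda>x :: (real^3) \<times> (real^3). wv k \<bullet> snd x)"
        by (intro bounded_linear_compose[OF bounded_linear_inner_right] bounded_linear_snd)
      have bij: "bij (\<lambda>j. k - j)" by (rule bij_betw_byWitness[where f' = "\<lambda>j. k - j"]) auto
      have "wv k \<bullet> snd (cnv k z z s) = 0" if s: "s \<in> {0..T}" for s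
      proof -
        let ?F = "\<lambda>j. wv k \<bullet> snd (mhd_form k (z j s) (z (k - j) s))"
        \<comment> \<open>The longitudinal part of the magnetic nonlinearity is antisymmetric under
          \<open>j \<mapsto> k - j\<close>, so its sum equals its own negative.\<close>
        have "(\<Sum>\<^sub>\<infinity>j. ?F (k - j)) = (\<Sum>\<^sub>\<infinity>j. - ?F j)"
          by (intro infsum_cong) (simp add: mhd_form_def inner_diff_right inner_commute)
        then have "(\<Sum>\<^sub>\<infinity>j. ?F j) = - (\<Sum>\<^sub>\<infinity>j. ?F j)"
          using infsum_reindex_bij_betw[OF bij, of ?F] by (simp only: infsum_uminus)
        then show ?thesis by (simp add: cnv_linear[OF bl s])
      qed
      then show ?thesis unfolding b_def
        by (intro zero[OF bl t]) (simp_all add: L_def \<beta>_div)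
    qed
    fix k t assume t: "t \<in> {0..T}"
    let ?H = "\<lambda>j. (a j t \<bullet> wv k) *\<^sub>R a (k - j) t + (b j t \<bullet> wv k) *\<^sub>R b (k - j) t"
    have "fst (cnv k z z t) = (\<Sum>\<^sub>\<infinity>j. leray k (?H j))"
      by (simp add: cnv_linear[OF bounded_linear_fst t] mhd_form_def a_def b_def)
    also have "\<dots> = leray k (\<Sum>\<^sub>\<infinity>j. ?H j)"
      using form_summable[OF t, of k] unfolding a_def b_def
      by (intro infsumI has_sum_bounded_linear[OF leray_bounded_linear] has_sum_infsum)
    finally have 1: "fst (cnv k z z t) = leray k (\<Sum>\<^sub>\<infinity>j. ?H j)" .
    have 2: "snd (cnv k z z t) = (\<Sum>\<^sub>\<infinity>j. (a j t \<bullet> wv k) *\<^sub>R b (k - j) t - (b j t \<bullet> wv k) *\<^sub>R a (k - j) t)"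
      by (simp add: cnv_linear[OF bounded_linear_snd t] mhd_form_def a_def b_def)
    have "fst (- q k *\<^sub>R z k t - cnv k z z t) = - q k *\<^sub>R a k t - leray k (\<Sum>\<^sub>\<infinity>j. ?H j)"
      by (simp only: fst_diff fst_scaleR 1 a_def b_def)
    moreover have "snd (- q k *\<^sub>R z k t - cnv k z z t) = - q k *\<^sub>R b k t
      - (\<Sum>\<^sub>\<infinity>j. (a j t \<bullet> wv k) *\<^sub>R b (k - j) t - (b j t \<bullet> wv k) *\<^sub>R a (k - j) t)"
      by (simp only: snd_diff snd_scaleR 2 a_def b_def)
    moreover have "a k = (\<lambda>t. fst (z k t))" "b k = (\<lambda>t. snd (z k t))" by (simp_all add: fun_eq_iff a_def b_def)
    ultimately show "(a k has_vector_derivative - q k *\<^sub>R a k t - leray k (\<Sum>\<^sub>\<infinity>j. ?H j)) (at t within {0..T})"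
      "(b k has_vector_derivative - q k *\<^sub>R b k t
      - (\<Sum>\<^sub>\<infinity>j. (a j t \<bullet> wv k) *\<^sub>R b (k - j) t - (b j t \<bullet> wv k) *\<^sub>R a (k - j) t)) (at t within {0..T})"
      using bounded_linear.has_vector_derivative[OF bounded_linear_fst zder[OF t, of k]]
        bounded_linear.has_vector_derivative[OF bounded_linear_snd zder[OF t, of k]] by metis+
  qed
  have w0: "w k 0 = 0" for k using w_z[of 0 k] T0 by (simp add: duhamel_def)
  have bes: "besov_norm (trig cos (\<lambda>k. b k t)) \<le> ennreal (12 * B0 + Rem)" if t: "t \<in> {0..T}" for t
    unfolding besov_norm_def
  proof (rule SUP_least)
    fix \<tau> :: real assume "\<tau> \<in> {0<..<1}"
    then have \<tau>: "0 < \<tau>" by simp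
    let ?d = "\<lambda>k. sqrt \<tau> * (exp (- \<tau> * q k) * norm (\<beta> k))"
    have "ennreal (\<tau> powr (1 / 2)) * Linfty_norm (heat_semigroup \<tau> (trig cos (\<lambda>k. b k t))) \<le> ennreal (\<Sum>\<^sub>\<infinity>k. ?d k + \<rho> k)"
    proof (rule scaled_heat_trig_le[OF _ \<tau> sol.summable_b(1)[OF t]])
      show "(\<lambda>k. ?d k + \<rho> k) summable_on UNIV" by (intro summable_on_add data_heat_le(1) \<tau> \<rho>s)
      fix k
      \<comment> \<open>\<open>snd_X\<close> removes the first iterate from the magnetic
        component.\<close>
      have "norm (snd (w k t)) \<le> norm (wv k) * \<rho> k"
        using order_trans[OF norm_fst_snd_le(2)[of "w k t + X k t"] \<rho>(3)[OF t]] snd_X[OF t, of k] by simp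
      moreover have "norm (exp (- q k * t) *\<^sub>R \<beta> k) \<le> norm (\<beta> k)" by (rule norm_scaleR_le) (use t in simp)
      ultimately have "norm (b k t) \<le> norm (\<beta> k) + norm (wv k) * \<rho> k"
        unfolding b_def z_def L_def snd_add snd_conv by (intro norm_triangle_le add_mono)
      then have "sqrt \<tau> * (exp (- \<tau> * q k) * norm (b k t)) \<le> sqrt \<tau> * (exp (- \<tau> * q k) * (norm (\<beta> k) + norm (wv k) * \<rho> k))"
        using \<tau> by (intro mult_left_mono) auto
      also have "\<dots> = ?d k + (sqrt \<tau> * norm (wv k) * exp (- \<tau> * q k)) * \<rho> k"
        by (simp add: algebra_simps)
      also have "\<dots> \<le> ?d k + 1 * \<rho> k"
        by (intro add_left_mono mult_right_mono heat_weight_le \<tau> \<rho>0)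
      finally show "sqrt \<tau> * (exp (- \<tau> * q k) * norm (b k t)) \<le> ?d k + \<rho> k" by simp
    qed simp
    also have "(\<Sum>\<^sub>\<infinity>k. ?d k + \<rho> k) = (\<Sum>\<^sub>\<infinity>k. ?d k) + (\<Sum>\<^sub>\<infinity>k. \<rho> k)"
      by (rule infsum_add[OF data_heat_le(1)[OF \<tau>] \<rho>s])
    also have "ennreal \<dots> \<le> ennreal (12 * B0 + Rem)"
      by (intro ennreal_leI add_mono data_heat_le(2)[OF \<tau>] \<rho>(2))
    finally show "ennreal (\<tau> powr (1 / 2)) * Linfty_norm (heat_semigroup \<tau> (trig cos (\<lambda>k. b k t))) \<le> ennreal (12 * B0 + Rem)" .
  qed
  have low: "ennreal (B0\<^sup>2 * r / 432 - A / K - 2 * Rem) \<le> hom_besov_norm (trig sin (\<lambda>k. a k T))"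
  proof -
    have TT: "T \<in> {0..T}" using T0 by simp
    let ?F = "{(0, 1), (0, - 1)} :: mode set"
    \<comment> \<open>The Besov supremum is tested at heat time 1, where the modes in
      \<open>?F\<close> lose only the factor \<open>exp (- 1)\<close>.\<close>
    let ?e = "\<lambda>k. exp (- 1 * q k)"
    have a_w: "a k T = fst (w k T)" for k by (simp add: a_def z_def L_def)
    have aX: "norm (a k T) \<le> norm (X k T) + norm (wv k) * \<rho> k" for k
    proof -
      have "norm (w k T) \<le> norm (X k T) + norm (w k T + X k T)"
        using norm_triangle_ineq4[of "w k T + X k T" "X k T"] by simp
      with \<rho>(3)[OF TT, of k] norm_fst_snd_le(1)[of "w k T"] show ?thesis unfolding a_w by linarith
    qed
    \<comment> \<open>Majorant of all modes outside \<open>?F\<close>. There \<open>X\<close>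
      vanishes below frequency \<open>K\<close>, and from \<open>K\<close> on the heat factor is at
      most \<open>1 / K\<close>.\<close>
    define g where "g k = c1 k / K + \<rho> k" for k
    have wc1: "wsm c1" using c1_sum by (simp add: wsm_def)
    have sc1: "c1 summable_on UNIV" using wsmD(2)[OF wc1] unfolding nonneg_summable_def by blast
    have gs: "g summable_on UNIV"
      unfolding g_def[abs_def] divide_inverse by (intro summable_on_add summable_on_cmult_left sc1 \<rho>s)
    have "(\<Sum>\<^sub>\<infinity>k. g k) = (\<Sum>\<^sub>\<infinity>k. c1 k) / K + (\<Sum>\<^sub>\<infinity>k. \<rho> k)"
      unfolding g_def[abs_def] divide_inverse
      by (subst infsum_add) (auto simp: infsum_cmult_left' intro: summable_on_cmult_left sc1 \<rho>s)
    also have "\<dots> \<le> A / K + Rem"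
      using K0 order_trans[OF wsmD(3)[OF wc1] c1_sum(2)] by (intro add_mono divide_right_mono \<rho>(2)) auto
    finally have gA: "(\<Sum>\<^sub>\<infinity>k. g k) \<le> A / K + Rem" .
    have g0: "0 \<le> g k" for k using c1_nonneg[of k] \<rho>0[of k] K0 by (simp add: g_def)
    have eg: "?e k * norm (a k T) \<le> g k" if k: "k \<notin> ?F" for k
    proof -
      have "?e k * norm (X k T) \<le> c1 k / K"
      proof (cases "norm (wv k) < K")
        case True
        then have "X k T = 0" using k by (intro X_eq_0) auto
        then show ?thesis using c1_nonneg[of k] K0 by simp
      next
        case False
        then have "K\<^sup>2 \<le> q k" using K0 by (intro power_mono) auto
        moreover have "K \<le> K\<^sup>2" using K1 mult_left_mono[of 1 K K] by (simp add: power2_eq_square)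
        ultimately have "K \<le> exp (q k)" using exp_ge_add_one_self[of "q k"] by linarith
        then have "?e k \<le> 1 / K" using K0 by (simp add: exp_minus field_simps)
        then have "?e k * norm (X k T) \<le> 1 / K * c1 k"
          using K0 by (intro mult_mono norm_X_le TT) auto
        then show ?thesis by simp
      qed
      moreover have "?e k * (norm (wv k) * \<rho> k) \<le> 1 * \<rho> k"
        using mult_right_mono[OF heat_weight_le[of 1 k] \<rho>0[of k]] by (simp add: ac_simps)
      moreover have "?e k * norm (a k T) \<le> ?e k * (norm (X k T) + norm (wv k) * \<rho> k)"
        by (intro mult_left_mono aX) simp
      ultimately show ?thesis by (simp add: g_def distrib_left)
    qed
    have n1: "norm (wv (0, 1)) = 1" "norm (wv (0, - 1)) = 1"
      using norm_wv_sq[of "(0, 1)"] norm_wv_sq[of "(0, - 1)"] by (simp_all add: power2_eq_1_iff) (smt (verit) norm_ge_zero)+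
    have \<rho>R: "\<rho> k \<le> Rem" for k
      using finite_sum_le_infsum[OF \<rho>s, of "{k}"] \<rho>0 \<rho>(2) by simp
    have aM: "B0\<^sup>2 * r / 144 - Rem \<le> \<bar>a (0, 1) T $ 3\<bar>"
    proof -
      have "\<bar>(fst (w (0, 1) T + X (0, 1) T)) $ 3\<bar> \<le> \<rho> (0, 1)"
        using order_trans[OF component_le_norm_cart order_trans[OF norm_fst_snd_le(1) \<rho>(3)[OF TT, of "(0, 1)"]]] n1 by simp
      then have "\<bar>a (0, 1) T $ 3 + fst (X (0, 1) T) $ 3\<bar> \<le> Rem"
        using \<rho>R[of "(0, 1)"] by (simp add: a_w)
      with main_term show ?thesis by linarith
    qed
    let ?h = "heat_semigroup 1 (trig sin (\<lambda>k. a k T))"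
    have sa: "(\<lambda>k. norm (?e k *\<^sub>R a k T)) summable_on UNIV"
      by (rule summable_norm_bound(2)[OF sol.summable_a(1)[OF TT]]) (rule norm_scaleR_le, simp)
    have h: "?h x = trig sin (\<lambda>k. ?e k *\<^sub>R a k T) x" for x
      by (rule heat_semigroup_trig[OF _ _ sol.summable_a(1)[OF TT]]) auto
    \<comment> \<open>On this set \<open>2 * sin (x $ 2) > 1\<close>; it is open, as a lower bound
      for an essential supremum requires.\<close>
    define U where "U = {x :: real ^ 3. 1 / 2 < sin (x $ 2)}"
    have U: "open U" unfolding U_def by (intro open_Collect_less continuous_intros)
    have "axis 2 (pi / 2) \<in> U" by (simp add: U_def axis_def)
    then have U': "U \<noteq> {}" by blast
    have hU: "B0\<^sup>2 * r / 432 - A / K - 2 * Rem \<le> norm (?h x)" if x: "x \<in> U" for x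
    proof -
      let ?t = "\<lambda>k. sin (wv k \<bullet> x) * (?e k * a k T $ 3)"
      have ts: "?h x $ 3 = (\<Sum>\<^sub>\<infinity>k. ?t k)"
        unfolding h trig_bounded_linear[OF bounded_linear_vec_nth abs_sin_le_one sa] by (simp add: trig_def)
      let ?i = "\<lambda>k. if k \<in> ?F then ?t k else 0" and ?o = "\<lambda>k. if k \<in> ?F then 0 else ?t k"
      have ob: "norm (?o k) \<le> g k" for k
      proof (cases "k \<in> ?F")
        case False
        have "\<bar>sin (wv k \<bullet> x)\<bar> * \<bar>?e k * a k T $ 3\<bar> \<le> 1 * (?e k * norm (a k T))"
          by (intro mult_mono) (auto simp: abs_mult component_le_norm_cart)
        then have "norm (?t k) \<le> g k" using eg[OF False] unfolding real_norm_def abs_mult[of "sin _"] by linarith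
        then show ?thesis by (simp only: if_not_P[OF False])
      qed (simp add: g0)
      have i_sum: "?i summable_on UNIV" by (rule finite_nonzero_values_imp_summable_on, rule finite_subset[of _ ?F]) auto
      have "(\<Sum>\<^sub>\<infinity>k. ?t k) = (\<Sum>\<^sub>\<infinity>k. ?i k + ?o k)" by (intro infsum_cong) simp
      also have "\<dots> = (\<Sum>\<^sub>\<infinity>k. ?i k) + (\<Sum>\<^sub>\<infinity>k. ?o k)"
        by (rule infsum_add[OF i_sum summable_norm_bound(1)[OF gs ob]])
      also have "(\<Sum>\<^sub>\<infinity>k. ?i k) = (\<Sum>\<^sub>\<infinity>k\<in>?F. ?t k)" by (rule infsum_cong_neutral) auto
      also have "\<dots> = ?t (0, 1) + ?t (0, - 1)" by simp
      \<comment> \<open>Both the coefficient and the sine are odd, so the two modes of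
        \<open>?F\<close> add up instead of cancelling.\<close>
      also have "\<dots> = 2 * sin (x $ 2) * (exp (- 1) * a (0, 1) T $ 3)"
      proof -
        have "a (0, - 1) T = - a (0, 1) T" using sol.a_odd[OF TT, of "(0, 1)"] by simp
        then show ?thesis by (simp add: n1 inner_3)
      qed
      finally have e: "?h x $ 3 = 2 * sin (x $ 2) * (exp (- 1) * a (0, 1) T $ 3) + (\<Sum>\<^sub>\<infinity>k. ?o k)"
        unfolding ts .
      have o: "\<bar>\<Sum>\<^sub>\<infinity>k. ?o k\<bar> \<le> A / K + Rem"
        using order_trans[OF summable_norm_bound(3)[OF gs ob] gA] by (simp only: real_norm_def)
      have "1 / 3 * \<bar>a (0, 1) T $ 3\<bar> \<le> \<bar>2 * sin (x $ 2) * (exp (- 1) * a (0, 1) T $ 3)\<bar>"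
      proof -
        have "1 / 3 \<le> exp (- 1 :: real)" using e_less_272 by (simp add: exp_minus field_simps)
        then have "1 * (1 / 3) \<le> (2 * sin (x $ 2)) * exp (- 1)" using x by (intro mult_mono) (auto simp: U_def)
        then have "1 / 3 * \<bar>a (0, 1) T $ 3\<bar> \<le> ((2 * sin (x $ 2)) * exp (- 1)) * \<bar>a (0, 1) T $ 3\<bar>"
          by (intro mult_right_mono) auto
        also have "\<dots> = \<bar>2 * sin (x $ 2) * (exp (- 1) * a (0, 1) T $ 3)\<bar>"
          using x by (simp add: U_def abs_mult)
        finally show ?thesis .
      qed
      then have "1 / 3 * \<bar>a (0, 1) T $ 3\<bar> - (A / K + Rem) \<le> \<bar>?h x $ 3\<bar>" unfolding e using o by linarith
      moreover have "\<bar>?h x $ 3\<bar> \<le> norm (?h x)" by (rule component_le_norm_cart)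
      moreover have "0 \<le> Rem" using order_trans[OF \<rho>0 \<rho>R] .
      ultimately show ?thesis using aM by linarith
    qed
    have "ennreal (B0\<^sup>2 * r / 432 - A / K - 2 * Rem) \<le> ennreal (1 powr (1 / 2)) * Linfty_norm ?h"
      using Linfty_norm_ge[OF U U' hU] by simp
    also have "\<dots> \<le> hom_besov_norm (trig sin (\<lambda>k. a k T))"
      unfolding hom_besov_norm_def by (rule SUP_upper) simp
    finally show ?thesis .
  qed
  show thesis
  proof (rule that[OF sol.classical_solution _ _ bes low])
    show "trig sin (\<lambda>k. a k 0) x = 0" for x by (simp add: trig_def a_def z_def L_def w0)
    show "trig cos (\<lambda>k. b k 0) x = trig cos \<beta> x" for x by (simp add: trig_def b_def z_def L_def w0)
  qed
qed

end

section \<open>Choice of the parameters\<close>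

lemma (in mhd_data) trig_cos_data:
  "trig cos \<beta> x = (\<Sum>m\<in>S. (B0 * norm (wv (m, 0)) * cos (wv (m, 0) \<bullet> x)) *\<^sub>R axis 3 1
     + (B0 * norm (wv (m, - 1)) * cos (wv (m, - 1) \<bullet> x)) *\<^sub>R slanted (of_int m))"
proof -
  let ?f = "\<lambda>k. cos (wv k \<bullet> x) *\<^sub>R \<beta> k"
  have even: "?f (- k) = ?f k" for k by (simp add: \<beta>_even wv_minus)
  have "trig cos \<beta> x = (\<Sum>k\<in>J. ?f k)" by (rule trig_finite[OF finite_J \<beta>_outside])
  also have "\<dots> = (\<Sum>m\<in>S. ?f (m, 0) + ?f (- m, 0) + ?f (m, - 1) + ?f (- m, 1))" by (rule sum_J)
  also have "\<dots> = (\<Sum>m\<in>S. (B0 * norm (wv (m, 0)) * cos (wv (m, 0) \<bullet> x)) *\<^sub>R axis 3 1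
     + (B0 * norm (wv (m, - 1)) * cos (wv (m, - 1) \<bullet> x)) *\<^sub>R slanted (of_int m))"
  proof (rule sum.cong[OF refl])
    fix m assume m: "m \<in> S"
    have e: "?f (- m, 0) = ?f (m, 0)" "?f (- m, 1) = ?f (m, - 1)"
      using even[of "(m, 0)"] even[of "(m, - 1)"] by simp_all
    have gen: "c *\<^sub>R ((B0 / 2 * n) *\<^sub>R y) + c *\<^sub>R ((B0 / 2 * n) *\<^sub>R y) = (B0 * n * c) *\<^sub>R y" for c n and y :: "real ^ 3"
      by (simp add: scaleR_add_left[symmetric] mult.commute)
    have \<beta>: "\<beta> (m, 0) = (B0 / 2 * norm (wv (m, 0))) *\<^sub>R axis 3 1"
      "\<beta> (m, - 1) = (B0 / 2 * norm (wv (m, - 1))) *\<^sub>R slanted (of_int m)"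
      using m S1[OF m] by (simp_all add: \<beta>_def)
    show "?f (m, 0) + ?f (- m, 0) + ?f (m, - 1) + ?f (- m, 1) = (B0 * norm (wv (m, 0)) * cos (wv (m, 0) \<bullet> x)) *\<^sub>R axis 3 1
     + (B0 * norm (wv (m, - 1)) * cos (wv (m, - 1) \<bullet> x)) *\<^sub>R slanted (of_int m)"
      unfolding e \<beta> gen add.assoc gen ..
  qed
  finally show ?thesis .
qed

section \<open>Lacunary frequencies and the sum bound\<close>

fun frequency :: "nat \<Rightarrow> nat \<Rightarrow> nat" where
  "frequency N 0 = N"
| "frequency N (Suc s) = 2 ^ Suc s * N * frequency N s"

text \<open>Doubling is the source of both the frequency gaps and the lacunary sum bound.\<close>

lemma frequency_double:
  assumes "1 \<le> N" shows "2 * frequency N s \<le> frequency N (Suc s)"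
proof -
  have "2 * 1 \<le> (2::nat) ^ Suc s * N" using assms by (intro mult_le_mono) auto
  then have "(2 * 1) * frequency N s \<le> (2 ^ Suc s * N) * frequency N s" by (rule mult_right_mono) simp
  then show ?thesis by simp
qed

lemma frequency_pos: "1 \<le> N \<Longrightarrow> 1 \<le> frequency N s"
proof (induction s)
  case (Suc s)
  then show ?case using frequency_double[of N s] by linarith
qed simp

lemma frequency_mono: "1 \<le> N \<Longrightarrow> s \<le> s' \<Longrightarrow> frequency N s \<le> frequency N s'"
  by (rule lift_Suc_mono_le[of "frequency N"]) (use frequency_double[of N] in \<open>metis le_add2 le_trans mult_2\<close>)

lemma frequency_gap: "1 \<le> N \<Longrightarrow> s < s' \<Longrightarrow> 2 * frequency N s \<le> frequency N s'"
  using frequency_double[of N s] frequency_mono[of N "Suc s" s'] by linarith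

lemma frequency_inj: "1 \<le> N \<Longrightarrow> inj (frequency N)"
proof (rule injI)
  fix s s' assume N: "1 \<le> N" and e: "frequency N s = frequency N s'"
  show "s = s'"
    using frequency_gap[OF N, of s s'] frequency_gap[OF N, of s' s] frequency_pos[OF N, of s] e by (cases s s' rule: linorder_cases) auto
qed

declare frequency.simps [simp del]

text \<open>\<open>1 / (1 + x)\<close> serves as a potential: along a sequence that at least doubles
  in each step the right-hand sides telescope, so the sum of the left-hand sides is bounded
  independently of its length. The 4 comes from
  \<open>(1 + x) * (1 + 2 * x) \<le> 4 * (1 + x\<^sup>2)\<close>.\<close>

lemma gauss_le_telescope:
  assumes x: "0 \<le> x" and y: "2 * x \<le> y"
  shows "x * exp (- x\<^sup>2) \<le> 4 * (1 / (1 + x) - 1 / (1 + y :: real))"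
proof -
  \<comment> \<open>The difference is written as a sum of squares and a positive constant.\<close>
  have "4 * (1 + x\<^sup>2) - (1 + x) * (1 + 2 * x) = 3 / 2 * (x - 1)\<^sup>2 + x\<^sup>2 / 2 + 3 / 2"
    by (simp add: power2_eq_square field_simps)
  moreover have "0 \<le> 3 / 2 * (x - 1)\<^sup>2 + x\<^sup>2 / 2 + 3 / 2" by (intro add_nonneg_nonneg) auto
  ultimately have "(1 + x) * (1 + 2 * x) \<le> 4 * (1 + x\<^sup>2)" by (metis diff_ge_0_iff_ge)
  also have "\<dots> \<le> 4 * exp (x\<^sup>2)" by (rule mult_left_mono[OF exp_ge_add_one_self]) simp
  finally have le: "(1 + x) * (1 + 2 * x) \<le> 4 * exp (x\<^sup>2)" .
  have "inverse e \<le> 4 / p" if "p \<le> 4 * e" "0 < p" "0 < e" for e p :: real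
    using that by (simp add: field_simps)
  from this[OF le] x have "exp (- x\<^sup>2) \<le> 4 / ((1 + x) * (1 + 2 * x))" by (simp add: exp_minus)
  from mult_left_mono[OF this x] have "x * exp (- x\<^sup>2) \<le> 4 * (x / ((1 + x) * (1 + 2 * x)))" by (simp add: mult.commute)
  also have "x / ((1 + x) * (1 + 2 * x)) = 1 / (1 + x) - 1 / (1 + 2 * x)"
    using x by (simp add: field_simps)
  also have "1 / (1 + 2 * x) \<ge> 1 / (1 + y)" using x y by (intro divide_left_mono) auto
  then have "4 * (1 / (1 + x) - 1 / (1 + 2 * x)) \<le> 4 * (1 / (1 + x) - 1 / (1 + y))" by simp
  finally show ?thesis .
qed

lemma lacunary_sum_le:
  assumes "\<And>s. 0 \<le> x s" "\<And>s. 2 * x s \<le> x (Suc s)"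
  shows "(\<Sum>s=1..r. x s * exp (- (x s)\<^sup>2)) \<le> (4 :: real)"
proof -
  have "(\<Sum>s=1..r. x s * exp (- (x s)\<^sup>2)) \<le> (\<Sum>s=1..r. 4 * (1 / (1 + x s) - 1 / (1 + x (Suc s))))"
    by (intro sum_mono gauss_le_telescope assms)
  also have "\<dots> = 4 * (1 / (1 + x 1) - 1 / (1 + x (Suc r)))"
    unfolding sum_distrib_left[symmetric] by (induction r) auto
  also have "\<dots> \<le> 4"
  proof -
    have "1 / (1 + x 1) \<le> 1" "0 \<le> 1 / (1 + x (Suc r))"
      using assms(1)[of 1] assms(1)[of "Suc r"] by (simp_all add: divide_le_eq)
    moreover have "4 * (a - b) \<le> 4" if "a \<le> 1" "0 \<le> b" for a b :: real using that by simp
    ultimately show ?thesis by blast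
  qed
  finally show ?thesis .
qed

lemma torus_cos: "torus_fun (\<lambda>x. cos (wv k \<bullet> x))"
  using torus_trig_cos[of "\<lambda>j. if j = k then 1 else 0 :: real"]
    trig_finite[of "{k}" "\<lambda>j. if j = k then 1 else 0 :: real" cos] by (simp add: fun_eq_iff[symmetric] torus_fun_def)

lemma data_exists:
  fixes N r :: nat and B0 :: real
  assumes N: "1 \<le> N" and r: "1 \<le> r" and B0: "0 < B0"
    and small: "16 * exp ((128 * B0 * real r)\<^sup>2 * (4 * real r)) * (256 * B0\<^sup>2 * (real r)\<^sup>2) \<le> real (frequency N 1)"
  shows "mhd_data ((\<lambda>s. int (frequency N s)) ` {1..r}) B0 (frequency N 1)"
    "card ((\<lambda>s. int (frequency N s)) ` {1..r}) = r"
proof -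
  let ?S = "(\<lambda>s. int (frequency N s)) ` {1..r}"
  have inj: "inj_on (\<lambda>s. int (frequency N s)) {1..r}"
    using frequency_inj[OF N] by (auto simp: inj_on_def)
  show card: "card ?S = r" using card_image[OF inj] by simp
  have K: "frequency N 1 \<le> frequency N s" if "s \<in> {1..r}" for s
    using that by (intro frequency_mono N) auto
  have K2: "2 \<le> frequency N 1" using frequency_double[OF N, of 0] N by (simp add: frequency.simps(1))
  show "mhd_data ?S B0 (frequency N 1)"
  proof
    show "finite ?S" "?S \<noteq> {}" "2 \<le> real (frequency N 1)" "0 < B0" using r K2 B0 by auto
    show "real (frequency N 1) \<le> of_int m" if "m \<in> ?S" for m using that K by auto
    show "real (frequency N 1) \<le> \<bar>of_int m - of_int m'\<bar>" if mm: "m \<in> ?S" "m' \<in> ?S" "m \<noteq> m'" for m m'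
    proof -
      have *: "real (frequency N 1) \<le> real (frequency N s') - real (frequency N s)" if "s \<in> {1..r}" "s < s'" for s s'
      proof -
        \<comment> \<open>From \<open>2 * frequency N s \<le> frequency N s'\<close>, with one copy
          of \<open>frequency N s\<close> replaced by the smaller
          \<open>frequency N 1\<close>.\<close>
        have "frequency N 1 + frequency N s \<le> frequency N s'" using frequency_gap[OF N that(2)] K[OF that(1)] by linarith
        then show ?thesis by linarith
      qed
      obtain s s' where s: "s \<in> {1..r}" "s' \<in> {1..r}" "m = int (frequency N s)" "m' = int (frequency N s')" using mm by auto
      then have "s \<noteq> s'" using mm(3) by auto
      then consider "s < s'" | "s' < s" by linarith
      then show ?thesis using *[OF s(1), of s'] *[OF s(2), of s] s(3,4) by cases auto
    qed
    show "(\<Sum>m\<in>?S. sqrt \<tau> * of_int m * exp (- (of_int m)\<^sup>2 * \<tau>)) \<le> 4" if \<tau>: "0 < \<tau>" for \<tau>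
    proof -
      have "(\<Sum>m\<in>?S. sqrt \<tau> * of_int m * exp (- (of_int m)\<^sup>2 * \<tau>))
        = (\<Sum>s=1..r. (sqrt \<tau> * real (frequency N s)) * exp (- (sqrt \<tau> * real (frequency N s))\<^sup>2))"
        unfolding sum.reindex[OF inj] o_def using \<tau> by (simp add: power_mult_distrib mult.commute)
      also have "\<dots> \<le> 4"
      proof (rule lacunary_sum_le)
        show "2 * (sqrt \<tau> * real (frequency N s)) \<le> sqrt \<tau> * real (frequency N (Suc s))" for s
          using mult_left_mono[of "real (2 * frequency N s)" "real (frequency N (Suc s))" "sqrt \<tau>"] frequency_double[OF N, of s] \<tau>
          by (simp only: of_nat_le_iff) simp
      qed (use \<tau> in simp)
      finally show ?thesis .
    qed
    show "16 * exp ((128 * B0 * real (card ?S))\<^sup>2 * (4 * real (card ?S))) * (1 / real (frequency N 1)) * (256 * B0\<^sup>2 * (real (card ?S))\<^sup>2) \<le> 1"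
      unfolding card using small K2 by (simp add: field_simps)
  qed
qed

lemma wave_parameters_exist:
  assumes N: "1 \<le> N" and r: "1 \<le> r" and Q: "0 < Q"
  shows "wave_parameters Q r (\<lambda>s. wv (int (frequency N s), 0)) (\<lambda>s. wv (int (frequency N s), - 1)) (axis 2 1)
    (\<lambda>s. axis 3 1) (\<lambda>s. slanted (real (frequency N s)))"
proof -
  have n: "norm (wv (int m, 0)) = real m" for m
    using norm_wv_sq[of "(int m, 0)"] by (simp add: power2_eq_iff_nonneg)
  have eta: "axis 2 1 = wv (0, 1)" by (simp add: vec_eq_iff forall_3 axis_def)
  have F: "1 \<le> real (frequency N s)" for s using frequency_pos[OF N, of s] by simp
  have N0: "0 < real N" using N by simp
  show ?thesis
    unfolding wave_parameters_def
  proof (intro conjI ballI)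
    show "wv (int (frequency N 0), 0) \<noteq> 0" using n[of "frequency N 0"] N0 by (auto simp: frequency.simps(1))
    fix s assume s: "s \<in> {1..r}"
    then obtain s' where s': "s = Suc s'" by (cases s) auto
    show "\<exists>c. wv (int (frequency N s), 0) = c *\<^sub>R wv (int (frequency N 0), 0)"
      using N0 by (intro exI[of _ "real (frequency N s) / real N"]) (simp add: vec_eq_iff forall_3 frequency.simps(1))
    show "norm (wv (int (frequency N s), 0)) = 2 ^ s * norm (wv (int (frequency N 0), 0)) * norm (wv (int (frequency N (s - 1)), 0))"
      unfolding n by (simp add: s' frequency.simps)
    show "wv (int (frequency N s), - 1) = wv (int (frequency N s), 0) - axis 2 1"
      unfolding eta by (simp add: wv_diff[symmetric])
    show "torus_fun (\<lambda>x. cos (wv (int (frequency N s), 0) \<bullet> x))" "torus_fun (\<lambda>x. cos (wv (int (frequency N s), - 1) \<bullet> x))"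
      by (rule torus_cos)+
    show "slanted (real (frequency N s)) \<in> sphere 0 1" using norm_slanted[OF F] by simp
    show "wv (int (frequency N s), - 1) \<bullet> slanted (real (frequency N s)) = 0"
      using F[of s] by (simp add: inner_3)
    show "axis 2 1 \<bullet> slanted (real (frequency N s)) = 1 / 2" by (simp add: inner_axis')
  qed (use Q r in \<open>auto simp: inner_3 axis_def norm_eq_sqrt_inner\<close>)
qed

theorem theorem5p1:
  "\<exists>C>0. \<forall>\<delta>>0. \<exists>(Q::real) (r::nat) k k' \<eta> v v'.
     wave_parameters Q r k k' \<eta> v v' \<and>
     hom_besov_norm (b_init Q r k k' v v') \<le> ennreal (C * \<delta>) \<and>
     (\<exists>T u b p.
        0 < T \<and> T < \<delta> \<and>
        mhd_solution T u b p \<and>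
        (\<forall>x. u 0 x = 0) \<and> (\<forall>x. b 0 x = b_init Q r k k' v v' x) \<and>
        ennreal (1 / \<delta>) \<le> ennreal C * hom_besov_norm (u T) \<and>
        (\<forall>t. 0 < t \<and> t < T \<longrightarrow> besov_norm (b t) \<le> ennreal (C * \<delta>)))"
proof (rule exI[of _ 864], intro conjI allI impI)
  fix \<delta> :: real assume \<delta>: "0 < \<delta>"
  \<comment> \<open>Capping at 1 ensures \<open>1 / d ^ 3 \<ge> 1\<close>, hence
    \<open>r \<ge> 1\<close>; upper bounds by \<open>d\<close> imply those by \<delta>.\<close>
  define d where "d = min \<delta> 1"
  have d: "0 < d" "d \<le> 1" "d \<le> \<delta>" using \<delta> by (auto simp: d_def)
  \<comment> \<open>\<open>Q\<^sup>2 = 1 / d\<close> makes \<open>B0\<^sup>2 * r = 1 / d\<close>,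
    the size of the resonant velocity. Spreading this over at least \<open>1 / d ^ 3\<close> waves
    lowers the amplitude to \<open>B0 \<le> d\<close>.\<close>
  define Q where "Q = 1 / sqrt d"
  define r where "r = nat \<lceil>1 / d ^ 3\<rceil>"
  define B0 where "B0 = Q / sqrt (real r)"
  have rr: "1 / d ^ 3 \<le> real r" unfolding r_def by linarith
  moreover have "1 \<le> 1 / d ^ 3" using d by (simp add: power_le_one)
  ultimately have r1: "1 \<le> real r" by linarith
  then have r: "1 \<le> r" by simp
  have Q: "0 < Q" "Q\<^sup>2 = 1 / d" using d by (auto simp: Q_def power_divide)
  have Bf: "0 < B0" "B0\<^sup>2 * real r = 1 / d" using Q r1 by (auto simp: B0_def power_divide)
  have B0d: "B0 \<le> d"
  proof (rule power2_le_imp_le)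
    have "B0\<^sup>2 * (1 / d ^ 3) \<le> 1 / d" using mult_left_mono[OF rr, of "B0\<^sup>2"] Bf(2) by simp
    then show "B0\<^sup>2 \<le> d\<^sup>2" using d by (simp add: field_simps power2_eq_square power3_eq_cube)
  qed (use d in simp)
  define c0 where "c0 = exp ((128 * B0 * real r)\<^sup>2 * (4 * real r))"
  define A0 where "A0 = 256 * B0\<^sup>2 * (real r)\<^sup>2"
  \<comment> \<open>Chosen for \<open>Rem \<le> D / K\<close>, with \<open>T\<close> replaced by the
    larger \<open>1 / K\<close>. Like \<open>c0\<close> and \<open>A0\<close> it does not involve
    the base frequency, so \<open>N\<close> can be chosen afterwards.\<close>
  define D where "D = 32 * B0 * c0 * (4 * real r) * A0 + 8 * c0\<^sup>2 * A0\<^sup>2"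
  have nn: "0 \<le> c0" "0 \<le> A0" "0 \<le> D" using Bf by (auto simp: c0_def A0_def D_def)
  \<comment> \<open>Each summand secures one requirement on \<open>K\<close>:
    \<open>K \<ge> 2\<close>, the smallness condition of \<open>mhd_data\<close>,
    \<open>Rem \<le> d\<close>, errors below half of the main term, and
    \<open>T < d\<close>.\<close>
  define N where "N = nat \<lceil>2 + 16 * c0 * A0 + D / d + 864 * d * (A0 + 2 * D) + 1 / d\<rceil>"
  have N: "2 + 16 * c0 * A0 + D / d + 864 * d * (A0 + 2 * D) + 1 / d \<le> real N" unfolding N_def by linarith
  have parts: "0 \<le> 16 * c0 * A0" "0 \<le> D / d" "0 \<le> 864 * d * (A0 + 2 * D)" "0 \<le> 1 / d" using nn d by auto
  then have N1: "1 \<le> N" using N by linarith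
  define K where "K = real (frequency N 1)"
  have "N \<le> frequency N 1" using frequency_double[OF N1, of 0] by (simp add: frequency.simps(1))
  then have NK: "real N \<le> K" by (simp add: K_def)
  have Kb: "2 \<le> K" "16 * c0 * A0 \<le> K" "D / d \<le> K" "864 * d * (A0 + 2 * D) \<le> K" "1 / d < K"
    using N NK parts by linarith+
  define S where "S = (\<lambda>s. int (frequency N s)) ` {1..r}"
  have cardS: "card S = r" and data: "mhd_data S B0 K"
    using data_exists[OF N1 r Bf(1)] Kb(2) by (simp_all add: S_def K_def c0_def A0_def)
  interpret mhd_data S B0 K by (rule data)
  have ET: "exp (lam * real (card J)) = c0" by (simp add: lam_def card_J cardS c0_def)
  have AA: "A = A0" by (simp add: A_def cardS A0_def)
  have RemD: "Rem \<le> D / K"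
  proof -
    have "T = 1 / K\<^sup>2" by (rule T_def)
    also have "\<dots> \<le> 1 / K" using Kb(1) by (intro divide_left_mono) (auto simp: power2_eq_square)
    finally have "8 * c0\<^sup>2 * T * A0\<^sup>2 \<le> 8 * c0\<^sup>2 * (1 / K) * A0\<^sup>2" by (intro mult_right_mono mult_left_mono) auto
    then show ?thesis unfolding Rem_def ET AA unfolding card_J cardS D_def by (simp add: add_divide_distrib)
  qed
  have "D / K \<le> d" using Kb(1,3) d by (simp add: field_simps)
  with RemD have Rd: "Rem \<le> d" by linarith
  \<comment> \<open>Of the main term \<open>1 / (432 * d)\<close> one half is kept and the other
    half absorbs the errors, whence the constant 864.\<close>
  have low: "1 / (864 * d) \<le> B0\<^sup>2 * real (card S) / 432 - A / K - 2 * Rem"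
  proof -
    have "A0 / K + 2 * (D / K) \<le> 1 / (864 * d)" using Kb(1,4) d by (simp add: field_simps)
    moreover have "B0\<^sup>2 * real (card S) / 432 = 1 / (864 * d) + 1 / (864 * d)" using Bf(2) by (simp add: cardS)
    ultimately show ?thesis using RemD by (simp add: AA)
  qed
  obtain u b p where sol: "mhd_solution T u b p" "\<And>x. u 0 x = 0" "\<And>x. b 0 x = trig cos \<beta> x"
    "\<And>t. t \<in> {0..T} \<Longrightarrow> besov_norm (b t) \<le> ennreal (12 * B0 + Rem)"
    "ennreal (B0\<^sup>2 * real (card S) / 432 - A / K - 2 * Rem) \<le> hom_besov_norm (u T)"
    by (rule data_solution) blast
  let ?k = "\<lambda>s. wv (int (frequency N s), 0)" and ?k' = "\<lambda>s. wv (int (frequency N s), - 1)"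
  let ?v = "\<lambda>s::nat. axis 3 1 :: real ^ 3" and ?v' = "\<lambda>s. slanted (real (frequency N s))"
  have inj: "inj_on (\<lambda>s. int (frequency N s)) {1..r}"
    using frequency_inj[OF N1] by (auto simp: inj_on_def)
  have init: "b_init Q r ?k ?k' ?v ?v' = trig cos \<beta>"
  proof
    fix x
    let ?F = "\<lambda>m. (B0 * norm (wv (m, 0)) * cos (wv (m, 0) \<bullet> x)) *\<^sub>R axis 3 1
      + (B0 * norm (wv (m, - 1)) * cos (wv (m, - 1) \<bullet> x)) *\<^sub>R slanted (of_int m)"
    have "trig cos \<beta> x = (\<Sum>m\<in>S. ?F m)" by (rule trig_cos_data)
    also have "\<dots> = (\<Sum>s=1..r. ?F (int (frequency N s)))"
      unfolding S_def by (rule sum.reindex[OF inj, unfolded o_def])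
    finally show "b_init Q r ?k ?k' ?v ?v' x = trig cos \<beta> x"
      unfolding b_init_def B0_def[symmetric]
      by (simp add: scaleR_sum_right scaleR_add_right mult.assoc)
  qed
  have low': "ennreal (1 / \<delta>) \<le> ennreal 864 * hom_besov_norm (u T)"
  proof -
    have "1 / \<delta> \<le> 864 * (1 / (864 * d))" using d by (simp add: frac_le)
    also have "\<dots> \<le> 864 * (B0\<^sup>2 * real (card S) / 432 - A / K - 2 * Rem)" by (intro mult_left_mono low) simp
    finally have "ennreal (1 / \<delta>) \<le> ennreal (864 * (B0\<^sup>2 * real (card S) / 432 - A / K - 2 * Rem))" by (rule ennreal_leI)
    also have "\<dots> = ennreal 864 * ennreal (B0\<^sup>2 * real (card S) / 432 - A / K - 2 * Rem)"
      using order_trans[OF _ low, of 0] d by (intro ennreal_mult) auto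
    also have "\<dots> \<le> ennreal 864 * hom_besov_norm (u T)" by (intro mult_left_mono sol(5)) simp
    finally show ?thesis .
  qed
  have T\<delta>: "T < \<delta>"
  proof -
    have "1 / K\<^sup>2 \<le> 1 / K" using Kb(1) by (intro divide_left_mono) (auto simp: power2_eq_square)
    also have "\<dots> < d" using Kb(1,5) d by (simp add: field_simps)
    finally show ?thesis using d by (simp add: T_def)
  qed
  have le: "12 * B0 + Rem \<le> 864 * \<delta>" "12 * B0 \<le> 864 * \<delta>" using B0d Rd d by linarith+
  show "\<exists>(Q::real) (r::nat) k k' \<eta> v v'.
     wave_parameters Q r k k' \<eta> v v' \<and>
     hom_besov_norm (b_init Q r k k' v v') \<le> ennreal (864 * \<delta>) \<and>
     (\<exists>T u b p.
        0 < T \<and> T < \<delta> \<and>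
        mhd_solution T u b p \<and>
        (\<forall>x. u 0 x = 0) \<and> (\<forall>x. b 0 x = b_init Q r k k' v v' x) \<and>
        ennreal (1 / \<delta>) \<le> ennreal 864 * hom_besov_norm (u T) \<and>
        (\<forall>t. 0 < t \<and> t < T \<longrightarrow> besov_norm (b t) \<le> ennreal (864 * \<delta>)))"
  proof (intro exI conjI allI impI)
    show "wave_parameters Q r ?k ?k' (axis 2 1) ?v ?v'" by (rule wave_parameters_exist[OF N1 r Q(1)])
    show "hom_besov_norm (b_init Q r ?k ?k' ?v ?v') \<le> ennreal (864 * \<delta>)"
      unfolding init using order_trans[OF data_hom_besov ennreal_leI[OF le(2)]] .
    show "0 < T" by (rule pos(1))
    show "T < \<delta>" by (rule T\<delta>)
    show "mhd_solution T u b p" by (rule sol(1))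
    show "u 0 x = 0" for x by (rule sol(2))
    show "b 0 x = b_init Q r ?k ?k' ?v ?v' x" for x unfolding init by (rule sol(3))
    show "ennreal (1 / \<delta>) \<le> ennreal 864 * hom_besov_norm (u T)" by (rule low')
    show "besov_norm (b t) \<le> ennreal (864 * \<delta>)" if "0 < t \<and> t < T" for t
      using order_trans[OF sol(4) ennreal_leI[OF le(1)]] that by auto
  qed
qed simp

end
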